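(* Assume Hypotheses (H1), (H2) and (H3) hold for $\alpha=1,2$, that $\mu_\alpha=\mu_\alpha^0$ for $\alpha=1,2$, and that $\varphi_1(0)\varphi_2(0)=0$. Then the operator $H$ has only finitely many eigenvalues lying outside its essential spectrum.
   Context: Let $\mathbb{T}^3=(-\pi,\pi]^3$ be the three-dimensional torus, and for $\delta>0$ let $U_\delta(0)=\{p\in\mathbb{T}^3:|p|<\delta\}$. Let $u:(\mathbb{T}^3)^2\to\mathbb{R}$ be essentially bounded, let $\varphi_1,\varphi_2\in L_2(\mathbb{T}^3)$ be real-valued, and let $\mu_1,\mu_2>0$. The operator $H=H_0-\mu_1V_1-\mu_2V_2$ acts on $L_2((\mathbb{T}^3)^2)$ by $(H_0f)(p,q)=u(p,q)f(p,q)$, $(V_1f)(p,q)=\varphi_1(p)\int_{\mathbb{T}^3}\varphi_1(t)f(t,q)\,dt$, $(V_2f)(p,q)=\varphi_2(q)\int_{\mathbb{T}^3}\varphi_2(t)f(p,t)\,dt$. Throughout, $\alpha,\beta\in\{1,2\}$ with $\alpha\neq\beta$. Set $u^{(1)}_p(q)=u(q,p)$, $u^{(2)}_p(q)=u(p,q)$, $m=\min_{p,q}u(p,q)$, and $\Lambda_\alpha(p,z)=\int_{\mathbb{T}^3}\frac{\varphi_\alpha^2(t)\,dt}{u^{(\alpha)}_p(t)-z}$. Define $\mu_\alpha^0=\Lambda_\alpha(0,m)^{-1}$. For $1/2<\theta\le1$, $\mathcal{B}(\theta,\mathbb{T}^d)$ denotes the closure of the smooth periodic functions with respect to the norm $\|f\|_\theta=\sup_{t,\ell,\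 \ell\ne0}\big[|f(t)|+|\ell|^{-\theta}|f(t+\ell)-f(t)|\big]$. (H1) (i) $u$ is even with respect to $(p,q)$, has a unique non-degenerate minimum at $(0,0)$, and all its third-order partial derivatives belong to $\mathcal{B}(\theta,(\mathbb{T}^3)^2)$ for some $1/2<\theta\le1$. (ii) There exist a positive definite $3\times3$ matrix $U$ and reals $l_1,l_2>0$, $l\ne0$ such that $\big(\partial^2u(0,0)/\partial p^{(i)}\partial p^{(j)}\big)=l_1U$, $\big(\partial^2u(0,0)/\partial p^{(i)}\partial q^{(j)}\big)=lU$ and $\big(\partial^2u(0,0)/\partial q^{(i)}\partial q^{(j)}\big)=l_2U$. (H2) Each $\varphi_\alpha\in C^{(2)}(\mathbb{T}^3)$ and is either even or odd. (H3) $\Lambda_\alpha(\cdot,m)$ has a unique maximum at the origin, and for some $c,\delta>0$ one has $\Lambda_\alpha(0,m)-\Lambda_\alpha(p,m)>c|p|^2$ for all $0\ne p\in U_\delta(0)$. *)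

theory Defs
  imports "HOL-Analysis.Analysis"
begin

text \<open>The torus is modelled by the fundamental domain (-pi,pi]^d inside a Euclidean
  space; functions on the torus are 2pi-periodic functions on the whole space.\<close>

definition torus_box :: "'a::euclidean_space set" where
  "torus_box = {x. \<forall>b\<in>Basis. - pi < x \<bullet> b \<and> x \<bullet> b \<le> pi}"

definition periodic_fun :: "('a::euclidean_space \<Rightarrow> 'b) \<Rightarrow> bool" where
  "periodic_fun f \<longleftrightarrow> (\<forall>x. \<forall>b\<in>Basis. f (x + (2 * pi) *\<^sub>R b) = f x)"

definition partial :: "('a::real_normed_vector \<Rightarrow> real) \<Rightarrow> 'a \<Rightarrow> 'a \<Rightarrow> real" where
  "partial f e x = deriv (\<lambda>t. f (x + t *\<^sub>R e)) 0"

fun ipartial :: "('a::real_normed_vector \<Rightarrow> real) \<Rightarrow> 'a list \<Rightarrow> 'a \<Rightarrow> real" where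
  "ipartial f [] = f"
| "ipartial f (e # es) = partial (ipartial f es) e"

definition C_k :: "nat \<Rightarrow> ('a::euclidean_space \<Rightarrow> real) \<Rightarrow> bool" where
  "C_k k f \<longleftrightarrow>
     (\<forall>es. set es \<subseteq> Basis \<and> length es \<le> k \<longrightarrow> continuous_on UNIV (ipartial f es)) \<and>
     (\<forall>es e x. set es \<subseteq> Basis \<and> length es < k \<and> e \<in> Basis \<longrightarrow>
        (\<lambda>t. ipartial f es (x + t *\<^sub>R e)) differentiable (at 0))"

definition smooth_fun :: "('a::euclidean_space \<Rightarrow> real) \<Rightarrow> bool" where
  "smooth_fun f \<longleftrightarrow> (\<forall>k. C_k k f)"

text \<open>B(theta, T^d): closure of smooth periodic functions w.r.t. the norm
  sup_{t, l in T^d, l \<noteq> 0} [ |f t| + |l|^(-theta) |f(t+l) - f t| ].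
  f lies in the closure iff for every eps > 0 some smooth periodic g has
  ||f - g||_theta \<le> eps.\<close>

definition holder_B :: "real \<Rightarrow> ('a::euclidean_space \<Rightarrow> real) \<Rightarrow> bool" where
  "holder_B \<theta> f \<longleftrightarrow> periodic_fun f \<and>
     (\<forall>\<epsilon>>0. \<exists>g. smooth_fun g \<and> periodic_fun g \<and>
        (\<forall>t l. l \<in> torus_box \<and> l \<noteq> 0 \<longrightarrow>
           \<bar>f t - g t\<bar> + norm l powr (- \<theta>) * \<bar>(f (t + l) - g (t + l)) - (f t - g t)\<bar> \<le> \<epsilon>))"

definition u_sec :: "((real^3) \<times> (real^3) \<Rightarrow> real) \<Rightarrow> nat \<Rightarrow> real^3 \<Rightarrow> real^3 \<Rightarrow> real" where
  "u_sec u \<alpha> p t = (if \<alpha> = 1 then u (t, p) else u (p, t))"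

definition umin :: "((real^3) \<times> (real^3) \<Rightarrow> real) \<Rightarrow> real" where
  "umin u = Inf (u ` torus_box)"

definition Lambda :: "((real^3) \<times> (real^3) \<Rightarrow> real) \<Rightarrow> (real^3 \<Rightarrow> real) \<Rightarrow> nat \<Rightarrow> real^3 \<Rightarrow> real \<Rightarrow> real" where
  "Lambda u \<phi> \<alpha> p z = (\<integral>t. (\<phi> t)\<^sup>2 / (u_sec u \<alpha> p t - z) \<partial>(lebesgue_on torus_box))"

definition mu0 :: "((real^3) \<times> (real^3) \<Rightarrow> real) \<Rightarrow> (real^3 \<Rightarrow> real) \<Rightarrow> nat \<Rightarrow> real" where
  "mu0 u \<phi> \<alpha> = 1 / Lambda u \<phi> \<alpha> 0 (umin u)"

definition posdef3 :: "real^3^3 \<Rightarrow> bool" where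
  "posdef3 U \<longleftrightarrow> (\<forall>x. x \<noteq> 0 \<longrightarrow> 0 < x \<bullet> (U *v x))"

definition hyp_H1 :: "((real^3) \<times> (real^3) \<Rightarrow> real) \<Rightarrow> bool" where
  "hyp_H1 u \<longleftrightarrow>
     periodic_fun u \<and>
     (\<forall>x. u (- x) = u x) \<and>
     (\<forall>x\<in>torus_box. x \<noteq> 0 \<longrightarrow> u 0 < u x) \<and>
     C_k 3 u \<and>
     (\<forall>v. (\<forall>c\<in>Basis. (\<Sum>b\<in>Basis. (v \<bullet> b) * ipartial u [b, c] 0) = 0) \<longrightarrow> v = 0) \<and>
     (\<exists>\<theta>. 1/2 < \<theta> \<and> \<theta> \<le> 1 \<and>
        (\<forall>es. set es \<subseteq> Basis \<and> length es = 3 \<longrightarrow> holder_B \<theta> (ipartial u es))) \<and>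
     (\<exists>U l1 l2 l. posdef3 U \<and> l1 > 0 \<and> l2 > 0 \<and> l \<noteq> 0 \<and>
        (\<forall>i j. ipartial u [(axis i 1, 0), (axis j 1, 0)] 0 = l1 * U $ i $ j \<and>
               ipartial u [(axis i 1, 0), (0, axis j 1)] 0 = l * U $ i $ j \<and>
               ipartial u [(0, axis i 1), (0, axis j 1)] 0 = l2 * U $ i $ j))"

definition hyp_H2 :: "(real^3 \<Rightarrow> real) \<Rightarrow> bool" where
  "hyp_H2 \<phi> \<longleftrightarrow> periodic_fun \<phi> \<and> C_k 2 \<phi> \<and>
     ((\<forall>p. \<phi> (- p) = \<phi> p) \<or> (\<forall>p. \<phi> (- p) = - \<phi> p))"

definition hyp_H3 :: "((real^3) \<times> (real^3) \<Rightarrow> real) \<Rightarrow> (real^3 \<Rightarrow> real) \<Rightarrow> nat \<Rightarrow> bool" where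
  "hyp_H3 u \<phi> \<alpha> \<longleftrightarrow>
     (\<forall>p\<in>torus_box. p \<noteq> 0 \<longrightarrow> Lambda u \<phi> \<alpha> p (umin u) < Lambda u \<phi> \<alpha> 0 (umin u)) \<and>
     (\<exists>c \<delta>. c > 0 \<and> \<delta> > 0 \<and>
        (\<forall>p\<in>torus_box. p \<noteq> 0 \<and> norm p < \<delta> \<longrightarrow>
           Lambda u \<phi> \<alpha> 0 (umin u) - Lambda u \<phi> \<alpha> p (umin u) > c * (norm p)\<^sup>2))"

abbreviation T6 :: "((real^3) \<times> (real^3)) set" where
  "T6 \<equiv> torus_box"

definition L2fun :: "((real^3) \<times> (real^3) \<Rightarrow> complex) \<Rightarrow> bool" where
  "L2fun f \<longleftrightarrow> f \<in> borel_measurable (lebesgue_on T6) \<and>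
     integrable (lebesgue_on T6) (\<lambda>x. (cmod (f x))\<^sup>2)"

definition L2inner :: "((real^3) \<times> (real^3) \<Rightarrow> complex) \<Rightarrow> ((real^3) \<times> (real^3) \<Rightarrow> complex) \<Rightarrow> complex" where
  "L2inner f g = (\<integral>x. f x * cnj (g x) \<partial>(lebesgue_on T6))"

definition L2norm2 :: "((real^3) \<times> (real^3) \<Rightarrow> complex) \<Rightarrow> real" where
  "L2norm2 f = (\<integral>x. (cmod (f x))\<^sup>2 \<partial>(lebesgue_on T6))"

definition Hop :: "((real^3) \<times> (real^3) \<Rightarrow> real) \<Rightarrow> (real^3 \<Rightarrow> real) \<Rightarrow> (real^3 \<Rightarrow> real) \<Rightarrow> real \<Rightarrow> real
     \<Rightarrow> ((real^3) \<times> (real^3) \<Rightarrow> complex) \<Rightarrow> ((real^3) \<times> (real^3) \<Rightarrow> complex)" where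
  "Hop u \<phi>1 \<phi>2 \<mu>1 \<mu>2 f = (\<lambda>(p, q).
      complex_of_real (u (p, q)) * f (p, q)
    - complex_of_real (\<mu>1 * \<phi>1 p) * (\<integral>t. complex_of_real (\<phi>1 t) * f (t, q) \<partial>(lebesgue_on torus_box))
    - complex_of_real (\<mu>2 * \<phi>2 q) * (\<integral>t. complex_of_real (\<phi>2 t) * f (p, t) \<partial>(lebesgue_on torus_box)))"

definition is_eigenvalue :: "(((real^3) \<times> (real^3) \<Rightarrow> complex) \<Rightarrow> ((real^3) \<times> (real^3) \<Rightarrow> complex)) \<Rightarrow> complex \<Rightarrow> bool" where
  "is_eigenvalue H z \<longleftrightarrow> (\<exists>f. L2fun f \<and> \<not> (AE x in lebesgue_on T6. f x = 0) \<and>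
      (AE x in lebesgue_on T6. H f x = z * f x))"

text \<open>Essential spectrum of the (bounded self-adjoint) operator H, via Weyl's criterion:
  z is in the essential spectrum iff there is an orthonormal sequence f_n with
  ||(H - z) f_n|| \<rightarrow> 0.\<close>

definition ess_spectrum :: "(((real^3) \<times> (real^3) \<Rightarrow> complex) \<Rightarrow> ((real^3) \<times> (real^3) \<Rightarrow> complex)) \<Rightarrow> complex set" where
  "ess_spectrum H = {z. \<exists>F :: nat \<Rightarrow> ((real^3) \<times> (real^3) \<Rightarrow> complex).
      (\<forall>n. L2fun (F n)) \<and>
      (\<forall>n m. L2inner (F n) (F m) = (if n = m then 1 else 0)) \<and>
      (\<lambda>n. L2norm2 (\<lambda>x. H (F n) x - z * F n x)) \<longlonglongrightarrow> 0}"

end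

(* Put w = u - m, g1(q) = int phi1(t) f(t,q) dt, g2(p) = int phi2(t) f(p,t) dt and
   D_a = 1 - mu_a Lambda_a(., m), which is nonnegative and vanishes only at 0.

   An eigenvalue in the range of u is in the essential spectrum (Weyl sequence of normalised
   indicators of shrinking cubes), and one outside the range of u must lie below m. On the span of
   N eigenfunctions below m the energy <(H - m) f, f> is negative, and completing the square in
   int w f^2 turns this into
     |x1|^2 + |x2|^2 < 2 int K(p,q) x2(p) x1(q) dp dq,   x_a = sqrt(mu_a D_a) g_a,
     K(p,q) = sqrt(mu1 mu2) phi1(p) phi2(q) / (w(p,q) sqrt(D_1(q) D_2(p))).
   Orthonormalising in (x1, x2) yields N <= |K|^2 in L_2, so it remains to see that K is square
   integrable. Near the origin w >= c (|p|^2 + |q|^2). If phi_a(0) = 0 then phi_a is O(|p|) and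
   D_a >= c |p|^2 by (H3). If phi_a(0) <> 0 then D_a >= c |p|: compare 1/w with the inverse of
   its Hessian form in an ellipsoid of size R|p|, where translating the form only decreases the
   integral, and use evenness to bound the rest by second differences. As phi1(0) phi2(0) = 0, at
   most one phi_a is nonzero at 0, and K^2 <= C |p|^(-5/2) |q|^(-5/2). *)
theory Submission
  imports Defs
begin

section \<open>Partial derivatives and Taylor's formula\<close>

text \<open>The exponents are forced by homogeneity. Let k_a be 1 if phi_a vanishes at 0 and 0
  otherwise; then D_a is bounded below by a multiple of |p|^(1 + k_a), and K^2 is bounded by a
  function of degree k1 + k2 - 6 in six variables, where degree -6 diverges logarithmically. The
  condition on phi1(0) phi2(0) supplies at least one missing power; at a resonant factor the
  quadratic bound of (H3) would lose it again. Degree -5 is split evenly between p and q, and 5/2 <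
  3 makes each factor integrable. The linear gap has the same obstacle: first differences of 1/w are
  of order |p|/|t|^3 and integrate to |p| log(1/|p|), more than the gain |p|. Averaging over p and
  -p leaves second differences of order |p|^2/|t|^4 and removes the logarithm. No min-max principle
  and no description of the essential spectrum enters. Every eigenvalue outside the range of u is
  counted, whether or not it lies in the essential spectrum, by one real eigenfunction each.\<close>

lemma ipartial_DERIV:
  assumes "C_k k f" "set es \<subseteq> Basis" "length es < k" "e \<in> Basis"
  shows "((\<lambda>t. ipartial f es (x + t *\<^sub>R e)) has_real_derivative ipartial f (e # es) (x + s *\<^sub>R e)) (at s)"
proof -
  \<comment> \<open>\<open>C_k\<close> asserts differentiability only at parameter 0 of a line, but
    through every base point; moving the base point to x + s e gives it at parameter
    \<open>s\<close>.\<close>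
  have "(\<lambda>t. ipartial f es ((x + s *\<^sub>R e) + t *\<^sub>R e)) differentiable (at 0)"
    using assms by (auto simp: C_k_def)
  then have "((\<lambda>t. ipartial f es ((x + s *\<^sub>R e) + t *\<^sub>R e)) has_real_derivative ipartial f (e # es) (x + s *\<^sub>R e)) (at (s - s))"
    by (simp add: partial_def DERIV_deriv_iff_real_differentiable)
  then have "((\<lambda>t. ipartial f es ((x + s *\<^sub>R e) + (t - s) *\<^sub>R e)) has_real_derivative ipartial f (e # es) (x + s *\<^sub>R e) * 1) (at s)"
    by (rule DERIV_chain2) (auto intro!: derivative_eq_intros)
  then show ?thesis by (simp add: algebra_simps)
qed

lemma C_k_continuous:
  assumes "C_k k f" "set es \<subseteq> Basis" "length es \<le> k"
  shows "continuous_on UNIV (ipartial f es)"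
  using assms by (auto simp: C_k_def)

lemma continuous_on_UNIV_ball:
  fixes f :: "'a::real_normed_vector \<Rightarrow> real"
  assumes "continuous_on UNIV f" "\<epsilon> > 0"
  obtains d where "d > 0" "\<And>y. norm (y - x) < d \<Longrightarrow> \<bar>f y - f x\<bar> < \<epsilon>"
  using assms unfolding continuous_on_iff dist_norm real_norm_def by (metis UNIV_I)

lemma ipartial_MVT:
  assumes "C_k k f" "set es \<subseteq> Basis" "length es < k" "e \<in> Basis"
  obtains \<theta> where "\<bar>\<theta>\<bar> \<le> \<bar>t\<bar>" "ipartial f es (x + t *\<^sub>R e) - ipartial f es x = t * ipartial f (e # es) (x + \<theta> *\<^sub>R e)"
proof -
  note D = ipartial_DERIV[OF assms, of x]
  consider "t = 0" | "t > 0" | "t < 0" by linarith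
  then show ?thesis
  proof cases
    case 1 then show ?thesis by (intro that[of 0]) auto
  next
    case 2
    obtain z where "0 < z" "z < t" "ipartial f es (x + t *\<^sub>R e) - ipartial f es (x + 0 *\<^sub>R e) = (t - 0) * ipartial f (e # es) (x + z *\<^sub>R e)"
      using MVT2[OF 2, of "\<lambda>t. ipartial f es (x + t *\<^sub>R e)" "\<lambda>s. ipartial f (e # es) (x + s *\<^sub>R e)"] D by blast
    then show ?thesis by (intro that[of z]) auto
  next
    case 3
    obtain z where "t < z" "z < 0" "ipartial f es (x + 0 *\<^sub>R e) - ipartial f es (x + t *\<^sub>R e) = (0 - t) * ipartial f (e # es) (x + z *\<^sub>R e)"
      using MVT2[OF 3, of "\<lambda>t. ipartial f es (x + t *\<^sub>R e)" "\<lambda>s. ipartial f (e # es) (x + s *\<^sub>R e)"] D by blast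
    then show ?thesis by (intro that[of z]) auto
  qed
qed

text \<open>Continuity of the partial derivatives upgrades coordinatewise to total
  differentiability: the coordinates of the increment are added one at a time, each by a mean value
  step along one axis, and continuity replaces the partial derivative at the intermediate point by
  its value at \<open>x0\<close>.\<close>

lemma partials_strict_derivative:
  fixes f :: "'a::euclidean_space \<Rightarrow> real"
  assumes f: "C_k k f" and es: "set es \<subseteq> Basis" "length es < k" and S: "finite S" "S \<subseteq> Basis"
    and "\<epsilon> > 0"
  shows "\<exists>\<delta>>0. \<forall>x h. norm (x - x0) < \<delta> \<longrightarrow> norm h < \<delta> \<longrightarrow>
     \<bar>ipartial f es (x + (\<Sum>b\<in>S. (h \<bullet> b) *\<^sub>R b)) - ipartial f es x
        - (\<Sum>b\<in>S. (h \<bullet> b) * ipartial f (b # es) x0)\<bar> \<le> \<epsilon> * norm h"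
  using S \<open>\<epsilon> > 0\<close>
proof (induction S arbitrary: \<epsilon> rule: finite_induct)
  case empty
  then show ?case by (intro exI[of _ 1]) auto
next
  case (insert b S)
  let ?g = "ipartial f es"
  have b: "b \<in> Basis" using insert by auto
  obtain \<delta>1 where \<delta>1: "\<delta>1 > 0" and
    1: "\<And>x h. norm (x - x0) < \<delta>1 \<Longrightarrow> norm h < \<delta>1 \<Longrightarrow>
     \<bar>?g (x + (\<Sum>b\<in>S. (h \<bullet> b) *\<^sub>R b)) - ?g x
        - (\<Sum>b\<in>S. (h \<bullet> b) * ipartial f (b # es) x0)\<bar> \<le> \<epsilon>/2 * norm h"
    using insert.IH[of "\<epsilon>/2"] insert.prems by auto
  obtain \<delta>2 where \<delta>2: "\<delta>2 > 0" and
    2: "\<And>y. norm (y - x0) < \<delta>2 \<Longrightarrow> \<bar>ipartial f (b # es) y - ipartial f (b # es) x0\<bar> < \<epsilon>/2"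
    using continuous_on_UNIV_ball[OF C_k_continuous[OF f, of "b # es"], of "\<epsilon>/2" x0] b es insert.prems
    by auto
  \<comment> \<open>The mean value point lies within |x - x0| + (card S + 1) |h| of
    \<open>x0\<close>; with n = card S + 2 it suffices to keep both norms below \<delta>2/n.\<close>
  define n where "n = real (card S) + 2"
  have n: "n \<ge> 2" by (simp add: n_def)
  show ?case
  proof (intro exI[of _ "min \<delta>1 (\<delta>2/n)"] conjI allI impI)
    show "0 < min \<delta>1 (\<delta>2/n)" using \<delta>1 \<delta>2 n by simp
    fix x h :: 'a assume x: "norm (x - x0) < min \<delta>1 (\<delta>2/n)" and h: "norm h < min \<delta>1 (\<delta>2/n)"
    define y where "y = x + (\<Sum>b\<in>S. (h \<bullet> b) *\<^sub>R b)"
    obtain \<theta> where \<theta>: "\<bar>\<theta>\<bar> \<le> \<bar>h \<bullet> b\<bar>" "?g (y + (h \<bullet> b) *\<^sub>R b) - ?g y = (h \<bullet> b) * ipartial f (b # es) (y + \<theta> *\<^sub>R b)"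
      using ipartial_MVT[OF f es b] by blast
    have hb: "\<bar>h \<bullet> c\<bar> \<le> norm h" if "c \<in> Basis" for c
      using Basis_le_norm[OF that] by simp
    have "norm (\<Sum>b\<in>S. (h \<bullet> b) *\<^sub>R b) \<le> real (card S) * norm h"
      using insert.prems hb by (intro sum_norm_bound) (auto)
    moreover have "norm (\<theta> *\<^sub>R b) \<le> norm h" using b \<theta> hb[OF b] by simp
    moreover have "norm (y + \<theta> *\<^sub>R b - x0) \<le> norm (x - x0) + norm (\<Sum>b\<in>S. (h \<bullet> b) *\<^sub>R b) + norm (\<theta> *\<^sub>R b)"
      unfolding y_def by (smt (verit) add.assoc add.commute add_diff_eq norm_triangle_ineq)
    ultimately have "norm (y + \<theta> *\<^sub>R b - x0) \<le> norm (x - x0) + (n - 1) * norm h"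
      by (simp add: n_def algebra_simps)
    also have "\<dots> < \<delta>2/n + (n - 1) * (\<delta>2/n)"
      using x h n by (intro add_less_le_mono mult_left_mono) auto
    also have "\<dots> = \<delta>2" using n by (simp add: field_simps)
    finally have "\<bar>ipartial f (b # es) (y + \<theta> *\<^sub>R b) - ipartial f (b # es) x0\<bar> < \<epsilon>/2" by (rule 2)
    then have "\<bar>(h \<bullet> b) * (ipartial f (b # es) (y + \<theta> *\<^sub>R b) - ipartial f (b # es) x0)\<bar> \<le> norm h * (\<epsilon>/2)"
      unfolding abs_mult using hb[OF b] by (intro mult_mono) auto
    then have "\<bar>?g (y + (h \<bullet> b) *\<^sub>R b) - ?g y - (h \<bullet> b) * ipartial f (b # es) x0\<bar> \<le> \<epsilon>/2 * norm h"
      unfolding \<theta>(2) by (simp add: algebra_simps)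
    moreover have "\<bar>?g y - ?g x - (\<Sum>b\<in>S. (h \<bullet> b) * ipartial f (b # es) x0)\<bar> \<le> \<epsilon>/2 * norm h"
      unfolding y_def using x h by (intro 1) auto
    moreover have "x + (\<Sum>b\<in>insert b S. (h \<bullet> b) *\<^sub>R b) = y + (h \<bullet> b) *\<^sub>R b"
      using insert by (simp add: y_def algebra_simps)
    moreover have "(\<Sum>b\<in>insert b S. (h \<bullet> b) * ipartial f (b # es) x0) =
        (h \<bullet> b) * ipartial f (b # es) x0 + (\<Sum>b\<in>S. (h \<bullet> b) * ipartial f (b # es) x0)"
      using insert by simp
    ultimately show "\<bar>?g (x + (\<Sum>b\<in>insert b S. (h \<bullet> b) *\<^sub>R b)) - ?g x
        - (\<Sum>b\<in>insert b S. (h \<bullet> b) * ipartial f (b # es) x0)\<bar> \<le> \<epsilon> * norm h"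
      by (smt (verit) field_sum_of_halves distrib_right)
  qed
qed

lemma ipartial_has_derivative:
  fixes f :: "'a::euclidean_space \<Rightarrow> real"
  assumes f: "C_k k f" and es: "set es \<subseteq> Basis" "length es < k"
  shows "(ipartial f es has_derivative (\<lambda>h. \<Sum>b\<in>Basis. (h \<bullet> b) * ipartial f (b # es) x)) (at x)"
  unfolding has_derivative_at_alt
proof (intro conjI allI impI)
  show "bounded_linear (\<lambda>h. \<Sum>b\<in>Basis. (h \<bullet> b) * ipartial f (b # es) x)"
    by (intro bounded_linear_sum bounded_linear_mult_const bounded_linear_inner_left)
  fix e :: real assume "e > 0"
  then obtain \<delta> where "\<delta> > 0" and \<delta>: "\<And>y h. norm (y - x) < \<delta> \<Longrightarrow> norm h < \<delta> \<Longrightarrow>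
     \<bar>ipartial f es (y + (\<Sum>b\<in>Basis. (h \<bullet> b) *\<^sub>R b)) - ipartial f es y
        - (\<Sum>b\<in>Basis. (h \<bullet> b) * ipartial f (b # es) x)\<bar> \<le> e * norm h"
    using partials_strict_derivative[OF f es finite_Basis order_refl, of e x] by blast
  show "\<exists>d>0. \<forall>y. norm (y - x) < d \<longrightarrow>
           norm (ipartial f es y - ipartial f es x - (\<Sum>b\<in>Basis. ((y - x) \<bullet> b) * ipartial f (b # es) x)) \<le> e * norm (y - x)"
    using \<open>\<delta> > 0\<close> \<delta>[of x "y - x" for y] by (intro exI[of _ \<delta>]) (simp add: euclidean_representation)
qed

text \<open>Partial derivatives only see coordinate lines, while Taylor's formula is needed along
  arbitrary directions; the total derivative supplies the chain rule.\<close>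

lemma ipartial_line_DERIV:
  fixes f :: "'a::euclidean_space \<Rightarrow> real"
  assumes "C_k k f" "set es \<subseteq> Basis" "length es < k"
  shows "((\<lambda>t. ipartial f es (x + t *\<^sub>R v)) has_real_derivative
     (\<Sum>b\<in>Basis. (v \<bullet> b) * ipartial f (b # es) (x + s *\<^sub>R v))) (at s)"
proof -
  have "((\<lambda>t. ipartial f es (x + t *\<^sub>R v)) has_derivative
      (\<lambda>h. \<Sum>b\<in>Basis. ((h *\<^sub>R v) \<bullet> b) * ipartial f (b # es) (x + s *\<^sub>R v))) (at s)"
    by (rule has_derivative_compose[OF _ ipartial_has_derivative[OF assms]])
       (auto intro!: derivative_eq_intros)
  then show ?thesis
    by (rule has_derivative_imp_has_field_derivative) (simp add: sum_distrib_left mult_ac)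
qed

text \<open>The second derivative with two vector slots: the polarised form is what shows that a
  null vector of a nonnegative Hessian lies in its kernel.\<close>

definition hessq :: "('a::euclidean_space \<Rightarrow> real) \<Rightarrow> 'a \<Rightarrow> 'a \<Rightarrow> 'a \<Rightarrow> real" where
  "hessq f x v w = (\<Sum>b\<in>Basis. \<Sum>c\<in>Basis. (v \<bullet> b) * (w \<bullet> c) * ipartial f [b, c] x)"

lemma C_k_Taylor2:
  fixes f :: "'a::euclidean_space \<Rightarrow> real"
  assumes f: "C_k k f" and k: "2 \<le> k"
  obtains \<theta> where "0 < \<theta>" "\<theta> < 1"
    "f (x + v) = f x + (\<Sum>b\<in>Basis. (v \<bullet> b) * ipartial f [b] x) + hessq f (x + \<theta> *\<^sub>R v) v v / 2"
proof -
  \<comment> \<open>The derivatives of order 0, 1 and 2 along the segment from x to x + v, packed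
    into the family indexed by the order that Maclaurin's formula expects.\<close>
  define d where "d n t = (if n = 0 then f (x + t *\<^sub>R v) else if n = 1 then
     (\<Sum>b\<in>Basis. (v \<bullet> b) * ipartial f [b] (x + t *\<^sub>R v)) else hessq f (x + t *\<^sub>R v) v v)" for n :: nat and t
  have 0: "(d 0 has_real_derivative d 1 t) (at t)" for t
    using ipartial_line_DERIV[OF f, of "[]" x v t] k by (simp add: d_def [abs_def])
  have 1: "(d 1 has_real_derivative d 2 t) (at t)" for t
  proof -
    have "((\<lambda>t. \<Sum>c\<in>Basis. (v \<bullet> c) * ipartial f [c] (x + t *\<^sub>R v)) has_real_derivative
       (\<Sum>c\<in>Basis. (v \<bullet> c) * (\<Sum>b\<in>Basis. (v \<bullet> b) * ipartial f [b, c] (x + t *\<^sub>R v)))) (at t)"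
      using k by (intro DERIV_sum DERIV_cmult ipartial_line_DERIV[OF f]) auto
    also have "(\<Sum>c\<in>Basis. (v \<bullet> c) * (\<Sum>b\<in>Basis. (v \<bullet> b) * ipartial f [b, c] (x + t *\<^sub>R v))) = d 2 t"
      unfolding d_def hessq_def by (subst sum.swap) (simp add: sum_distrib_left mult_ac)
    finally show ?thesis by (simp add: d_def [abs_def])
  qed
  have "\<exists>t. 0 < t \<and> t < 1 \<and> d 0 1 = (\<Sum>m<2. d m 0 / fact m * 1 ^ m) + d 2 t / fact 2 * 1 ^ 2"
    by (rule Maclaurin[of 1 2 d]) (use 0 1 in \<open>auto simp: less_Suc_eq numeral_2_eq_2\<close>)
  then obtain \<theta> where "0 < \<theta>" "\<theta> < 1" and "d 0 1 = d 0 0 + d 1 0 + d 2 \<theta> / 2"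
    by (auto simp: numeral_2_eq_2)
  then show ?thesis by (intro that[of \<theta>]) (auto simp: d_def)
qed

text \<open>The second difference over the square spanned by s b and s c is symmetric in b and c,
  and two mean value steps turn it into s^2 times either mixed derivative at a point within 2 s of
  x. Continuity at x then excludes different values there.\<close>

lemma C_k_Schwarz:
  fixes f :: "'a::euclidean_space \<Rightarrow> real"
  assumes f: "C_k k f" and k: "2 \<le> k" and b: "b \<in> Basis" and c: "c \<in> Basis"
  shows "ipartial f [b, c] x = ipartial f [c, b] x"
proof (rule ccontr)
  assume ne: "ipartial f [b, c] x \<noteq> ipartial f [c, b] x"
  define \<epsilon> where "\<epsilon> = \<bar>ipartial f [b, c] x - ipartial f [c, b] x\<bar> / 2"
  have \<epsilon>: "\<epsilon> > 0" using ne by (simp add: \<epsilon>_def)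
  have key: "\<exists>y. norm (y - x) \<le> 2 * s \<and> f (x + s *\<^sub>R b + s *\<^sub>R c) - f (x + s *\<^sub>R b) - f (x + s *\<^sub>R c) + f x
      = s * s * ipartial f [c, b] y" if s: "s > 0" and b: "b \<in> Basis" and c: "c \<in> Basis" for s b c
  proof -
    define g where "g t = f (x + t *\<^sub>R b + s *\<^sub>R c) - f (x + t *\<^sub>R b)" for t
    have g': "(g has_real_derivative ipartial f [b] (x + t *\<^sub>R b + s *\<^sub>R c) - ipartial f [b] (x + t *\<^sub>R b)) (at t)" for t
      unfolding g_def
      using ipartial_DERIV[OF f, of "[]" b "x + s *\<^sub>R c" t] ipartial_DERIV[OF f, of "[]" b "x" t] k b
      by (intro DERIV_diff) (auto simp: algebra_simps)
    obtain \<sigma> where \<sigma>: "0 < \<sigma>" "\<sigma> < s" "g s - g 0 = (s - 0) * (ipartial f [b] (x + \<sigma> *\<^sub>R b + s *\<^sub>R c) - ipartial f [b] (x + \<sigma> *\<^sub>R b))"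
      using MVT2[OF s g'] by blast
    obtain \<tau> where \<tau>: "\<bar>\<tau>\<bar> \<le> \<bar>s\<bar>" "ipartial f [b] (x + \<sigma> *\<^sub>R b + s *\<^sub>R c) - ipartial f [b] (x + \<sigma> *\<^sub>R b) =
         s * ipartial f [c, b] (x + \<sigma> *\<^sub>R b + \<tau> *\<^sub>R c)"
      by (rule ipartial_MVT[OF f, of "[b]" c s "x + \<sigma> *\<^sub>R b"]) (use b c k in auto)
    have "norm (\<sigma> *\<^sub>R b + \<tau> *\<^sub>R c) \<le> norm (\<sigma> *\<^sub>R b) + norm (\<tau> *\<^sub>R c)" by (rule norm_triangle_ineq)
    also have "\<dots> \<le> 2 * s" using \<sigma> \<tau> s b c by simp
    finally have "norm (x + \<sigma> *\<^sub>R b + \<tau> *\<^sub>R c - x) \<le> 2 * s" by (simp add: algebra_simps)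
    then show ?thesis using \<sigma> \<tau> by (intro exI[of _ "x + \<sigma> *\<^sub>R b + \<tau> *\<^sub>R c"]) (auto simp: g_def)
  qed
  obtain d1 where d1: "d1 > 0" "\<And>y. norm (y - x) < d1 \<Longrightarrow> \<bar>ipartial f [b, c] y - ipartial f [b, c] x\<bar> < \<epsilon>"
    using continuous_on_UNIV_ball[OF C_k_continuous[OF f, of "[b, c]"] \<epsilon>, of x] b c k by auto
  obtain d2 where d2: "d2 > 0" "\<And>y. norm (y - x) < d2 \<Longrightarrow> \<bar>ipartial f [c, b] y - ipartial f [c, b] x\<bar> < \<epsilon>"
    using continuous_on_UNIV_ball[OF C_k_continuous[OF f, of "[c, b]"] \<epsilon>, of x] b c k by auto
  define s where "s = min d1 d2 / 3"
  have s: "s > 0" "2 * s < d1" "2 * s < d2" using d1(1) d2(1) by (auto simp: s_def)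
  obtain y where y: "norm (y - x) \<le> 2 * s" "f (x + s *\<^sub>R b + s *\<^sub>R c) - f (x + s *\<^sub>R b) - f (x + s *\<^sub>R c) + f x
      = s * s * ipartial f [c, b] y" using key[OF s(1) b c] by blast
  obtain z where z: "norm (z - x) \<le> 2 * s" "f (x + s *\<^sub>R c + s *\<^sub>R b) - f (x + s *\<^sub>R c) - f (x + s *\<^sub>R b) + f x
      = s * s * ipartial f [b, c] z" using key[OF s(1) c b] by blast
  have "s * s * ipartial f [c, b] y = s * s * ipartial f [b, c] z"
    using y(2) z(2) by (simp add: algebra_simps)
  then have "ipartial f [c, b] y = ipartial f [b, c] z" using s by simp
  moreover have "\<bar>ipartial f [b, c] z - ipartial f [b, c] x\<bar> < \<epsilon>" using z s by (intro d1) auto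
  moreover have "\<bar>ipartial f [c, b] y - ipartial f [c, b] x\<bar> < \<epsilon>" using y s by (intro d2) auto
  ultimately show False unfolding \<epsilon>_def by (simp add: abs_if split: if_splits)
qed

lemma hessq_sym:
  assumes "C_k k f" "2 \<le> k"
  shows "hessq f x v w = hessq f x w v"
  unfolding hessq_def using C_k_Schwarz[OF assms] by (subst sum.swap) (simp add: mult_ac)

section \<open>A Hilbert-Schmidt counting bound\<close>

text \<open>Gram-Schmidt is carried out on coefficient vectors, with the Gram matrix as inner
  product, so that no functions modulo null sets have to be orthonormalised.\<close>

lemma gram_schmidt_coeffs:
  fixes G :: "nat \<Rightarrow> nat \<Rightarrow> real"
  assumes sym: "\<And>i j. G i j = G j i"
    and pos: "\<And>c. \<exists>i<N. c i \<noteq> 0 \<Longrightarrow> 0 < (\<Sum>k<N. \<Sum>l<N. c k * c l * G k l)"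
  obtains C where "\<And>i j. i < N \<Longrightarrow> j < N \<Longrightarrow>
      (\<Sum>k<N. \<Sum>l<N. C i k * C j l * G k l) = (if i = j then 1 else 0 :: real)"
proof -
  define B where "B c d = (\<Sum>k<N. \<Sum>l<N. c k * d l * G k l)" for c d :: "nat \<Rightarrow> real"
  have B_sym: "B c d = B d c" for c d
    unfolding B_def by (subst sum.swap) (simp add: sym mult_ac)
  have B_diff: "B (\<lambda>k. c k - d k) e = B c e - B d e" for c d e
    by (simp add: B_def left_diff_distrib sum_subtractf)
  have B_scale: "B (\<lambda>k. a * c k) e = a * B c e" for a c e
    by (simp add: B_def sum_distrib_left mult_ac)
  have B_sum: "B (\<lambda>k. \<Sum>i<n. a i * C i k) e = (\<Sum>i<n. a i * B (C i) e)" for a :: "nat \<Rightarrow> real" and C n e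
  proof -
    have "B (\<lambda>k. \<Sum>i<n. a i * C i k) e = (\<Sum>k<N. \<Sum>l<N. \<Sum>i<n. a i * (C i k * e l * G k l))"
      by (simp add: B_def sum_distrib_right sum_distrib_left mult_ac)
    also have "\<dots> = (\<Sum>k<N. \<Sum>i<n. \<Sum>l<N. a i * (C i k * e l * G k l))"
      by (intro sum.cong refl sum.swap)
    also have "\<dots> = (\<Sum>i<n. \<Sum>k<N. \<Sum>l<N. a i * (C i k * e l * G k l))"
      by (rule sum.swap)
    finally show ?thesis by (simp add: B_def sum_distrib_left)
  qed
  have "\<exists>C. (\<forall>i<n. \<forall>k>i. C i k = 0) \<and> (\<forall>i<n. \<forall>j<n. B (C i) (C j) = (if i = j then 1 else 0))"
    if "n \<le> N" for n
    using that
  proof (induction n)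
    case 0
    show ?case by simp
  next
    case (Suc n)
    obtain C where C: "(\<forall>i<n. \<forall>k>i. C i k = 0) \<and> (\<forall>i<n. \<forall>j<n. B (C i) (C j) = (if i = j then 1 else 0))"
      using Suc.IH[OF Suc_leD[OF Suc.prems]] by (rule exE)
    have supp: "\<And>i k. i < n \<Longrightarrow> k > i \<Longrightarrow> C i k = 0"
      using C by simp
    have orth: "\<And>i j. i < n \<Longrightarrow> j < n \<Longrightarrow> B (C i) (C j) = (if i = j then 1 else 0)"
      using C by simp
    \<comment> \<open>The next unit vector. The earlier \<open>C i\<close> with i < n vanish at all
      indices above i, so the projected vector keeps the entry v n = 1; it is therefore nonzero and
      can be normalised.\<close>
    define e where "e k = (if k = n then 1 else 0 :: real)" for k
    define v where "v k = e k - (\<Sum>i<n. B e (C i) * C i k)" for k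
    have "v n = 1" using supp by (simp add: v_def e_def)
    then have pv: "B v v > 0" unfolding B_def using Suc.prems by (intro pos) (auto intro!: exI[of _ n])
    have vC: "B v (C j) = 0" if j: "j < n" for j
    proof -
      have "B v (C j) = B e (C j) - (\<Sum>i<n. B e (C i) * (if i = j then 1 else 0))"
        unfolding v_def B_diff B_sum using j orth by (intro arg_cong2[of _ _ _ _ "(-)"] sum.cong) auto
      then show ?thesis using j by (simp add: if_distrib cong: if_cong)
    qed
    define v' where "v' k = 1 / sqrt (B v v) * v k" for k
    define D where "D i = (if i = n then v' else C i)" for i
    have B_v': "B v' d = 1 / sqrt (B v v) * B v d" for d
      unfolding v'_def B_scale ..
    have v'v': "B v' v' = 1"
      unfolding B_v' B_sym[of v v'] using pv by (simp add: field_simps)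
    have v'C: "B v' (C j) = 0" "B (C j) v' = 0" if "j < n" for j
      using vC[OF that] by (simp_all add: B_v' B_sym[of "C j" v'])
    have "B (D i) (D j) = (if i = j then 1 else 0)" if "i < Suc n" "j < Suc n" for i j
      using that orth v'v' v'C unfolding D_def less_Suc_eq by auto
    moreover have "D i k = 0" if "i < Suc n" "k > i" for i k
      using that supp by (auto simp: D_def v'_def v_def e_def less_Suc_eq)
    ultimately show ?case by (intro exI[of _ D]) auto
  qed
  from this[OF order_refl] show ?thesis using that unfolding B_def by blast
qed

lemma integrable_mult_of_squares:
  fixes f g :: "'a \<Rightarrow> real"
  assumes [measurable]: "f \<in> borel_measurable M" "g \<in> borel_measurable M"
    and f: "integrable M (\<lambda>x. (f x)\<^sup>2)" and g: "integrable M (\<lambda>x. (g x)\<^sup>2)"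
  shows "integrable M (\<lambda>x. f x * g x)"
proof (rule Bochner_Integration.integrable_bound)
  show "integrable M (\<lambda>x. (f x)\<^sup>2 + (g x)\<^sup>2)" using f g by simp
  show "AE x in M. norm (f x * g x) \<le> norm ((f x)\<^sup>2 + (g x)\<^sup>2)"
  proof (rule AE_I2)
    fix x
    have "2 * \<bar>f x * g x\<bar> \<le> (f x)\<^sup>2 + (g x)\<^sup>2"
      using sum_squares_bound[of "\<bar>f x\<bar>" "\<bar>g x\<bar>"] by (simp add: abs_mult)
    then show "norm (f x * g x) \<le> norm ((f x)\<^sup>2 + (g x)\<^sup>2)" by simp
  qed
qed simp

lemma integrable_square_sum:
  fixes f :: "'i \<Rightarrow> 'a \<Rightarrow> real"
  assumes "finite I" "\<And>i. i \<in> I \<Longrightarrow> f i \<in> borel_measurable M" "\<And>i. i \<in> I \<Longrightarrow> integrable M (\<lambda>x. (f i x)\<^sup>2)"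
  shows "integrable M (\<lambda>x. (\<Sum>i\<in>I. f i x)\<^sup>2)"
proof -
  have "(\<lambda>x. (\<Sum>i\<in>I. f i x)\<^sup>2) = (\<lambda>x. \<Sum>i\<in>I. \<Sum>j\<in>I. f i x * f j x)"
    by (simp add: power2_eq_square sum_product)
  then show ?thesis using assms
    by (auto intro!: Bochner_Integration.integrable_sum integrable_mult_of_squares)
qed

lemma integral_bilinear_sum:
  fixes f g :: "'i \<Rightarrow> 'a \<Rightarrow> real"
  assumes "finite I" "\<And>i j. i \<in> I \<Longrightarrow> j \<in> I \<Longrightarrow> integrable M (\<lambda>x. f i x * g j x)"
  shows "(\<integral>x. (\<Sum>i\<in>I. a i * f i x) * (\<Sum>j\<in>I. b j * g j x) \<partial>M) = (\<Sum>i\<in>I. \<Sum>j\<in>I. a i * b j * (\<integral>x. f i x * g j x \<partial>M))"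
proof -
  have "(\<lambda>x. (\<Sum>i\<in>I. a i * f i x) * (\<Sum>j\<in>I. b j * g j x)) = (\<lambda>x. \<Sum>i\<in>I. \<Sum>j\<in>I. (a i * b j) * (f i x * g j x))"
    by (simp add: sum_product mult_ac)
  then show ?thesis using assms by (simp add: Bochner_Integration.integral_sum)
qed

lemma (in pair_sigma_finite) integrable_times:
  fixes f :: "'a \<Rightarrow> real" and g :: "'b \<Rightarrow> real"
  assumes f: "integrable M1 f" and g: "integrable M2 g"
  shows "integrable (M1 \<Otimes>\<^sub>M M2) (\<lambda>z. f (fst z) * g (snd z))"
    and "(\<integral>z. f (fst z) * g (snd z) \<partial>(M1 \<Otimes>\<^sub>M M2)) = (\<integral>x. f x \<partial>M1) * (\<integral>y. g y \<partial>M2)"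
proof -
  have [measurable]: "f \<in> borel_measurable M1" "g \<in> borel_measurable M2" using f g by auto
  show int: "integrable (M1 \<Otimes>\<^sub>M M2) (\<lambda>z. f (fst z) * g (snd z))"
  proof (rule Fubini_integrable)
    show "(\<lambda>z. f (fst z) * g (snd z)) \<in> borel_measurable (M1 \<Otimes>\<^sub>M M2)" by measurable
    show "integrable M1 (\<lambda>x. \<integral>y. norm (f (fst (x, y)) * g (snd (x, y))) \<partial>M2)"
      using f g by (simp add: abs_mult)
    show "AE x in M1. integrable M2 (\<lambda>y. f (fst (x, y)) * g (snd (x, y)))"
      using g by simp
  qed
  show "(\<integral>z. f (fst z) * g (snd z) \<partial>(M1 \<Otimes>\<^sub>M M2)) = (\<integral>x. f x \<partial>M1) * (\<integral>y. g y \<partial>M2)"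
    using integral_fst[of "\<lambda>x y. f x * g y"] int by (simp add: case_prod_beta')
qed

text \<open>For a basis of the \<open>N\<close>-dimensional coefficient space orthonormal with respect to
  \<open>\<langle>x1, x1\<rangle> + \<langle>x2, x2\<rangle>\<close>, the two Gram matrices satisfy \<open>A1 + A2 = 1\<close>, so
  \<open>4 A1\<^sub>i\<^sub>j A2\<^sub>i\<^sub>j \<le> \<delta>\<^sub>i\<^sub>j\<close>; summing the hypothesis over the basis and pairing with \<open>K\<close> gives the bound.\<close>
lemma hilbert_schmidt_bound:
  fixes K :: "'a \<times> 'a \<Rightarrow> real" and x1 x2 :: "nat \<Rightarrow> 'a \<Rightarrow> real"
  assumes sf: "sigma_finite_measure M"
    and K[measurable]: "K \<in> borel_measurable (M \<Otimes>\<^sub>M M)" and K2: "integrable (M \<Otimes>\<^sub>M M) (\<lambda>z. (K z)\<^sup>2)"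
    and [measurable]: "\<And>i. x1 i \<in> borel_measurable M" "\<And>i. x2 i \<in> borel_measurable M"
    and i1: "\<And>i. integrable M (\<lambda>x. (x1 i x)\<^sup>2)" and i2: "\<And>i. integrable M (\<lambda>x. (x2 i x)\<^sup>2)"
    and key: "\<And>c. \<exists>i<N. c i \<noteq> 0 \<Longrightarrow>
       (\<integral>x. (\<Sum>i<N. c i * x1 i x)\<^sup>2 \<partial>M) + (\<integral>x. (\<Sum>i<N. c i * x2 i x)\<^sup>2 \<partial>M)
        < 2 * (\<integral>z. K z * ((\<Sum>i<N. c i * x2 i (fst z)) * (\<Sum>i<N. c i * x1 i (snd z))) \<partial>(M \<Otimes>\<^sub>M M))"
  shows "real N \<le> (\<integral>z. (K z)\<^sup>2 \<partial>(M \<Otimes>\<^sub>M M))"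
proof -
  interpret sigma_finite_measure M by fact
  interpret pair_sigma_finite M M ..
  define G where "G i j = (\<integral>x. x1 i x * x1 j x \<partial>M) + (\<integral>x. x2 i x * x2 j x \<partial>M)" for i j
  have int1: "integrable M (\<lambda>x. x1 i x * x1 j x)" and int2: "integrable M (\<lambda>x. x2 i x * x2 j x)" for i j
    using i1 i2 by (auto intro!: integrable_mult_of_squares)
  have bil: "(\<integral>x. (\<Sum>i<N. a i * x1 i x) * (\<Sum>i<N. b i * x1 i x) \<partial>M) + (\<integral>x. (\<Sum>i<N. a i * x2 i x) * (\<Sum>i<N. b i * x2 i x) \<partial>M)
      = (\<Sum>k<N. \<Sum>l<N. a k * b l * G k l)" for a b
    by (simp add: integral_bilinear_sum int1 int2 G_def distrib_left sum.distrib)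
  define y1 where "y1 a x = (\<Sum>i<N. a i * x1 i x)" for a x
  define y2 where "y2 a x = (\<Sum>i<N. a i * x2 i x)" for a x
  have [measurable]: "y1 a \<in> borel_measurable M" "y2 a \<in> borel_measurable M" for a
    unfolding y1_def y2_def by measurable
  have y12: "integrable M (\<lambda>x. (y1 a x)\<^sup>2)" "integrable M (\<lambda>x. (y2 a x)\<^sup>2)" for a
    unfolding y1_def y2_def using i1 i2
    by (auto intro!: integrable_square_sum simp: power_mult_distrib)
  have iy1: "integrable M (\<lambda>x. y1 a x * y1 b x)" and iy2: "integrable M (\<lambda>x. y2 a x * y2 b x)" for a b
    using y12 by (auto intro!: integrable_mult_of_squares)
  have prod_sq: "integrable (M \<Otimes>\<^sub>M M) (\<lambda>z. (y2 a (fst z) * y1 a (snd z))\<^sup>2)" for a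
    unfolding power_mult_distrib by (intro integrable_times y12)
  have intK: "integrable (M \<Otimes>\<^sub>M M) (\<lambda>z. K z * (y2 a (fst z) * y1 a (snd z)))" for a
    by (intro integrable_mult_of_squares K2 prod_sq) measurable
  have key': "(\<integral>x. (y1 c x)\<^sup>2 \<partial>M) + (\<integral>x. (y2 c x)\<^sup>2 \<partial>M) < 2 * (\<integral>z. K z * (y2 c (fst z) * y1 c (snd z)) \<partial>(M \<Otimes>\<^sub>M M))"
    if "\<exists>i<N. c i \<noteq> 0" for c
    using key[OF that] unfolding y1_def y2_def .
  \<comment> \<open>Definiteness of the Gram form comes from the strictness of the hypothesis: if
    the form vanished, y2(p) y1(q) would vanish almost everywhere, and a nonnegative left side would
    be smaller than a right side equal to 0.\<close>
  have pos: "0 < (\<Sum>k<N. \<Sum>l<N. c k * c l * G k l)" if c: "\<exists>i<N. c i \<noteq> 0" for c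
  proof -
    have eq: "(\<Sum>k<N. \<Sum>l<N. c k * c l * G k l) = (\<integral>x. (y1 c x)\<^sup>2 \<partial>M) + (\<integral>x. (y2 c x)\<^sup>2 \<partial>M)"
      unfolding bil[symmetric] y1_def y2_def power2_eq_square ..
    have ge: "0 \<le> (\<integral>x. (y1 c x)\<^sup>2 \<partial>M)" "0 \<le> (\<integral>x. (y2 c x)\<^sup>2 \<partial>M)" by simp_all
    show ?thesis
    proof (rule ccontr)
      assume "\<not> 0 < (\<Sum>k<N. \<Sum>l<N. c k * c l * G k l)"
      then have 0: "(\<integral>x. (y1 c x)\<^sup>2 \<partial>M) = 0" using ge eq by linarith
      have "(\<integral>z. (y2 c (fst z) * y1 c (snd z))\<^sup>2 \<partial>(M \<Otimes>\<^sub>M M)) = 0"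
        unfolding power_mult_distrib
      using integrable_times(2)[of "\<lambda>x. (y2 c x)\<^sup>2" "\<lambda>x. (y1 c x)\<^sup>2"] by (simp add: y12 0)
      then have "AE z in M \<Otimes>\<^sub>M M. y2 c (fst z) * y1 c (snd z) = 0"
        using integral_nonneg_eq_0_iff_AE[OF prod_sq[of c]] by simp
      then have "(\<integral>z. K z * (y2 c (fst z) * y1 c (snd z)) \<partial>(M \<Otimes>\<^sub>M M)) = 0"
        by (intro integral_eq_zero_AE) auto
      with key'[OF c] ge show False by linarith
    qed
  qed
  obtain C where C: "\<And>i j. i < N \<Longrightarrow> j < N \<Longrightarrow>
      (\<Sum>k<N. \<Sum>l<N. C i k * C j l * G k l) = (if i = j then 1 else 0 :: real)"
  proof (rule gram_schmidt_coeffs[of G N])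
    show "G i j = G j i" for i j by (simp add: G_def mult.commute)
  qed (use pos in auto)
  define A1 where "A1 i j = (\<integral>x. y1 (C i) x * y1 (C j) x \<partial>M)" for i j
  define A2 where "A2 i j = (\<integral>x. y2 (C i) x * y2 (C j) x \<partial>M)" for i j
  have A12: "A1 i j + A2 i j = (if i = j then 1 else 0)" if "i < N" "j < N" for i j
    using bil[of "C i" "C j"] C[OF that] unfolding A1_def A2_def y1_def y2_def by simp
  define Y where "Y z = (\<Sum>i<N. y2 (C i) (fst z) * y1 (C i) (snd z))" for z
  have Y2_eq: "(Y z)\<^sup>2 = (\<Sum>i<N. \<Sum>j<N. (y2 (C i) (fst z) * y2 (C j) (fst z)) * (y1 (C i) (snd z) * y1 (C j) (snd z)))" for z
    by (simp add: Y_def power2_eq_square sum_product mult_ac)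
  have yy: "integrable (M \<Otimes>\<^sub>M M) (\<lambda>z. y2 a (fst z) * y2 b (fst z) * (y1 a (snd z) * y1 b (snd z)))"
    "(\<integral>z. y2 a (fst z) * y2 b (fst z) * (y1 a (snd z) * y1 b (snd z)) \<partial>(M \<Otimes>\<^sub>M M))
      = (\<integral>x. y2 a x * y2 b x \<partial>M) * (\<integral>x. y1 a x * y1 b x \<partial>M)" for a b
    using integrable_times[OF iy2[of a b] iy1[of a b]] by auto
  have [measurable]: "Y \<in> borel_measurable (M \<Otimes>\<^sub>M M)" unfolding Y_def by measurable
  have intY2: "integrable (M \<Otimes>\<^sub>M M) (\<lambda>z. (Y z)\<^sup>2)"
    unfolding Y2_eq by (intro Bochner_Integration.integrable_sum integrable_times iy1 iy2)
  have "4 * (\<integral>z. (Y z)\<^sup>2 \<partial>(M \<Otimes>\<^sub>M M)) = (\<Sum>i<N. \<Sum>j<N. 4 * (A2 i j * A1 i j))"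
    unfolding Y2_eq A1_def A2_def
    by (simp add: Bochner_Integration.integral_sum yy sum_distrib_left)
  also have "\<dots> \<le> (\<Sum>i<N. \<Sum>j<N. if i = j then 1 else 0)"
  proof (intro sum_mono)
    fix i j assume "i \<in> {..<N}" "j \<in> {..<N}"
    then have *: "A2 i j = (if i = j then 1 else 0) - A1 i j" using A12[of i j] by auto
    \<comment> \<open>With A2 = delta - A1 this square says 4 A1 A2 <= delta^2 = delta.\<close>
    have "0 \<le> (2 * A1 i j - (if i = j then 1 else 0))\<^sup>2" by simp
    then show "4 * (A2 i j * A1 i j) \<le> (if i = j then 1 else 0)"
      unfolding * by (auto simp: power2_eq_square algebra_simps split: if_splits)
  qed
  also have "\<dots> = real N" by simp
  finally have Y4: "4 * (\<integral>z. (Y z)\<^sup>2 \<partial>(M \<Otimes>\<^sub>M M)) \<le> real N" .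
  have ne: "\<exists>k<N. C i k \<noteq> 0" if "i < N" for i
  proof (rule ccontr)
    assume "\<not> ?thesis"
    then have "(\<Sum>k<N. \<Sum>l<N. C i k * C i l * G k l) = 0" by (intro sum.neutral ballI) auto
    with C[OF that that] show False by simp
  qed
  have "real N = (\<Sum>i<N. A1 i i + A2 i i)" using A12 by simp
  also have "\<dots> \<le> (\<Sum>i<N. 2 * (\<integral>z. K z * (y2 (C i) (fst z) * y1 (C i) (snd z)) \<partial>(M \<Otimes>\<^sub>M M)))"
    using key'[OF ne] by (intro sum_mono) (auto simp: A1_def A2_def power2_eq_square less_imp_le)
  also have "\<dots> = 2 * (\<integral>z. K z * Y z \<partial>(M \<Otimes>\<^sub>M M))"
    unfolding Y_def sum_distrib_left
    by (subst Bochner_Integration.integral_sum) (auto simp: intK sum_distrib_left)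
  also have "2 * (\<integral>z. K z * Y z \<partial>(M \<Otimes>\<^sub>M M)) = (\<integral>z. 2 * (K z * Y z) \<partial>(M \<Otimes>\<^sub>M M))" by simp
  also have "\<dots> \<le> (\<integral>z. 1/2 * (K z)\<^sup>2 + 2 * (Y z)\<^sup>2 \<partial>(M \<Otimes>\<^sub>M M))"
  proof (rule integral_mono)
    show "integrable (M \<Otimes>\<^sub>M M) (\<lambda>z. 2 * (K z * Y z))"
      by (intro integrable_mult_right integrable_mult_of_squares K2 intY2) measurable
    show "integrable (M \<Otimes>\<^sub>M M) (\<lambda>z. 1/2 * (K z)\<^sup>2 + 2 * (Y z)\<^sup>2)"
      using K2 intY2 by simp
    fix z
    \<comment> \<open>Young's inequality with weights 1/2 and 2: since four times the integral of
      Y^2 is at most N, the Y term costs at most N/2, which the left side absorbs.\<close>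
    have "0 \<le> (K z - 2 * Y z)\<^sup>2" by simp
    then show "2 * (K z * Y z) \<le> 1/2 * (K z)\<^sup>2 + 2 * (Y z)\<^sup>2" by (simp add: power2_eq_square algebra_simps)
  qed
  also have "\<dots> = 1/2 * (\<integral>z. (K z)\<^sup>2 \<partial>(M \<Otimes>\<^sub>M M)) + 2 * (\<integral>z. (Y z)\<^sup>2 \<partial>(M \<Otimes>\<^sub>M M))"
    using K2 intY2 by simp
  also have "\<dots> \<le> 1/2 * (\<integral>z. (K z)\<^sup>2 \<partial>(M \<Otimes>\<^sub>M M)) + real N / 2" using Y4 by simp
  finally show ?thesis by simp
qed

section \<open>The Birman-Schwinger kernel\<close>

lemma Cauchy_Schwarz_integral:
  fixes f g :: "'a \<Rightarrow> real"
  assumes [measurable]: "f \<in> borel_measurable M" "g \<in> borel_measurable M"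
    and f: "integrable M (\<lambda>x. (f x)\<^sup>2)" and g: "integrable M (\<lambda>x. (g x)\<^sup>2)"
  shows "(\<integral>x. f x * g x \<partial>M)\<^sup>2 \<le> (\<integral>x. (f x)\<^sup>2 \<partial>M) * (\<integral>x. (g x)\<^sup>2 \<partial>M)"
proof -
  define A where "A = (\<integral>x. (f x)\<^sup>2 \<partial>M)"
  define B where "B = (\<integral>x. (g x)\<^sup>2 \<partial>M)"
  define c where "c = (\<integral>x. f x * g x \<partial>M)"
  have fg: "integrable M (\<lambda>x. f x * g x)" by (intro integrable_mult_of_squares f g) auto
  have q: "0 \<le> A - 2 * t * c + t\<^sup>2 * B" for t
  proof -
    have "0 \<le> (\<integral>x. (f x - t * g x)\<^sup>2 \<partial>M)" by simp
    also have "(\<lambda>x. (f x - t * g x)\<^sup>2) = (\<lambda>x. (f x)\<^sup>2 - 2 * t * (f x * g x) + t\<^sup>2 * (g x)\<^sup>2)"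
      by (auto simp: power2_eq_square algebra_simps)
    also have "(\<integral>x. \<dots> x \<partial>M) = A - 2 * t * c + t\<^sup>2 * B"
      using f g fg by (simp add: A_def B_def c_def)
    finally show ?thesis .
  qed
  have B0: "0 \<le> B" by (simp add: B_def)
  have "c\<^sup>2 \<le> A * B"
  proof (cases "B = 0")
    case True
    have "c = 0"
    proof (rule ccontr)
      assume "c \<noteq> 0"
      \<comment> \<open>For B = 0 the quadratic is affine in t, and this t gives it the value
        -1.\<close>
      then show False using q[of "(A + 1) / (2 * c)"] True by simp
    qed
    then show ?thesis using True by simp
  next
    case False
    have "0 \<le> A - c\<^sup>2 / B" using q[of "c / B"] False by (simp add: power2_eq_square)
    then show ?thesis using False B0 by (simp add: field_simps)
  qed
  then show ?thesis by (simp add: A_def B_def c_def)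
qed

text \<open>Cauchy-Schwarz on almost every section; this puts the marginals \<open>g1\<close> and
  \<open>g2\<close> of an L2 function into L2 of one variable.\<close>

lemma (in pair_sigma_finite) marginal_square_integrable:
  fixes f :: "'a \<times> 'b \<Rightarrow> real"
  assumes [measurable]: "f \<in> borel_measurable (M1 \<Otimes>\<^sub>M M2)" "\<phi> \<in> borel_measurable M2"
    and f: "integrable (M1 \<Otimes>\<^sub>M M2) (\<lambda>z. (f z)\<^sup>2)" and \<phi>: "integrable M2 (\<lambda>x. (\<phi> x)\<^sup>2)"
  shows "integrable M1 (\<lambda>x. (\<integral>y. \<phi> y * f (x, y) \<partial>M2)\<^sup>2)"
    and "AE x in M1. integrable M2 (\<lambda>y. \<phi> y * f (x, y))"
proof -
  have ae: "AE x in M1. integrable M2 (\<lambda>y. (f (x, y))\<^sup>2)"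
    using AE_integrable_fst'[OF f] by simp
  then show "AE x in M1. integrable M2 (\<lambda>y. \<phi> y * f (x, y))"
    using AE_space by eventually_elim (intro integrable_mult_of_squares \<phi>; measurable)
  show "integrable M1 (\<lambda>x. (\<integral>y. \<phi> y * f (x, y) \<partial>M2)\<^sup>2)"
  proof (rule Bochner_Integration.integrable_bound)
    show "integrable M1 (\<lambda>x. (\<integral>y. (\<phi> y)\<^sup>2 \<partial>M2) * (\<integral>y. (f (x, y))\<^sup>2 \<partial>M2))"
      using integrable_fst'[OF f] by simp
    show "AE x in M1. norm ((\<integral>y. \<phi> y * f (x, y) \<partial>M2)\<^sup>2) \<le> norm ((\<integral>y. (\<phi> y)\<^sup>2 \<partial>M2) * (\<integral>y. (f (x, y))\<^sup>2 \<partial>M2))"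
      using ae AE_space
    proof eventually_elim
      case (elim x)
      then have "(\<integral>y. \<phi> y * f (x, y) \<partial>M2)\<^sup>2 \<le> (\<integral>y. (\<phi> y)\<^sup>2 \<partial>M2) * (\<integral>y. (f (x, y))\<^sup>2 \<partial>M2)"
        by (intro Cauchy_Schwarz_integral \<phi>; measurable)
      then show ?case by simp
    qed
  qed simp
qed

text \<open>The map sending g to g(x) \<phi>(y) is the adjoint of the marginal map; this rewrites
  integrals over the product through \<open>g1\<close> and \<open>g2\<close>.\<close>

lemma (in pair_sigma_finite) integral_times_marginal:
  fixes f :: "'a \<times> 'b \<Rightarrow> real"
  assumes [measurable]: "f \<in> borel_measurable (M1 \<Otimes>\<^sub>M M2)" "\<phi> \<in> borel_measurable M2" "g \<in> borel_measurable M1"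
    and f: "integrable (M1 \<Otimes>\<^sub>M M2) (\<lambda>z. (f z)\<^sup>2)" and \<phi>: "integrable M2 (\<lambda>x. (\<phi> x)\<^sup>2)"
    and g: "integrable M1 (\<lambda>x. (g x)\<^sup>2)"
  shows "integrable (M1 \<Otimes>\<^sub>M M2) (\<lambda>z. g (fst z) * \<phi> (snd z) * f z)"
    and "(\<integral>z. g (fst z) * \<phi> (snd z) * f z \<partial>(M1 \<Otimes>\<^sub>M M2)) = (\<integral>x. g x * (\<integral>y. \<phi> y * f (x, y) \<partial>M2) \<partial>M1)"
proof -
  have sq: "integrable (M1 \<Otimes>\<^sub>M M2) (\<lambda>z. (g (fst z) * \<phi> (snd z))\<^sup>2)"
    unfolding power_mult_distrib by (intro integrable_times g \<phi>)
  show int: "integrable (M1 \<Otimes>\<^sub>M M2) (\<lambda>z. g (fst z) * \<phi> (snd z) * f z)"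
    by (intro integrable_mult_of_squares f sq) measurable
  show "(\<integral>z. g (fst z) * \<phi> (snd z) * f z \<partial>(M1 \<Otimes>\<^sub>M M2)) = (\<integral>x. g x * (\<integral>y. \<phi> y * f (x, y) \<partial>M2) \<partial>M1)"
    using integral_fst'[OF int] by (simp add: mult.assoc)
qed

text \<open>Integrating out y turns the weight 1/w into a function of x alone, later
  \<open>\<Lambda>1\<close> or \<open>\<Lambda>2\<close>; its bound \<open>B\<close>, later 1/\<mu>,
  reduces integrability to that of g^2.\<close>

lemma (in pair_sigma_finite) weighted_square_integrable:
  fixes w :: "'a \<times> 'b \<Rightarrow> real"
  assumes [measurable]: "w \<in> borel_measurable (M1 \<Otimes>\<^sub>M M2)" "\<phi> \<in> borel_measurable M2" "g \<in> borel_measurable M1"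
    and w: "\<And>z. 0 \<le> w z" and g: "integrable M1 (\<lambda>x. (g x)\<^sup>2)"
    and int: "AE x in M1. integrable M2 (\<lambda>y. (\<phi> y)\<^sup>2 / w (x, y))"
    and le: "AE x in M1. (\<integral>y. (\<phi> y)\<^sup>2 / w (x, y) \<partial>M2) \<le> B"
  shows "integrable (M1 \<Otimes>\<^sub>M M2) (\<lambda>z. (g (fst z) * \<phi> (snd z))\<^sup>2 / w z)"
    and "(\<integral>z. (g (fst z) * \<phi> (snd z))\<^sup>2 / w z \<partial>(M1 \<Otimes>\<^sub>M M2))
       = (\<integral>x. (\<integral>y. (\<phi> y)\<^sup>2 / w (x, y) \<partial>M2) * (g x)\<^sup>2 \<partial>M1)"
    and "integrable M1 (\<lambda>x. (\<integral>y. (\<phi> y)\<^sup>2 / w (x, y) \<partial>M2) * (g x)\<^sup>2)"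
proof -
  have eq: "(g x * \<phi> y)\<^sup>2 / w (x, y) = (g x)\<^sup>2 * ((\<phi> y)\<^sup>2 / w (x, y))" for x y
    by (simp add: power_mult_distrib)
  have nrm: "norm ((g x * \<phi> y)\<^sup>2 / w (x, y)) = (g x)\<^sup>2 * ((\<phi> y)\<^sup>2 / w (x, y))" for x y
    unfolding eq using w by (simp add: abs_mult)
  show i1: "integrable M1 (\<lambda>x. (\<integral>y. (\<phi> y)\<^sup>2 / w (x, y) \<partial>M2) * (g x)\<^sup>2)"
  proof (rule Bochner_Integration.integrable_bound)
    show "integrable M1 (\<lambda>x. B * (g x)\<^sup>2)" using g by simp
    show "AE x in M1. norm ((\<integral>y. (\<phi> y)\<^sup>2 / w (x, y) \<partial>M2) * (g x)\<^sup>2) \<le> norm (B * (g x)\<^sup>2)"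
      using le
    proof eventually_elim
      case (elim x)
      have "0 \<le> (\<integral>y. (\<phi> y)\<^sup>2 / w (x, y) \<partial>M2)" using w by (intro integral_nonneg_AE) auto
      then show ?case using elim by (simp add: abs_mult mult_right_mono)
    qed
  qed simp
  show i2: "integrable (M1 \<Otimes>\<^sub>M M2) (\<lambda>z. (g (fst z) * \<phi> (snd z))\<^sup>2 / w z)"
  proof (rule Fubini_integrable)
    show "integrable M1 (\<lambda>x. \<integral>y. norm ((g (fst (x, y)) * \<phi> (snd (x, y)))\<^sup>2 / w (x, y)) \<partial>M2)"
      using i1 by (simp only: fst_conv snd_conv nrm integral_mult_right_zero) (simp add: mult.commute)
    show "AE x in M1. integrable M2 (\<lambda>y. (g (fst (x, y)) * \<phi> (snd (x, y)))\<^sup>2 / w (x, y))"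
      using int by eventually_elim (simp only: fst_conv snd_conv eq, rule integrable_mult_right, assumption)
  qed measurable
  show "(\<integral>z. (g (fst z) * \<phi> (snd z))\<^sup>2 / w z \<partial>(M1 \<Otimes>\<^sub>M M2))
       = (\<integral>x. (\<integral>y. (\<phi> y)\<^sup>2 / w (x, y) \<partial>M2) * (g x)\<^sup>2 \<partial>M1)"
    unfolding integral_fst'[OF i2, symmetric] by (simp only: fst_conv snd_conv eq integral_mult_right_zero) (simp add: mult.commute)
qed

lemma (in pair_sigma_finite) AE_pair_fst:
  assumes P: "AE x in M1. P x"
  shows "AE z in M1 \<Otimes>\<^sub>M M2. P (fst z)"
proof -
  obtain N where N: "N \<in> null_sets M1" "{x\<in>space M1. \<not> P x} \<subseteq> N"
    using P by (auto simp: eventually_ae_filter)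
  then have "N \<times> space M2 \<in> null_sets (M1 \<Otimes>\<^sub>M M2)"
    by (auto simp: null_sets_def M2.emeasure_pair_measure_Times)
  then show ?thesis using N(2) by (intro AE_I'[of "N \<times> space M2"]) (auto simp: space_pair_measure)
qed

lemma (in pair_sigma_finite) AE_pair_snd:
  assumes P: "AE y in M2. P y"
  shows "AE z in M1 \<Otimes>\<^sub>M M2. P (snd z)"
proof -
  obtain N where N: "N \<in> null_sets M2" "{y\<in>space M2. \<not> P y} \<subseteq> N"
    using P by (auto simp: eventually_ae_filter)
  then have "space M1 \<times> N \<in> null_sets (M1 \<Otimes>\<^sub>M M2)"
    by (auto simp: null_sets_def M2.emeasure_pair_measure_Times)
  then show ?thesis using N(2) by (intro AE_I'[of "space M1 \<times> N"]) (auto simp: space_pair_measure)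
qed

text \<open>The measure-theoretic half of the argument, free of the geometry of the torus;
  \<open>w\<close> stands for u - m. The strict bounds are imposed only almost everywhere because at
  the critical coupling \<mu> \<Lambda> equals 1 at the origin.\<close>

locale birman_schwinger = sigma_finite_measure M for M :: "'a measure" +
  fixes w :: "'a \<times> 'a \<Rightarrow> real" and \<phi>1 \<phi>2 :: "'a \<Rightarrow> real" and \<mu>1 \<mu>2 W :: real and \<Lambda>1 \<Lambda>2 :: "'a \<Rightarrow> real"
  assumes w_meas[measurable]: "w \<in> borel_measurable (M \<Otimes>\<^sub>M M)"
    and w_nonneg: "\<And>z. 0 \<le> w z" and w_le: "\<And>z. w z \<le> W" and w_pos: "AE z in M \<Otimes>\<^sub>M M. 0 < w z"
    and \<phi>_meas[measurable]: "\<phi>1 \<in> borel_measurable M" "\<phi>2 \<in> borel_measurable M"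
    and \<phi>_sq: "integrable M (\<lambda>x. (\<phi>1 x)\<^sup>2)" "integrable M (\<lambda>x. (\<phi>2 x)\<^sup>2)"
    and \<mu>_pos: "0 < \<mu>1" "0 < \<mu>2"
    and \<Lambda>1_int: "AE q in M. integrable M (\<lambda>t. (\<phi>1 t)\<^sup>2 / w (t, q))"
    and \<Lambda>2_int: "AE p in M. integrable M (\<lambda>t. (\<phi>2 t)\<^sup>2 / w (p, t))"
    and \<Lambda>1_eq: "\<And>q. \<Lambda>1 q = (\<integral>t. (\<phi>1 t)\<^sup>2 / w (t, q) \<partial>M)"
    and \<Lambda>2_eq: "\<And>p. \<Lambda>2 p = (\<integral>t. (\<phi>2 t)\<^sup>2 / w (p, t) \<partial>M)"
    and \<Lambda>1_less: "AE q in M. \<mu>1 * \<Lambda>1 q < 1"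
    and \<Lambda>2_less: "AE p in M. \<mu>2 * \<Lambda>2 p < 1"
begin

sublocale pair_sigma_finite M M ..

definition "g1 f q = (\<integral>t. \<phi>1 t * f (t, q) \<partial>M)"
definition "g2 f p = (\<integral>t. \<phi>2 t * f (p, t) \<partial>M)"
definition "D1 q = 1 - \<mu>1 * \<Lambda>1 q"
definition "D2 p = 1 - \<mu>2 * \<Lambda>2 p"
definition "K z = sqrt (\<mu>1 * \<mu>2) * \<phi>1 (fst z) * \<phi>2 (snd z) / (w z * sqrt (D1 (snd z)) * sqrt (D2 (fst z)))"

definition L2 :: "('a \<times> 'a \<Rightarrow> real) \<Rightarrow> bool" where
  "L2 f \<longleftrightarrow> f \<in> borel_measurable (M \<Otimes>\<^sub>M M) \<and> integrable (M \<Otimes>\<^sub>M M) (\<lambda>z. (f z)\<^sup>2)"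

definition "energy f = (\<integral>z. w z * (f z)\<^sup>2 \<partial>(M \<Otimes>\<^sub>M M)) - \<mu>1 * (\<integral>q. (g1 f q)\<^sup>2 \<partial>M) - \<mu>2 * (\<integral>p. (g2 f p)\<^sup>2 \<partial>M)"

lemma \<Lambda>_meas[measurable]: "\<Lambda>1 \<in> borel_measurable M" "\<Lambda>2 \<in> borel_measurable M"
  unfolding \<Lambda>1_eq[abs_def] \<Lambda>2_eq[abs_def] by measurable

lemma D_meas[measurable]: "D1 \<in> borel_measurable M" "D2 \<in> borel_measurable M"
  unfolding D1_def[abs_def] D2_def[abs_def] by measurable

lemma K_meas[measurable]: "K \<in> borel_measurable (M \<Otimes>\<^sub>M M)"
  unfolding K_def[abs_def] by measurable

lemma \<Lambda>_nonneg: "0 \<le> \<Lambda>1 q" "0 \<le> \<Lambda>2 q"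
  unfolding \<Lambda>1_eq \<Lambda>2_eq using w_nonneg by (auto intro!: integral_nonneg_AE)

lemma D_pos: "AE q in M. 0 < D1 q" "AE q in M. 0 < D2 q"
  using \<Lambda>1_less \<Lambda>2_less by (auto simp: D1_def D2_def)

lemma D_le1: "D1 q \<le> 1" "D2 q \<le> 1"
  using \<Lambda>_nonneg \<mu>_pos by (auto simp: D1_def D2_def)

text \<open>The Fubini lemmas integrate out the second variable, whereas \<open>g1\<close>
  integrates out the first; exchanging the coordinates transfers them.\<close>

lemma swap_meas: "f \<in> borel_measurable (M \<Otimes>\<^sub>M M) \<Longrightarrow> (\<lambda>z. f (snd z, fst z)) \<in> borel_measurable (M \<Otimes>\<^sub>M M)"
  for f :: "'a \<times> 'a \<Rightarrow> real"
  by (rule measurable_compose[OF measurable_Pair[OF measurable_snd measurable_fst]])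

lemma swap_integrable: "integrable (M \<Otimes>\<^sub>M M) (\<lambda>z. f (snd z, fst z)) \<longleftrightarrow> integrable (M \<Otimes>\<^sub>M M) f"
  for f :: "'a \<times> 'a \<Rightarrow> real"
  using integrable_product_swap_iff[of f] by (simp add: case_prod_beta')

lemma swap_integral: "f \<in> borel_measurable (M \<Otimes>\<^sub>M M) \<Longrightarrow>
    (\<integral>z. f (snd z, fst z) \<partial>(M \<Otimes>\<^sub>M M)) = (\<integral>z. f z \<partial>(M \<Otimes>\<^sub>M M))"
  for f :: "'a \<times> 'a \<Rightarrow> real"
  using integral_product_swap[of f] by (simp add: case_prod_beta')

lemma g_meas[measurable]:
  assumes [measurable]: "f \<in> borel_measurable (M \<Otimes>\<^sub>M M)"
  shows "g1 f \<in> borel_measurable M" "g2 f \<in> borel_measurable M"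
  unfolding g1_def[abs_def] g2_def[abs_def] by measurable

lemma g_L2:
  assumes "L2 f"
  shows "integrable M (\<lambda>x. (g1 f x)\<^sup>2)" "integrable M (\<lambda>x. (g2 f x)\<^sup>2)"
    "AE x in M. integrable M (\<lambda>y. \<phi>1 y * f (y, x))" "AE x in M. integrable M (\<lambda>y. \<phi>2 y * f (x, y))"
proof -
  have f: "f \<in> borel_measurable (M \<Otimes>\<^sub>M M)" "integrable (M \<Otimes>\<^sub>M M) (\<lambda>z. (f z)\<^sup>2)"
    using assms by (auto simp: L2_def)
  have f': "integrable (M \<Otimes>\<^sub>M M) (\<lambda>z. (f (snd z, fst z))\<^sup>2)"
    using swap_integrable[of "\<lambda>z. (f z)\<^sup>2"] f by simp
  show "integrable M (\<lambda>x. (g1 f x)\<^sup>2)" "AE x in M. integrable M (\<lambda>y. \<phi>1 y * f (y, x))"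
    using marginal_square_integrable[OF swap_meas[OF f(1)] \<phi>_meas(1) f' \<phi>_sq(1)] by (simp_all add: g1_def)
  show "integrable M (\<lambda>x. (g2 f x)\<^sup>2)" "AE x in M. integrable M (\<lambda>y. \<phi>2 y * f (x, y))"
    using marginal_square_integrable[OF f(1) \<phi>_meas(2) f(2) \<phi>_sq(2)] by (simp_all add: g2_def)
qed

lemma pairing:
  assumes f: "L2 f" and [measurable]: "h \<in> borel_measurable M" and h: "integrable M (\<lambda>x. (h x)\<^sup>2)"
  shows "integrable (M \<Otimes>\<^sub>M M) (\<lambda>z. h (snd z) * \<phi>1 (fst z) * f z)"
    "(\<integral>z. h (snd z) * \<phi>1 (fst z) * f z \<partial>(M \<Otimes>\<^sub>M M)) = (\<integral>x. h x * g1 f x \<partial>M)"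
    "integrable (M \<Otimes>\<^sub>M M) (\<lambda>z. h (fst z) * \<phi>2 (snd z) * f z)"
    "(\<integral>z. h (fst z) * \<phi>2 (snd z) * f z \<partial>(M \<Otimes>\<^sub>M M)) = (\<integral>x. h x * g2 f x \<partial>M)"
proof -
  have f: "f \<in> borel_measurable (M \<Otimes>\<^sub>M M)" "integrable (M \<Otimes>\<^sub>M M) (\<lambda>z. (f z)\<^sup>2)"
    using assms by (auto simp: L2_def)
  note [measurable] = f(1)
  have f': "integrable (M \<Otimes>\<^sub>M M) (\<lambda>z. (f (snd z, fst z))\<^sup>2)"
    using swap_integrable[of "\<lambda>z. (f z)\<^sup>2"] f by simp
  note 1 = integral_times_marginal[OF swap_meas[OF f(1)] \<phi>_meas(1) assms(2) f' \<phi>_sq(1) h]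
  show "integrable (M \<Otimes>\<^sub>M M) (\<lambda>z. h (snd z) * \<phi>1 (fst z) * f z)"
    using 1(1) swap_integrable[of "\<lambda>z. h (snd z) * \<phi>1 (fst z) * f z"] by simp
  show "(\<integral>z. h (snd z) * \<phi>1 (fst z) * f z \<partial>(M \<Otimes>\<^sub>M M)) = (\<integral>x. h x * g1 f x \<partial>M)"
    using 1(2) swap_integral[of "\<lambda>z. h (snd z) * \<phi>1 (fst z) * f z"] by (simp add: g1_def)
  show "integrable (M \<Otimes>\<^sub>M M) (\<lambda>z. h (fst z) * \<phi>2 (snd z) * f z)"
    "(\<integral>z. h (fst z) * \<phi>2 (snd z) * f z \<partial>(M \<Otimes>\<^sub>M M)) = (\<integral>x. h x * g2 f x \<partial>M)"
    using integral_times_marginal[OF f(1) \<phi>_meas(2) assms(2) f(2) \<phi>_sq(2) h] by (simp_all add: g2_def)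
qed

lemma weighted:
  assumes [measurable]: "h \<in> borel_measurable M" and h: "integrable M (\<lambda>x. (h x)\<^sup>2)"
  shows "integrable (M \<Otimes>\<^sub>M M) (\<lambda>z. (h (snd z) * \<phi>1 (fst z))\<^sup>2 / w z)"
    "(\<integral>z. (h (snd z) * \<phi>1 (fst z))\<^sup>2 / w z \<partial>(M \<Otimes>\<^sub>M M)) = (\<integral>x. \<Lambda>1 x * (h x)\<^sup>2 \<partial>M)"
    "integrable M (\<lambda>x. \<Lambda>1 x * (h x)\<^sup>2)"
    "integrable (M \<Otimes>\<^sub>M M) (\<lambda>z. (h (fst z) * \<phi>2 (snd z))\<^sup>2 / w z)"
    "(\<integral>z. (h (fst z) * \<phi>2 (snd z))\<^sup>2 / w z \<partial>(M \<Otimes>\<^sub>M M)) = (\<integral>x. \<Lambda>2 x * (h x)\<^sup>2 \<partial>M)"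
    "integrable M (\<lambda>x. \<Lambda>2 x * (h x)\<^sup>2)"
proof -
  have b: "AE x in M. \<Lambda>1 x \<le> 1 / \<mu>1" "AE x in M. \<Lambda>2 x \<le> 1 / \<mu>2"
    using \<Lambda>1_less by (rule eventually_mono, use \<mu>_pos in \<open>simp add: field_simps\<close>)
      (use \<Lambda>2_less in \<open>rule eventually_mono\<close>, use \<mu>_pos in \<open>simp add: field_simps\<close>)
  note 1 = weighted_square_integrable[OF swap_meas[OF w_meas] \<phi>_meas(1) assms(1) w_nonneg h, of "1 / \<mu>1"]
  note 2 = weighted_square_integrable[OF w_meas \<phi>_meas(2) assms(1) w_nonneg h, of "1 / \<mu>2"]
  show "integrable (M \<Otimes>\<^sub>M M) (\<lambda>z. (h (snd z) * \<phi>1 (fst z))\<^sup>2 / w z)"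
    using 1(1) \<Lambda>1_int b(1) swap_integrable[of "\<lambda>z. (h (snd z) * \<phi>1 (fst z))\<^sup>2 / w z"] by (simp add: \<Lambda>1_eq)
  show "(\<integral>z. (h (snd z) * \<phi>1 (fst z))\<^sup>2 / w z \<partial>(M \<Otimes>\<^sub>M M)) = (\<integral>x. \<Lambda>1 x * (h x)\<^sup>2 \<partial>M)"
    using 1(2) \<Lambda>1_int b(1) swap_integral[of "\<lambda>z. (h (snd z) * \<phi>1 (fst z))\<^sup>2 / w z"] by (simp add: \<Lambda>1_eq)
  show "integrable M (\<lambda>x. \<Lambda>1 x * (h x)\<^sup>2)"
    using 1(3) \<Lambda>1_int b(1) by (simp add: \<Lambda>1_eq)
  show "integrable (M \<Otimes>\<^sub>M M) (\<lambda>z. (h (fst z) * \<phi>2 (snd z))\<^sup>2 / w z)"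
    "(\<integral>z. (h (fst z) * \<phi>2 (snd z))\<^sup>2 / w z \<partial>(M \<Otimes>\<^sub>M M)) = (\<integral>x. \<Lambda>2 x * (h x)\<^sup>2 \<partial>M)"
    "integrable M (\<lambda>x. \<Lambda>2 x * (h x)\<^sup>2)"
    using 2 \<Lambda>2_int b(2) by (simp_all add: \<Lambda>2_eq)
qed

text \<open>Completing the square: \<open>\<integral> (w f - S)\<^sup>2 / w \<ge> 0\<close> for
  \<open>S = \<mu>1 \<phi>1 g1 + \<mu>2 \<phi>2 g2\<close>, combined with \<open>\<integral> f S = \<mu>1 \<integral> g1\<^sup>2 + \<mu>2 \<integral> g2\<^sup>2\<close>.\<close>
lemma negative_energy:
  assumes f: "L2 f" and neg: "energy f < 0"
  shows "\<mu>1 * (\<integral>q. D1 q * (g1 f q)\<^sup>2 \<partial>M) + \<mu>2 * (\<integral>p. D2 p * (g2 f p)\<^sup>2 \<partial>M)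
     < 2 * (\<integral>z. \<mu>1 * \<mu>2 * (\<phi>1 (fst z) * \<phi>2 (snd z)) * (g2 f (fst z) * g1 f (snd z)) / w z \<partial>(M \<Otimes>\<^sub>M M))"
proof -
  have [measurable]: "f \<in> borel_measurable (M \<Otimes>\<^sub>M M)" and f2: "integrable (M \<Otimes>\<^sub>M M) (\<lambda>z. (f z)\<^sup>2)"
    using f by (auto simp: L2_def)
  define a where "a z = g1 f (snd z) * \<phi>1 (fst z)" for z
  define b where "b z = g2 f (fst z) * \<phi>2 (snd z)" for z
  have [measurable]: "a \<in> borel_measurable (M \<Otimes>\<^sub>M M)" "b \<in> borel_measurable (M \<Otimes>\<^sub>M M)"
    unfolding a_def b_def by measurable
  note G = g_L2[OF f]
  have wf2: "integrable (M \<Otimes>\<^sub>M M) (\<lambda>z. w z * (f z)\<^sup>2)"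
  proof (rule Bochner_Integration.integrable_bound)
    show "integrable (M \<Otimes>\<^sub>M M) (\<lambda>z. W * (f z)\<^sup>2)" using f2 by simp
    show "AE z in M \<Otimes>\<^sub>M M. norm (w z * (f z)\<^sup>2) \<le> norm (W * (f z)\<^sup>2)"
      using w_nonneg w_le by (auto simp: abs_mult intro!: mult_right_mono AE_I2) (metis abs_ge_self abs_of_nonneg order_trans)
  qed simp
  have af: "integrable (M \<Otimes>\<^sub>M M) (\<lambda>z. a z * f z)" "(\<integral>z. a z * f z \<partial>(M \<Otimes>\<^sub>M M)) = (\<integral>q. (g1 f q)\<^sup>2 \<partial>M)"
    using pairing(1,2)[OF f _ G(1)] by (auto simp: a_def power2_eq_square)
  have bf: "integrable (M \<Otimes>\<^sub>M M) (\<lambda>z. b z * f z)" "(\<integral>z. b z * f z \<partial>(M \<Otimes>\<^sub>M M)) = (\<integral>q. (g2 f q)\<^sup>2 \<partial>M)"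
    using pairing(3,4)[OF f _ G(2)] by (auto simp: b_def power2_eq_square)
  have aa: "integrable (M \<Otimes>\<^sub>M M) (\<lambda>z. (a z)\<^sup>2 / w z)" "(\<integral>z. (a z)\<^sup>2 / w z \<partial>(M \<Otimes>\<^sub>M M)) = (\<integral>x. \<Lambda>1 x * (g1 f x)\<^sup>2 \<partial>M)"
      "integrable M (\<lambda>x. \<Lambda>1 x * (g1 f x)\<^sup>2)"
    using weighted(1-3)[OF _ G(1)] by (auto simp: a_def)
  have bb: "integrable (M \<Otimes>\<^sub>M M) (\<lambda>z. (b z)\<^sup>2 / w z)" "(\<integral>z. (b z)\<^sup>2 / w z \<partial>(M \<Otimes>\<^sub>M M)) = (\<integral>x. \<Lambda>2 x * (g2 f x)\<^sup>2 \<partial>M)"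
      "integrable M (\<lambda>x. \<Lambda>2 x * (g2 f x)\<^sup>2)"
    using weighted(4-6)[OF _ G(2)] by (auto simp: b_def)
  have ab: "integrable (M \<Otimes>\<^sub>M M) (\<lambda>z. a z * b z / w z)"
  proof -
    have "integrable (M \<Otimes>\<^sub>M M) (\<lambda>z. a z / sqrt (w z) * (b z / sqrt (w z)))"
      using aa(1) bb(1) w_nonneg by (intro integrable_mult_of_squares) (auto simp: power_divide)
    then show ?thesis using w_nonneg by (simp add: real_sqrt_mult_self)
  qed
  let ?I = "integral\<^sup>L (M \<Otimes>\<^sub>M M)"
  let ?F = "\<lambda>z. w z * (f z)\<^sup>2 - 2 * \<mu>1 * (a z * f z) - 2 * \<mu>2 * (b z * f z)
     + \<mu>1\<^sup>2 * ((a z)\<^sup>2 / w z) + \<mu>2\<^sup>2 * ((b z)\<^sup>2 / w z) + 2 * \<mu>1 * \<mu>2 * (a z * b z / w z)"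
  have "0 \<le> ?I ?F"
  proof (rule integral_nonneg_AE)
    show "AE z in M \<Otimes>\<^sub>M M. 0 \<le> ?F z"
      using w_pos
    proof eventually_elim
      case (elim z)
      have "?F z = (w z * f z - \<mu>1 * a z - \<mu>2 * b z)\<^sup>2 / w z"
        using elim by (simp add: power2_eq_square field_simps)
      then show ?case using elim by simp
    qed
  qed
  also have "?I ?F = ?I (\<lambda>z. w z * (f z)\<^sup>2) - 2 * \<mu>1 * (\<integral>q. (g1 f q)\<^sup>2 \<partial>M) - 2 * \<mu>2 * (\<integral>q. (g2 f q)\<^sup>2 \<partial>M)
    + \<mu>1\<^sup>2 * (\<integral>x. \<Lambda>1 x * (g1 f x)\<^sup>2 \<partial>M) + \<mu>2\<^sup>2 * (\<integral>x. \<Lambda>2 x * (g2 f x)\<^sup>2 \<partial>M) + 2 * \<mu>1 * \<mu>2 * ?I (\<lambda>z. a z * b z / w z)"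
  proof -
    have lin: "?I (\<lambda>z. h1 z - c2 * h2 z - c3 * h3 z + c4 * h4 z + c5 * h5 z + c6 * h6 z)
      = ?I h1 - c2 * ?I h2 - c3 * ?I h3 + c4 * ?I h4 + c5 * ?I h5 + c6 * ?I h6"
      if "integrable (M \<Otimes>\<^sub>M M) h1" "integrable (M \<Otimes>\<^sub>M M) h2" "integrable (M \<Otimes>\<^sub>M M) h3"
        "integrable (M \<Otimes>\<^sub>M M) h4" "integrable (M \<Otimes>\<^sub>M M) h5" "integrable (M \<Otimes>\<^sub>M M) h6"
      for h1 h2 h3 h4 h5 h6 :: "'a \<times> 'a \<Rightarrow> real" and c2 c3 c4 c5 c6
      using that by simp
    show ?thesis
      unfolding aa(2)[symmetric] bb(2)[symmetric] af(2)[symmetric] bf(2)[symmetric]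
      by (rule lin[OF wf2 af(1) bf(1) aa(1) bb(1) ab])
  qed
  finally have 1: "0 \<le> ?I (\<lambda>z. w z * (f z)\<^sup>2) - 2 * \<mu>1 * (\<integral>q. (g1 f q)\<^sup>2 \<partial>M) - 2 * \<mu>2 * (\<integral>q. (g2 f q)\<^sup>2 \<partial>M)
    + \<mu>1\<^sup>2 * (\<integral>x. \<Lambda>1 x * (g1 f x)\<^sup>2 \<partial>M) + \<mu>2\<^sup>2 * (\<integral>x. \<Lambda>2 x * (g2 f x)\<^sup>2 \<partial>M) + 2 * \<mu>1 * \<mu>2 * ?I (\<lambda>z. a z * b z / w z)" .
  \<comment> \<open>Negative energy bounds the integral of w f^2 by \<mu>1 |g1|^2 + \<mu>2 |g2|^2,
    which turns -2 \<mu> |g|^2 into -\<mu> |g|^2; together with the \<mu>^2 \<Lambda> terms this is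
    minus the integral of \<mu> D g^2.\<close>
  have 2: "(\<integral>q. D1 q * (g1 f q)\<^sup>2 \<partial>M) = (\<integral>q. (g1 f q)\<^sup>2 \<partial>M) - \<mu>1 * (\<integral>x. \<Lambda>1 x * (g1 f x)\<^sup>2 \<partial>M)"
    using G(1) aa(3) by (simp add: D1_def left_diff_distrib mult.assoc)
  have 3: "(\<integral>q. D2 q * (g2 f q)\<^sup>2 \<partial>M) = (\<integral>q. (g2 f q)\<^sup>2 \<partial>M) - \<mu>2 * (\<integral>x. \<Lambda>2 x * (g2 f x)\<^sup>2 \<partial>M)"
    using G(2) bb(3) by (simp add: D2_def left_diff_distrib mult.assoc)
  have 4: "?I (\<lambda>z. \<mu>1 * \<mu>2 * (\<phi>1 (fst z) * \<phi>2 (snd z)) * (g2 f (fst z) * g1 f (snd z)) / w z)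
     = \<mu>1 * \<mu>2 * ?I (\<lambda>z. a z * b z / w z)"
    unfolding integral_mult_right_zero[symmetric] by (simp add: a_def b_def mult_ac)
  show ?thesis using 1 neg unfolding 2 3 4 energy_def
    by (simp add: power2_eq_square algebra_simps)
qed

text \<open>The finitely many marginal integrals converge simultaneously on almost every section
  only, so linearity is an almost everywhere statement.\<close>

lemma g_sum:
  assumes "finite I" "\<And>i. i \<in> I \<Longrightarrow> L2 (f i)"
  shows "AE x in M. g1 (\<lambda>z. \<Sum>i\<in>I. c i * f i z) x = (\<Sum>i\<in>I. c i * g1 (f i) x)"
    "AE x in M. g2 (\<lambda>z. \<Sum>i\<in>I. c i * f i z) x = (\<Sum>i\<in>I. c i * g2 (f i) x)"
proof -
  have "AE x in M. \<forall>i\<in>I. integrable M (\<lambda>y. \<phi>1 y * f i (y, x))"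
    using assms g_L2 by (intro AE_finite_allI) auto
  then show "AE x in M. g1 (\<lambda>z. \<Sum>i\<in>I. c i * f i z) x = (\<Sum>i\<in>I. c i * g1 (f i) x)"
  proof eventually_elim
    case (elim x)
    have "(\<lambda>t. \<phi>1 t * (\<Sum>i\<in>I. c i * f i (t, x))) = (\<lambda>t. \<Sum>i\<in>I. c i * (\<phi>1 t * f i (t, x)))"
      by (simp add: sum_distrib_left mult_ac)
    then show ?case using elim by (simp add: g1_def Bochner_Integration.integral_sum)
  qed
  have "AE x in M. \<forall>i\<in>I. integrable M (\<lambda>y. \<phi>2 y * f i (x, y))"
    using assms g_L2 by (intro AE_finite_allI) auto
  then show "AE x in M. g2 (\<lambda>z. \<Sum>i\<in>I. c i * f i z) x = (\<Sum>i\<in>I. c i * g2 (f i) x)"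
  proof eventually_elim
    case (elim x)
    have "(\<lambda>t. \<phi>2 t * (\<Sum>i\<in>I. c i * f i (x, t))) = (\<lambda>t. \<Sum>i\<in>I. c i * (\<phi>2 t * f i (x, t)))"
      by (simp add: sum_distrib_left mult_ac)
    then show ?case using elim by (simp add: g2_def Bochner_Integration.integral_sum)
  qed
qed

lemma L2_sum:
  assumes "finite I" "\<And>i. i \<in> I \<Longrightarrow> L2 (f i)"
  shows "L2 (\<lambda>z. \<Sum>i\<in>I. c i * f i z)"
  using assms unfolding L2_def
  by (auto intro!: integrable_square_sum borel_measurable_sum borel_measurable_times simp: power_mult_distrib)

text \<open>The weights sqrt(\<mu> D) turn the left side of \<open>negative_energy\<close> into a
  sum of two squared norms; on the right they cancel against the roots of D in \<open>K\<close>, and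
  the two factors sqrt(\<mu>1 \<mu>2) multiply to \<mu>1 \<mu>2. D <= 1 keeps the weighted marginals
  in L2, and D > 0 almost everywhere permits the cancellation.\<close>

theorem negative_energy_dimension_bound:
  assumes K2: "integrable (M \<Otimes>\<^sub>M M) (\<lambda>z. (K z)\<^sup>2)"
    and f: "\<And>i. L2 (f i)"
    and neg: "\<And>c. \<exists>i<N. c i \<noteq> 0 \<Longrightarrow> energy (\<lambda>z. \<Sum>i<N. c i * f i z) < 0"
  shows "real N \<le> (\<integral>z. (K z)\<^sup>2 \<partial>(M \<Otimes>\<^sub>M M))"
proof (rule hilbert_schmidt_bound[where ?x1.0="\<lambda>i q. sqrt (\<mu>1 * D1 q) * g1 (f i) q" and ?x2.0="\<lambda>i p. sqrt (\<mu>2 * D2 p) * g2 (f i) p"])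
  show "sigma_finite_measure M" ..
  have [measurable]: "f i \<in> borel_measurable (M \<Otimes>\<^sub>M M)" for i using f by (auto simp: L2_def)
  show "(\<lambda>q. sqrt (\<mu>1 * D1 q) * g1 (f i) q) \<in> borel_measurable M" "(\<lambda>p. sqrt (\<mu>2 * D2 p) * g2 (f i) p) \<in> borel_measurable M" for i
    by measurable
  show "integrable M (\<lambda>x. (sqrt (\<mu>1 * D1 x) * g1 (f i) x)\<^sup>2)" for i
  proof (rule Bochner_Integration.integrable_bound)
    show "integrable M (\<lambda>x. \<mu>1 * (g1 (f i) x)\<^sup>2)" using g_L2[OF f] by simp
    show "AE x in M. norm ((sqrt (\<mu>1 * D1 x) * g1 (f i) x)\<^sup>2) \<le> norm (\<mu>1 * (g1 (f i) x)\<^sup>2)"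
      using D_pos(1) by eventually_elim (use \<mu>_pos D_le1 in \<open>auto simp: power_mult_distrib abs_mult intro!: mult_left_mono mult_left_le_one_le\<close>)
  qed simp
  show "integrable M (\<lambda>x. (sqrt (\<mu>2 * D2 x) * g2 (f i) x)\<^sup>2)" for i
  proof (rule Bochner_Integration.integrable_bound)
    show "integrable M (\<lambda>x. \<mu>2 * (g2 (f i) x)\<^sup>2)" using g_L2[OF f] by simp
    show "AE x in M. norm ((sqrt (\<mu>2 * D2 x) * g2 (f i) x)\<^sup>2) \<le> norm (\<mu>2 * (g2 (f i) x)\<^sup>2)"
      using D_pos(2) by eventually_elim (use \<mu>_pos D_le1 in \<open>auto simp: power_mult_distrib abs_mult intro!: mult_left_mono mult_left_le_one_le\<close>)
  qed simp
  fix c :: "nat \<Rightarrow> real" assume c: "\<exists>i<N. c i \<noteq> 0"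
  define F where "F z = (\<Sum>i<N. c i * f i z)" for z
  have F: "L2 F" unfolding F_def using f by (intro L2_sum) auto
  then have [measurable]: "F \<in> borel_measurable (M \<Otimes>\<^sub>M M)" by (auto simp: L2_def)
  have e: "energy F < 0" using neg[OF c] by (simp add: F_def[abs_def])
  have s1: "AE x in M. (\<Sum>i<N. c i * (sqrt (\<mu>1 * D1 x) * g1 (f i) x)) = sqrt (\<mu>1 * D1 x) * g1 F x"
    using g_sum(1)[of "{..<N}" f c, OF _ f] by (auto simp: F_def[abs_def] sum_distrib_left mult_ac elim!: eventually_mono)
  have s2: "AE x in M. (\<Sum>i<N. c i * (sqrt (\<mu>2 * D2 x) * g2 (f i) x)) = sqrt (\<mu>2 * D2 x) * g2 F x"
    using g_sum(2)[of "{..<N}" f c, OF _ f] by (auto simp: F_def[abs_def] sum_distrib_left mult_ac elim!: eventually_mono)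
  have i1: "(\<integral>x. (\<Sum>i<N. c i * (sqrt (\<mu>1 * D1 x) * g1 (f i) x))\<^sup>2 \<partial>M) = \<mu>1 * (\<integral>q. D1 q * (g1 F q)\<^sup>2 \<partial>M)"
    unfolding integral_mult_right_zero[symmetric]
    by (rule integral_cong_AE) (use s1 D_pos(1) \<mu>_pos in \<open>auto simp: power_mult_distrib\<close>)
  have i2: "(\<integral>x. (\<Sum>i<N. c i * (sqrt (\<mu>2 * D2 x) * g2 (f i) x))\<^sup>2 \<partial>M) = \<mu>2 * (\<integral>q. D2 q * (g2 F q)\<^sup>2 \<partial>M)"
    unfolding integral_mult_right_zero[symmetric]
    by (rule integral_cong_AE) (use s2 D_pos(2) \<mu>_pos in \<open>auto simp: power_mult_distrib\<close>)
  have i3: "(\<integral>z. K z * ((\<Sum>i<N. c i * (sqrt (\<mu>2 * D2 (fst z)) * g2 (f i) (fst z))) *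
                   (\<Sum>i<N. c i * (sqrt (\<mu>1 * D1 (snd z)) * g1 (f i) (snd z)))) \<partial>(M \<Otimes>\<^sub>M M))
     = (\<integral>z. \<mu>1 * \<mu>2 * (\<phi>1 (fst z) * \<phi>2 (snd z)) * (g2 F (fst z) * g1 F (snd z)) / w z \<partial>(M \<Otimes>\<^sub>M M))"
  proof (rule integral_cong_AE)
    show "AE z in M \<Otimes>\<^sub>M M. K z * ((\<Sum>i<N. c i * (sqrt (\<mu>2 * D2 (fst z)) * g2 (f i) (fst z))) *
                   (\<Sum>i<N. c i * (sqrt (\<mu>1 * D1 (snd z)) * g1 (f i) (snd z)))) =
         \<mu>1 * \<mu>2 * (\<phi>1 (fst z) * \<phi>2 (snd z)) * (g2 F (fst z) * g1 F (snd z)) / w z"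
      using AE_pair_fst[OF s2] AE_pair_snd[OF s1] AE_pair_fst[OF D_pos(2)] AE_pair_snd[OF D_pos(1)] w_pos
    proof eventually_elim
      case (elim z)
      have "sqrt (\<mu>1 * \<mu>2) * sqrt (\<mu>1 * \<mu>2) = \<mu>1 * \<mu>2" using \<mu>_pos by simp
      then show ?case unfolding elim(1,2) K_def using elim(3-5) \<mu>_pos
        by (simp add: real_sqrt_mult field_simps)
    qed
  qed measurable
  show "(\<integral>x. (\<Sum>i<N. c i * (sqrt (\<mu>1 * D1 x) * g1 (f i) x))\<^sup>2 \<partial>M) +
        (\<integral>x. (\<Sum>i<N. c i * (sqrt (\<mu>2 * D2 x) * g2 (f i) x))\<^sup>2 \<partial>M)
        < 2 * (\<integral>z. K z * ((\<Sum>i<N. c i * (sqrt (\<mu>2 * D2 (fst z)) * g2 (f i) (fst z))) *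
                   (\<Sum>i<N. c i * (sqrt (\<mu>1 * D1 (snd z)) * g1 (f i) (snd z)))) \<partial>(M \<Otimes>\<^sub>M M))"
    unfolding i1 i2 i3 by (rule negative_energy[OF F e])
qed (use K2 in auto)

end

section \<open>Integrals of powers of the norm\<close>

text \<open>Almost everywhere f is dominated by the series of a k times the indicator of A k,
  because a single term already dominates; the sets may overlap. Applied to dyadic balls, this takes
  the place of polar coordinates.\<close>

lemma dyadic_integral_bound:
  fixes f :: "'a \<Rightarrow> real" and A :: "nat \<Rightarrow> 'a set"
  assumes [measurable]: "f \<in> borel_measurable M" "\<And>k. A k \<in> sets M"
    and f: "\<And>x. 0 \<le> f x" and a: "\<And>k. 0 \<le> a k" and m: "\<And>k. 0 \<le> m k"
    and cover: "AE x in M. f x = 0 \<or> (\<exists>k. x \<in> A k \<and> f x \<le> a k)"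
    and A: "\<And>k. emeasure M (A k) \<le> ennreal (m k)"
    and S: "(\<lambda>k. a k * m k) sums S"
  shows "integrable M f" "(\<integral>x. f x \<partial>M) \<le> S"
proof -
  have S0: "0 \<le> S" unfolding sums_unique[OF S] using S a m by (intro suminf_nonneg) (auto simp: sums_iff)
  have "(\<integral>\<^sup>+x. ennreal (f x) \<partial>M) \<le> (\<integral>\<^sup>+x. (\<Sum>k. ennreal (a k) * indicator (A k) x) \<partial>M)"
  proof (rule nn_integral_mono_AE, use cover in eventually_elim)
    case (elim x)
    then consider "f x = 0" | k where "x \<in> A k" "f x \<le> a k" by blast
    then show "ennreal (f x) \<le> (\<Sum>k. ennreal (a k) * indicator (A k) x)"
    proof cases
      case (2 k)
      then have "ennreal (f x) \<le> ennreal (a k) * indicator (A k) x" by (simp add: ennreal_leI)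
      also have "\<dots> = (\<Sum>i\<in>{k}. ennreal (a i) * indicator (A i) x)"
        by (simp only: sum.insert[OF finite.emptyI] sum.empty empty_iff not_False_eq_True add_0_right)
      also have "\<dots> \<le> (\<Sum>i. ennreal (a i) * indicator (A i) x)"
        by (intro sum_le_suminf) auto
      finally show ?thesis .
    qed simp
  qed
  also have "\<dots> = (\<Sum>k. ennreal (a k) * emeasure M (A k))"
    by (subst nn_integral_suminf) (auto simp: nn_integral_cmult)
  also have "\<dots> \<le> (\<Sum>k. ennreal (a k * m k))"
    using A a by (intro suminf_le) (auto simp: ennreal_mult' intro!: mult_left_mono)
  also have "\<dots> = ennreal S"
    using S a m by (intro suminf_ennreal_eq) auto
  finally have le: "(\<integral>\<^sup>+x. ennreal (f x) \<partial>M) \<le> ennreal S" .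
  then have "(\<integral>\<^sup>+x. ennreal (norm (f x)) \<partial>M) < \<infinity>" using f by (simp add: le_less_trans)
  then show i: "integrable M f" by (intro integrableI_bounded) auto
  show "(\<integral>x. f x \<partial>M) \<le> S"
    using le nn_integral_eq_integral[OF i] f S0 by simp
qed

text \<open>To the ball of radius r/2^k belongs the value of the weight at half that radius, so a k
  m k is geometric with ratio 2^(s - n), below 1 because s < n.\<close>

lemma integral_norm_powr_ball:
  fixes s :: real
  assumes s: "0 \<le> s" "s < DIM('a::euclidean_space)"
  obtains C where "C > 0" "\<And>r. r > 0 \<Longrightarrow> integrable lborel (\<lambda>x::'a. indicator (cball 0 r) x * norm x powr - s)"
    "\<And>r. r > 0 \<Longrightarrow> integral\<^sup>L lborel (\<lambda>x::'a. indicator (cball 0 r) x * norm x powr - s) \<le> C * r powr (DIM('a) - s)"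
proof -
  let ?n = "DIM('a)"
  define V where "V = unit_ball_vol ?n"
  have V: "V > 0" by (simp add: V_def)
  define q where "q = 2 powr - (?n - s)"
  have q: "0 < q" "q < 1" using s by (auto simp: q_def powr_less_one)
  define C where "C = 2 powr s * V / (1 - q)"
  have C: "C > 0" using q V by (simp add: C_def)
  have main: "integrable lborel (\<lambda>x::'a. indicator (cball 0 r) x * norm x powr - s) \<and>
     integral\<^sup>L lborel (\<lambda>x::'a. indicator (cball 0 r) x * norm x powr - s) \<le> C * r powr (?n - s)" if r: "r > 0" for r
  proof -
    define a where "a k = (r / 2 ^ Suc k) powr - s" for k
    define m where "m k = V * (r / 2 ^ k) ^ ?n" for k
    have "a k * m k = 2 powr s * V * r powr (?n - s) * q ^ k" for k
    proof -
      have p2: "(2::real) ^ k = 2 powr k" by (simp add: powr_realpow)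
      have 1: "a k = r powr - s * 2 powr s * 2 powr (k * s)"
        using r by (simp add: a_def powr_divide powr_minus powr_mult p2 powr_powr field_simps)
      have 2: "m k = V * (r powr ?n * 2 powr - (k * ?n))"
        using r by (simp add: m_def power_divide p2 powr_realpow [symmetric] powr_powr powr_minus field_simps)
      have 3: "q ^ k = 2 powr (k * s) * 2 powr - (k * ?n)"
        using q by (simp add: powr_realpow[symmetric] q_def powr_powr powr_add[symmetric] algebra_simps)
      have 4: "r powr (?n - s) = r powr - s * r powr ?n" by (simp add: powr_add[symmetric])
      show ?thesis unfolding 1 2 3 4 by simp
    qed
    then have sums: "(\<lambda>k. a k * m k) sums (C * r powr (?n - s))"
      using sums_mult[OF geometric_sums[of q], of "2 powr s * V * r powr (?n - s)"] q
      by (simp add: C_def mult_ac)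
    have cover: "AE x::'a in lborel. indicator (cball 0 r) x * norm x powr - s = 0 \<or>
        (\<exists>k. x \<in> cball 0 (r / 2 ^ k) \<and> indicator (cball 0 r) x * norm x powr - s \<le> a k)"
    proof (rule AE_I2)
      fix x :: 'a
      show "indicator (cball 0 r) x * norm x powr - s = 0 \<or>
        (\<exists>k. x \<in> cball 0 (r / 2 ^ k) \<and> indicator (cball 0 r) x * norm x powr - s \<le> a k)"
      proof (cases "x = 0 \<or> x \<notin> cball 0 r")
        case False
        then have x: "norm x > 0" "norm x \<le> r" by auto
        \<comment> \<open>The least k satisfying \<open>P\<close> is positive because |x| <= r; its
          predecessor k gives the shell r/2^(k+1) < |x| <= r/2^k that contains x.\<close>
        define P where "P k \<longleftrightarrow> r / 2 ^ k < norm x" for k :: nat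
        obtain k0 where "(1/2) ^ k0 < norm x / r"
          using real_arch_pow_inv[of "norm x / r" "1/2"] x r by auto
        then have "P k0" using r by (simp add: P_def field_simps power_divide)
        then have L: "P (LEAST k. P k)" by (rule LeastI)
        have "(LEAST k. P k) \<noteq> 0" using L x by (auto simp: P_def intro: ccontr)
        then obtain k where k: "(LEAST k. P k) = Suc k" using not0_implies_Suc by blast
        then have PS: "P (Suc k)" using L by simp
        have nP: "\<not> P k" using k not_less_Least[of k P] by simp
        then have "x \<in> cball 0 (r / 2 ^ k)" by (simp add: P_def)
        moreover have "norm x powr - s \<le> a k"
          using PS r s unfolding P_def a_def by (intro powr_mono2') auto
        ultimately show ?thesis using x by auto
      qed auto
    qed
    have ms: "emeasure lborel (cball 0 (r / 2 ^ k) :: 'a set) \<le> ennreal (m k)" for k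
      using r by (simp add: emeasure_cball m_def V_def)
    have mb: "(\<lambda>x::'a. indicator (cball 0 r) x * norm x powr - s) \<in> borel_measurable lborel"
      by (intro borel_measurable_times borel_measurable_indicator powr_real_measurable) auto
    note * = dyadic_integral_bound[of "\<lambda>x::'a. indicator (cball 0 r) x * norm x powr - s" lborel
        "\<lambda>k. cball 0 (r / 2 ^ k)", OF mb _ _ _ _ cover ms sums]
    show ?thesis
      using r V by (intro conjI *) (auto simp: a_def m_def)
  qed
  show ?thesis using that[of C] C main by blast
qed

text \<open>The mirror image of the integral over a ball: the shells r 2^k <= |x| < r 2^(k+1) run
  outwards, and the ratio 2^(n - s) is below 1 because s > n.\<close>

lemma integral_norm_powr_outside_ball:
  fixes s :: real
  assumes s: "DIM('a::euclidean_space) < s"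
  obtains C where "C > 0" "\<And>r. r > 0 \<Longrightarrow> integrable lborel (\<lambda>x::'a. indicator (- ball 0 r) x * norm x powr - s)"
    "\<And>r. r > 0 \<Longrightarrow> integral\<^sup>L lborel (\<lambda>x::'a. indicator (- ball 0 r) x * norm x powr - s) \<le> C * r powr (DIM('a) - s)"
proof -
  let ?n = "DIM('a)"
  define V where "V = unit_ball_vol ?n"
  have V: "V > 0" by (simp add: V_def)
  define q where "q = 2 powr (?n - s)"
  have q: "0 < q" "q < 1" using s by (auto simp: q_def powr_less_one)
  define C where "C = 2 ^ ?n * V / (1 - q)"
  have C: "C > 0" using q V by (simp add: C_def)
  have main: "integrable lborel (\<lambda>x::'a. indicator (- ball 0 r) x * norm x powr - s) \<and>
     integral\<^sup>L lborel (\<lambda>x::'a. indicator (- ball 0 r) x * norm x powr - s) \<le> C * r powr (?n - s)" if r: "r > 0" for r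
  proof -
    define a where "a k = (r * 2 ^ k) powr - s" for k
    define m where "m k = V * (r * 2 ^ Suc k) ^ ?n" for k
    have "a k * m k = 2 ^ ?n * V * r powr (?n - s) * q ^ k" for k
    proof -
      have p2: "(2::real) ^ k = 2 powr k" by (simp add: powr_realpow)
      have 1: "a k = r powr - s * 2 powr - (k * s)"
        using r by (simp add: a_def powr_mult p2 powr_powr)
      have 2: "m k = V * (r powr ?n * 2 ^ ?n * 2 powr (k * ?n))"
        using r by (simp add: m_def power_mult_distrib p2 powr_realpow [symmetric] powr_powr)
      have 3: "q ^ k = 2 powr - (k * s) * 2 powr (k * ?n)"
        using q by (simp add: powr_realpow[symmetric] q_def powr_powr powr_add[symmetric] algebra_simps)
      have 4: "r powr (?n - s) = r powr - s * r powr ?n" by (simp add: powr_add[symmetric])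
      show ?thesis unfolding 1 2 3 4 by simp
    qed
    then have sums: "(\<lambda>k. a k * m k) sums (C * r powr (?n - s))"
      using sums_mult[OF geometric_sums[of q], of "2 ^ ?n * V * r powr (?n - s)"] q
      by (simp add: C_def mult_ac)
    have cover: "AE x::'a in lborel. indicator (- ball 0 r) x * norm x powr - s = 0 \<or>
        (\<exists>k. x \<in> cball 0 (r * 2 ^ Suc k) \<and> indicator (- ball 0 r) x * norm x powr - s \<le> a k)"
    proof (rule AE_I2)
      fix x :: 'a
      show "indicator (- ball 0 r) x * norm x powr - s = 0 \<or>
        (\<exists>k. x \<in> cball 0 (r * 2 ^ Suc k) \<and> indicator (- ball 0 r) x * norm x powr - s \<le> a k)"
      proof (cases "x \<in> ball 0 r")
        case False
        then have x: "norm x \<ge> r" by auto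
        define P where "P k \<longleftrightarrow> norm x < r * 2 ^ k" for k :: nat
        obtain k0 where "norm x / r < 2 ^ k0"
          using real_arch_pow[of 2 "norm x / r"] by auto
        then have "P k0" using r by (simp add: P_def field_simps)
        then have L: "P (LEAST k. P k)" by (rule LeastI)
        have "(LEAST k. P k) \<noteq> 0" using L x by (auto simp: P_def intro: ccontr)
        then obtain k where k: "(LEAST k. P k) = Suc k" using not0_implies_Suc by blast
        then have PS: "P (Suc k)" using L by simp
        have nP: "\<not> P k" using k not_less_Least[of k P] by simp
        have "x \<in> cball 0 (r * 2 ^ Suc k)" using PS by (simp add: P_def)
        moreover have "norm x powr - s \<le> a k"
          using nP r s unfolding P_def a_def by (intro powr_mono2') auto
        ultimately show ?thesis using x by auto
      qed auto
    qed
    have ms: "emeasure lborel (cball 0 (r * 2 ^ Suc k) :: 'a set) \<le> ennreal (m k)" for k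
      using r by (simp add: emeasure_cball m_def V_def)
    have mb: "(\<lambda>x::'a. indicator (- ball 0 r) x * norm x powr - s) \<in> borel_measurable lborel"
      by (intro borel_measurable_times borel_measurable_indicator powr_real_measurable) auto
    note * = dyadic_integral_bound[of "\<lambda>x::'a. indicator (- ball 0 r) x * norm x powr - s" lborel
        "\<lambda>k. cball 0 (r * 2 ^ Suc k)", OF mb _ _ _ _ cover ms sums]
    show ?thesis
      using r V by (intro conjI *) (auto simp: a_def m_def)
  qed
  show ?thesis using that[of C] C main by blast
qed

section \<open>Translated ellipsoids\<close>

lemma lborel_integral_uminus:
  fixes f :: "'a::euclidean_space \<Rightarrow> real"
  assumes [measurable]: "f \<in> borel_measurable borel"
  shows "(\<integral>x. f (- x) \<partial>lborel) = (\<integral>x. f x \<partial>lborel)"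
proof -
  have "lborel = distr lborel borel (uminus :: 'a \<Rightarrow> 'a)"
    using lborel_affine[of "-1" "0::'a"] by (simp add: density_1)
  then have "(\<integral>x. f x \<partial>lborel) = (\<integral>x. f x \<partial>(distr lborel borel uminus))" by simp
  also have "\<dots> = (\<integral>x. f (- x) \<partial>lborel)" by (rule integral_distr) auto
  finally show ?thesis ..
qed

lemma lborel_integral_translation:
  fixes f :: "'a::euclidean_space \<Rightarrow> real"
  assumes [measurable]: "f \<in> borel_measurable borel"
  shows "(\<integral>x. f (x + c) \<partial>lborel) = (\<integral>x. f x \<partial>lborel)"
proof -
  have "(\<integral>x. f x \<partial>lborel) = (\<integral>x. f x \<partial>(distr lborel borel ((+) c)))" by (simp add: lborel_distr_plus)
  also have "\<dots> = (\<integral>x. f (c + x) \<partial>lborel)" by (rule integral_distr) auto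
  finally show ?thesis by (simp add: add.commute)
qed

lemma integrable_lborel_bounded_support:
  fixes f :: "'a::euclidean_space \<Rightarrow> real"
  assumes "f \<in> borel_measurable lborel" "\<And>x. \<bar>f x\<bar> \<le> B * indicator (cball 0 r) x"
  shows "integrable lborel f"
proof (rule Bochner_Integration.integrable_bound)
  show "integrable lborel (\<lambda>x::'a. B * indicator (cball 0 r) x)"
    by (intro integrable_mult_right integrable_real_indicator emeasure_lborel_cball_finite) simp
  show "AE x in lborel. norm (f x) \<le> norm (B * indicator (cball 0 r) x)"
    using assms(2) by (auto intro!: AE_I2 order_trans[OF _ abs_ge_self])
qed fact

text \<open>An exact identity writes the left side as minus the second difference over ap a0, plus a
  product of two first differences over ap am a0. First differences thus enter only quadratically,
  which yields p^2/t^4 where a single difference of reciprocals would give p/t^3.\<close>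

lemma second_difference_inverse:
  fixes a0 ap am c C p t :: real
  assumes c: "c > 0" and C: "C \<ge> 0" and t: "t > 0" and p: "p \<ge> 0"
    and a0: "a0 \<ge> c * t\<^sup>2" and ap: "ap \<ge> c * (p\<^sup>2 + t\<^sup>2)" and am: "am \<ge> c * (p\<^sup>2 + t\<^sup>2)"
    and hp: "\<bar>ap - a0\<bar> \<le> C * p * (p + t)" and hm: "\<bar>am - a0\<bar> \<le> C * p * (p + t)"
    and h2: "\<bar>ap + am - 2 * a0\<bar> \<le> C * p\<^sup>2"
  shows "1 / ap + 1 / am - 2 / a0 \<le> (C / c\<^sup>2 + 4 * C\<^sup>2 / c^3) * (p\<^sup>2 / t^4)"
proof -
  define S where "S = p\<^sup>2 + t\<^sup>2"
  have S: "S \<ge> t\<^sup>2" "S > 0" using t by (auto simp: S_def add_nonneg_pos)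
  have pos: "a0 > 0" "ap > 0" "am > 0"
    using a0 ap am c t S by (smt (verit) S_def mult_pos_pos zero_less_power)+
  have pt: "(p + t)\<^sup>2 \<le> 2 * S"
    using sum_squares_bound[of p t] by (simp add: S_def power2_eq_square algebra_simps)
  have t4: "c * t\<^sup>2 > 0" "c * S > 0" using c t S by auto
  have "1 / ap + 1 / am - 2 / a0 = - (ap + am - 2 * a0) / (ap * a0) + (am - a0) * (am - ap) / (ap * am * a0)"
    using pos by (simp add: field_simps)
  also have "\<dots> \<le> C / c\<^sup>2 * (p\<^sup>2 / t^4) + 4 * C\<^sup>2 / c^3 * (p\<^sup>2 / t^4)"
  proof (rule add_mono)
    have "- (ap + am - 2 * a0) / (ap * a0) \<le> C * p\<^sup>2 / ((c * t\<^sup>2) * (c * t\<^sup>2))"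
    proof (rule frac_le)
      show "c * t\<^sup>2 * (c * t\<^sup>2) \<le> ap * a0"
        using ap a0 c S t4 pos by (intro mult_mono) (auto simp: S_def[symmetric] intro: order_trans[OF mult_left_mono])
    qed (use h2 t4 C in auto)
    then show "- (ap + am - 2 * a0) / (ap * a0) \<le> C / c\<^sup>2 * (p\<^sup>2 / t^4)"
      by (simp add: power2_eq_square power4_eq_xxxx mult_ac)
    have "(am - a0) * (am - ap) \<le> \<bar>am - a0\<bar> * \<bar>am - ap\<bar>"
      by (metis abs_ge_self abs_mult)
    also have "\<dots> \<le> (C * p * (p + t)) * (2 * (C * p * (p + t)))"
      using hp hm C p t by (intro mult_mono) auto
    also have "\<dots> = 2 * C\<^sup>2 * p\<^sup>2 * (p + t)\<^sup>2" by (simp add: power2_eq_square)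
    also have "\<dots> \<le> 2 * C\<^sup>2 * p\<^sup>2 * (2 * S)"
      using pt by (intro mult_left_mono) auto
    finally have num: "(am - a0) * (am - ap) \<le> 4 * C\<^sup>2 * p\<^sup>2 * S" by simp
    have "(am - a0) * (am - ap) / (ap * am * a0) \<le> 4 * C\<^sup>2 * p\<^sup>2 * S / ((c * S) * (c * t\<^sup>2) * (c * t\<^sup>2))"
    proof (rule frac_le)
      show "c * S * (c * t\<^sup>2) * (c * t\<^sup>2) \<le> ap * am * a0"
        using ap am a0 c S t4 pos by (intro mult_mono) (auto simp: S_def[symmetric] intro: order_trans[OF mult_left_mono])
    qed (use num t4 S in auto)
    also have "\<dots> = 4 * C\<^sup>2 / c^3 * (p\<^sup>2 / t^4)"
      using S by (simp add: power2_eq_square power4_eq_xxxx power3_eq_cube mult_ac)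
    finally show "(am - a0) * (am - ap) / (ap * am * a0) \<le> 4 * C\<^sup>2 / c^3 * (p\<^sup>2 / t^4)" .
  qed
  finally show ?thesis by (simp only: distrib_right)
qed

text \<open>An error \<epsilon> S is divided by two factors of size c S, and 1/S <= 1/t^2: a
  relative error \<epsilon> in w becomes an error of order \<epsilon>/t^2 in 1/w.\<close>

lemma inverse_perturbation:
  fixes a b c S t \<epsilon> :: real
  assumes "c > 0" "t > 0" "S \<ge> t\<^sup>2" "a \<ge> c * S" "b \<ge> c * S" "\<bar>a - b\<bar> \<le> \<epsilon> * S"
  shows "\<bar>1 / a - 1 / b\<bar> \<le> \<epsilon> / c\<^sup>2 * (1 / t\<^sup>2)"
proof -
  have S0: "S > 0" using assms(2,3) by (auto intro: less_le_trans[of 0 "t\<^sup>2"])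
  have S: "S > 0" "c * S > 0" using S0 assms(1) by auto
  then have ab: "a > 0" "b > 0" using assms by linarith+
  have \<epsilon>: "\<epsilon> \<ge> 0" using assms(6) S by (smt (verit) mult_neg_pos)
  have "\<bar>1 / a - 1 / b\<bar> = \<bar>a - b\<bar> / (a * b)" using ab by (simp add: field_simps abs_if)
  also have "\<dots> \<le> \<epsilon> * S / ((c * S) * (c * S))"
    using assms S ab by (intro frac_le mult_mono) auto
  also have "\<dots> = \<epsilon> / c\<^sup>2 * (1 / S)" using S by (simp add: power2_eq_square)
  also have "\<dots> \<le> \<epsilon> / c\<^sup>2 * (1 / t\<^sup>2)"
    using assms S \<epsilon> by (intro mult_left_mono frac_le) auto
  finally show ?thesis .
qed

text \<open>The closed cube is compact, so that continuous functions attain their extrema on it, and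
  symmetric about 0, unlike the half-open \<open>torus_box\<close>, from which it differs by a null
  set.\<close>

definition ccube :: "'a::euclidean_space set" where
  "ccube = cbox (- pi *\<^sub>R One) (pi *\<^sub>R One)"

lemma mem_ccube: "x \<in> ccube \<longleftrightarrow> (\<forall>b\<in>Basis. \<bar>x \<bullet> b\<bar> \<le> pi)"
  by (auto simp: ccube_def mem_box abs_le_iff)

lemma ccube_uminus [simp]: "- x \<in> ccube \<longleftrightarrow> x \<in> ccube"
  by (simp add: mem_ccube)

lemma compact_ccube: "compact ccube" by (simp add: ccube_def)

lemma ccube_sets [measurable]: "ccube \<in> sets borel" by (simp add: ccube_def)

lemma cball_subset_ccube: "norm x \<le> pi \<Longrightarrow> x \<in> ccube"
  by (auto simp: mem_ccube intro: order_trans[OF Basis_le_norm])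

lemma ccube_subset_cball: obtains r where "r > 0" "(ccube :: 'a::euclidean_space set) \<subseteq> cball 0 r"
proof -
  obtain r where "\<forall>x\<in>(ccube :: 'a set). norm x \<le> r"
    using compact_imp_bounded[OF compact_ccube] by (auto simp: bounded_iff)
  then show ?thesis by (intro that[of "max r 1"]) auto
qed

lemma bounded_on_ccube:
  fixes f :: "'a::euclidean_space \<Rightarrow> real"
  assumes "continuous_on UNIV f"
  obtains B where "B > 0" "\<And>x. x \<in> ccube \<Longrightarrow> \<bar>f x\<bar> \<le> B"
proof -
  have "compact (f ` ccube)"
    by (intro compact_continuous_image compact_ccube continuous_on_subset[OF assms]) auto
  then obtain B where B: "\<forall>x\<in>f ` ccube. norm x \<le> B" by (meson compact_imp_bounded bounded_iff)
  show ?thesis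
  proof (rule that[of "max B 1"])
    show "\<bar>f x\<bar> \<le> max B 1" if "x \<in> ccube" for x using B that by (force simp: le_max_iff_disj)
  qed simp
qed

text \<open>The intended q is the form of the positive definite matrix U of (H1). Its homogeneity is
  present only as the two-sided comparison with |x|^2.\<close>

locale quad_form =
  fixes q :: "real^3 \<Rightarrow> real" and \<kappa> \<kappa>' :: real
  assumes q_cont: "continuous_on UNIV q"
    and \<kappa>: "0 < \<kappa>" and q_lo: "\<And>x. \<kappa> * (norm x)\<^sup>2 \<le> q x" and q_hi: "\<And>x. q x \<le> \<kappa>' * (norm x)\<^sup>2"
    and q_even: "\<And>x. q (- x) = q x"
begin

lemma q_meas [measurable]: "q \<in> borel_measurable borel"
  using q_cont by (rule borel_measurable_continuous_onI)

lemma \<kappa>_le: "\<kappa> \<le> \<kappa>'"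
proof -
  obtain b :: "real^3" where "b \<in> Basis" using SOME_Basis by blast
  then show ?thesis using q_lo[of b] q_hi[of b] by simp
qed

lemma q_pos: "x \<noteq> 0 \<Longrightarrow> 0 < q x" using q_lo[of x] \<kappa> by (smt (verit) mult_pos_pos zero_less_norm_iff zero_less_power)

lemma q_nonneg: "0 \<le> q x" using q_lo[of x] \<kappa> by (smt (verit) mult_nonneg_nonneg zero_le_power2)

text \<open>An ellipsoid of size \<rho> in the norm sqrt q. Sublevel sets of q are taken instead of
  balls because the rearrangement argument needs a level set of the integrand.\<close>

definition E :: "real \<Rightarrow> (real^3) set" where "E \<rho> = {t. q t < \<rho>\<^sup>2}"

lemma E_sets [measurable]: "E \<rho> \<in> sets borel" unfolding E_def by measurable

lemma E_uminus [simp]: "- t \<in> E \<rho> \<longleftrightarrow> t \<in> E \<rho>" by (simp add: E_def q_even)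

lemma E_subset: "0 \<le> \<rho> \<Longrightarrow> t \<in> E \<rho> \<Longrightarrow> norm t \<le> \<rho> / sqrt \<kappa>"
proof -
  assume "0 \<le> \<rho>" "t \<in> E \<rho>"
  then have "\<kappa> * (norm t)\<^sup>2 \<le> \<rho>\<^sup>2" using q_lo[of t] by (simp add: E_def)
  then have "(sqrt \<kappa> * norm t)\<^sup>2 \<le> \<rho>\<^sup>2" using \<kappa> by (simp add: power_mult_distrib)
  then have "sqrt \<kappa> * norm t \<le> \<rho>" using \<open>0 \<le> \<rho>\<close> by (rule power2_le_imp_le)
  then show ?thesis using \<kappa> by (simp add: field_simps)
qed

lemma E_compl: "0 \<le> \<rho> \<Longrightarrow> t \<notin> E \<rho> \<Longrightarrow> \<rho> / sqrt \<kappa>' \<le> norm t"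
proof -
  assume "0 \<le> \<rho>" "t \<notin> E \<rho>"
  then have "\<rho>\<^sup>2 \<le> \<kappa>' * (norm t)\<^sup>2" using q_hi[of t] by (simp add: E_def)
  then have "\<rho>\<^sup>2 \<le> (sqrt \<kappa>' * norm t)\<^sup>2" using \<kappa> \<kappa>_le by (simp add: power_mult_distrib)
  moreover have k': "sqrt \<kappa>' > 0" using \<kappa> \<kappa>_le by simp
  ultimately have "\<rho> \<le> sqrt \<kappa>' * norm t" by (meson power2_le_imp_le mult_nonneg_nonneg less_imp_le norm_ge_zero)
  then show ?thesis using k' by (simp add: pos_divide_le_eq mult.commute)
qed

text \<open>With \<open>H\<close> the integrand and \<open>k\<close> its value on the boundary of \<open>E\<close>,
  \<open>(H - k) (1\<^sub>E - 1\<^sub>E\<^sub>+\<^sub>v)\<close> is nonnegative pointwise, and both ellipsoids have the same measure.\<close>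
lemma bathtub:
  assumes l: "l > 0" and b: "b > 0" and \<rho>: "\<rho> > 0"
  shows "integrable lborel (\<lambda>t. indicator (E \<rho>) t * (2 / (l * q (t + v) + b)))"
    and "(\<integral>t. indicator (E \<rho>) t * (2 / (l * q (t + v) + b)) \<partial>lborel)
      \<le> (\<integral>t. indicator (E \<rho>) t * (2 / (l * q t + b)) \<partial>lborel)"
proof -
  define H where "H t = 2 / (l * q t + b)" for t
  define k where "k = 2 / (l * \<rho>\<^sup>2 + b)"
  have H: "0 \<le> H t" "H t \<le> 2 / b" for t
    using l b q_nonneg[of t] by (auto simp: H_def intro!: divide_left_mono add_nonneg_pos mult_pos_pos)
  have [measurable]: "H \<in> borel_measurable borel" unfolding H_def by measurable
  have int1: "integrable lborel (\<lambda>t. indicator (E \<rho>) t * H (t + a))" for a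
  proof (rule integrable_lborel_bounded_support[of _ "2 / b" "\<rho> / sqrt \<kappa>"])
    show "\<bar>indicator (E \<rho>) t * H (t + a)\<bar> \<le> 2 / b * indicator (cball 0 (\<rho> / sqrt \<kappa>)) t" for t
      using E_subset[of \<rho> t] H[of "t + a"] \<rho> b by (auto simp: indicator_def)
  qed measurable
  then show "integrable lborel (\<lambda>t. indicator (E \<rho>) t * (2 / (l * q (t + v) + b)))"
    by (simp add: H_def)
  have intE: "integrable lborel (indicator (E \<rho>) :: _ \<Rightarrow> real)"
  proof (rule integrable_lborel_bounded_support[of _ 1 "\<rho> / sqrt \<kappa>"])
    show "\<bar>indicator (E \<rho>) t :: real\<bar> \<le> 1 * indicator (cball 0 (\<rho> / sqrt \<kappa>)) t" for t
      using E_subset[of \<rho> t] \<rho> by (auto simp: indicator_def)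
  qed measurable
  have tr: "integrable lborel (\<lambda>t. f (t - v)) \<and> (\<integral>t. f (t - v) \<partial>lborel) = (\<integral>t. f t \<partial>lborel)"
    if "integrable lborel f" for f :: "real^3 \<Rightarrow> real"
  proof -
    have "integrable (distr lborel borel ((+) (- v))) f" using that by (simp add: lborel_distr_plus)
    then have "integrable lborel (\<lambda>t. f (- v + t))" by (subst (asm) integrable_distr_eq) (use that in auto)
    moreover have "(\<integral>t. f (t + (- v)) \<partial>lborel) = (\<integral>t. f t \<partial>lborel)"
      by (rule lborel_integral_translation) (use that in auto)
    ultimately show ?thesis by simp
  qed
  have trH: "integrable lborel (\<lambda>t. indicator (E \<rho>) (t - v) * H t)"
    "(\<integral>t. indicator (E \<rho>) (t - v) * H t \<partial>lborel) = (\<integral>t. indicator (E \<rho>) t * H (t + v) \<partial>lborel)"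
    using tr[OF int1[of v]] by simp_all
  have trE: "integrable lborel (\<lambda>t. indicator (E \<rho>) (t - v) :: real)"
    "(\<integral>t. indicator (E \<rho>) (t - v) \<partial>lborel) = (\<integral>t. indicator (E \<rho>) t \<partial>lborel :: real)"
    using tr[OF intE] by simp_all
  have "0 \<le> (\<integral>t. (indicator (E \<rho>) t * H t - indicator (E \<rho>) (t - v) * H t)
       - k * (indicator (E \<rho>) t - indicator (E \<rho>) (t - v)) \<partial>lborel)"
  proof (rule integral_nonneg_AE, rule AE_I2)
    fix t
    have "t \<in> E \<rho> \<Longrightarrow> k \<le> H t" "t \<notin> E \<rho> \<Longrightarrow> H t \<le> k"
      using l b q_nonneg[of t] \<rho> by (auto simp: E_def k_def H_def intro!: divide_left_mono mult_pos_pos add_nonneg_pos)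
    then show "0 \<le> (indicator (E \<rho>) t * H t - indicator (E \<rho>) (t - v) * H t)
       - k * (indicator (E \<rho>) t - indicator (E \<rho>) (t - v))"
      by (auto simp: indicator_def)
  qed
  also have "\<dots> = (\<integral>t. indicator (E \<rho>) t * H t \<partial>lborel) - (\<integral>t. indicator (E \<rho>) t * H (t + v) \<partial>lborel)"
    using int1[of 0] intE trH trE by simp
  finally show "(\<integral>t. indicator (E \<rho>) t * (2 / (l * q (t + v) + b)) \<partial>lborel)
      \<le> (\<integral>t. indicator (E \<rho>) t * (2 / (l * q t + b)) \<partial>lborel)" by (simp add: H_def)
qed

text \<open>In dimension three the exponent 2 leaves one power of the radius. With \<rho>
  proportional to |p| the errors of size \<epsilon>/|t|^2 thus integrate to \<epsilon> |p|,
  comparable with the gain.\<close>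

lemma integral_inverse_square_E:
  obtains C where "C > 0" "\<And>\<rho>. \<rho> > 0 \<Longrightarrow> integrable lborel (\<lambda>t. indicator (E \<rho>) t * (1 / (norm t)\<^sup>2))"
    "\<And>\<rho>. \<rho> > 0 \<Longrightarrow> (\<integral>t. indicator (E \<rho>) t * (1 / (norm t)\<^sup>2) \<partial>lborel) \<le> C * \<rho>"
proof -
  obtain C where C: "C > 0" "\<And>r. r > 0 \<Longrightarrow> integrable lborel (\<lambda>x::real^3. indicator (cball 0 r) x * norm x powr - 2)"
    "\<And>r. r > 0 \<Longrightarrow> integral\<^sup>L lborel (\<lambda>x::real^3. indicator (cball 0 r) x * norm x powr - 2) \<le> C * r powr (real DIM(real^3) - 2)"
    by (rule integral_norm_powr_ball[where ?s=2 and 'a="real^3"]) auto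
  have pw: "norm x powr - 2 = 1 / (norm x)\<^sup>2" for x :: "real^3"
    by (simp add: powr_minus_divide)
  have "integrable lborel (\<lambda>t. indicator (E \<rho>) t * (1 / (norm t)\<^sup>2)) \<and>
      (\<integral>t. indicator (E \<rho>) t * (1 / (norm t)\<^sup>2) \<partial>lborel) \<le> (C / sqrt \<kappa>) * \<rho>" if \<rho>: "\<rho> > 0" for \<rho>
  proof -
    have r: "\<rho> / sqrt \<kappa> > 0" using \<rho> \<kappa> by simp
    have le: "indicator (E \<rho>) t * (1 / (norm t)\<^sup>2) \<le> indicator (cball 0 (\<rho> / sqrt \<kappa>)) t * norm t powr - 2" for t
      using E_subset[of \<rho> t] \<rho> by (auto simp: indicator_def pw)
    have i: "integrable lborel (\<lambda>t. indicator (E \<rho>) t * (1 / (norm t)\<^sup>2))"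
      by (rule Bochner_Integration.integrable_bound[OF C(2)[OF r]])
         (use le in \<open>auto intro!: AE_I2 simp: indicator_def\<close>)
    have "(\<integral>t. indicator (E \<rho>) t * (1 / (norm t)\<^sup>2) \<partial>lborel) \<le> C * (\<rho> / sqrt \<kappa>) powr (real DIM(real^3) - 2)"
      using integral_mono[OF i C(2)[OF r] le] C(3)[OF r] by linarith
    then show ?thesis using i \<rho> \<kappa> by simp
  qed
  then show ?thesis using that[of "C / sqrt \<kappa>"] C(1) \<kappa> by auto
qed

text \<open>\<open>bathtub\<close> reduces every shift v to v = 0. The integrand is then nonnegative
  almost everywhere, and at least g/|p|^2 on the ball of radius a |p|, where a^2 =
  \<kappa>/\<kappa>' forces q t <= q p; the volume of the ball contributes |p|^3. The condition
  \<kappa>' < R^2 places this ball inside the ellipsoid, so \<gamma> depends neither on R nor on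
  v.\<close>

lemma gain:
  assumes l: "l > 0" and L: "L > 0"
  obtains \<gamma> where "\<gamma> > 0" "\<And>p R v. p \<noteq> 0 \<Longrightarrow> R > 0 \<Longrightarrow> \<kappa>' < R\<^sup>2 \<Longrightarrow>
    \<gamma> * norm p \<le> (\<integral>t. indicator (E (R * norm p)) t * (2 / (l * q t) - 2 / (l * q (t + v) + L * q p)) \<partial>lborel)"
proof -
  obtain C where C: "\<And>\<rho>. \<rho> > 0 \<Longrightarrow> integrable lborel (\<lambda>t. indicator (E \<rho>) t * (1 / (norm t)\<^sup>2))"
    by (rule integral_inverse_square_E) blast
  define a where "a = sqrt (\<kappa> / \<kappa>')"
  have a: "a > 0" "a\<^sup>2 = \<kappa> / \<kappa>'" using \<kappa> \<kappa>_le by (auto simp: a_def)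
  define g where "g = 2 * L / (l * (l + L) * \<kappa>')"
  have g: "g > 0" using l L \<kappa> \<kappa>_le by (auto simp: g_def)
  define V where "V = unit_ball_vol 3"
  have V: "V > 0" by (simp add: V_def)
  define \<gamma> where "\<gamma> = g * V * a ^ 3"
  show ?thesis
  proof (rule that[of \<gamma>])
    show "\<gamma> > 0" using g V a by (simp add: \<gamma>_def)
    fix p :: "real^3" and R :: real and v assume p: "p \<noteq> 0" and R: "R > 0" "\<kappa>' < R\<^sup>2"
    define \<rho> where "\<rho> = R * norm p"
    have \<rho>: "\<rho> > 0" using R p by (simp add: \<rho>_def)
    have b: "L * q p > 0" using L q_pos[OF p] by simp
    define B where "B = cball (0::real^3) (a * norm p)"
    have i1: "integrable lborel (\<lambda>t. indicator (E \<rho>) t * (2 / (l * q t)))"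
    proof (rule Bochner_Integration.integrable_bound[OF integrable_mult_right[OF C[OF \<rho>], of "2 / (l * \<kappa>)"]])
      show "AE t in lborel. norm (indicator (E \<rho>) t * (2 / (l * q t))) \<le> norm (2 / (l * \<kappa>) * (indicator (E \<rho>) t * (1 / (norm t)\<^sup>2)))"
      proof (rule AE_I2)
        fix t :: "real^3"
        show "norm (indicator (E \<rho>) t * (2 / (l * q t))) \<le> norm (2 / (l * \<kappa>) * (indicator (E \<rho>) t * (1 / (norm t)\<^sup>2)))"
        proof (cases "t = 0")
          case True
          then have "q t = 0" using q_hi[of t] q_nonneg[of t] by simp
          then show ?thesis by simp
        next
          case False
          have "2 / (l * q t) \<le> 2 / (l * (\<kappa> * (norm t)\<^sup>2))"
            using False l \<kappa> q_lo[of t] q_pos[OF False] by (intro divide_left_mono mult_left_mono mult_pos_pos) auto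
          then show ?thesis using l \<kappa> q_nonneg[of t] by (auto simp: indicator_def mult.assoc)
        qed
      qed
    qed measurable
    note i2 = bathtub(1)[OF l b \<rho>]
    have i20: "integrable lborel (\<lambda>t. indicator (E \<rho>) t * (2 / (l * q t + L * q p)))" using i2[of 0] by simp
    have Bm: "measure lborel B = V * (a * norm p) ^ 3"
      using a by (simp add: B_def V_def content_cball)
    have "\<gamma> * norm p = g / (norm p)\<^sup>2 * measure lborel B"
      unfolding Bm using p by (simp add: \<gamma>_def power_mult_distrib power3_eq_cube power2_eq_square)
    also have "\<dots> = (\<integral>t. g / (norm p)\<^sup>2 * indicator B t \<partial>lborel)" by (simp add: B_def)
    also have "\<dots> \<le> (\<integral>t. indicator (E \<rho>) t * (2 / (l * q t)) - indicator (E \<rho>) t * (2 / (l * q t + L * q p)) \<partial>lborel)"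
    proof (rule integral_mono_AE)
      show "integrable lborel (\<lambda>t. g / (norm p)\<^sup>2 * indicator B t)"
        unfolding B_def
        by (intro integrable_mult_right integrable_real_indicator emeasure_lborel_cball_finite) simp
      show "integrable lborel (\<lambda>t. indicator (E \<rho>) t * (2 / (l * q t)) - indicator (E \<rho>) t * (2 / (l * q t + L * q p)))"
        using i1 i20 by simp
      show "AE t in lborel. g / (norm p)\<^sup>2 * indicator B t \<le>
          indicator (E \<rho>) t * (2 / (l * q t)) - indicator (E \<rho>) t * (2 / (l * q t + L * q p))"
        using AE_lborel_singleton[of 0]
      proof eventually_elim
        case (elim t)
        have qt: "q t > 0" and qp: "q p > 0" using q_pos elim p by auto
        have eq: "2 / (l * q t) - 2 / (l * q t + L * q p) = 2 * L * q p / (l * q t * (l * q t + L * q p))"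
          using qt qp l L by (simp add: field_simps add_pos_pos less_imp_neq[THEN not_sym])
        have nn: "0 \<le> 2 / (l * q t) - 2 / (l * q t + L * q p)"
          unfolding eq using qt qp l L by simp
        show ?case
        proof (cases "t \<in> B")
          case True
          have "q t \<le> \<kappa>' * (a * norm p)\<^sup>2"
            using True q_hi[of t] \<kappa> \<kappa>_le by (auto simp: B_def intro!: order_trans[OF q_hi] mult_left_mono power_mono)
          then have tk: "q t \<le> \<kappa> * (norm p)\<^sup>2" using a \<kappa> \<kappa>_le by (simp add: power_mult_distrib)
          then have tp: "q t \<le> q p" using q_lo[of p] by linarith
          have "q t \<le> \<kappa>' * (norm p)\<^sup>2" using tp q_hi[of p] by linarith
          also have "\<dots> < R\<^sup>2 * (norm p)\<^sup>2" using R p by (intro mult_strict_right_mono) auto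
          finally have tE: "t \<in> E \<rho>" by (simp add: E_def \<rho>_def power_mult_distrib)
          have "g / (norm p)\<^sup>2 = 2 * L * q p / (l * (l + L) * (\<kappa>' * (norm p)\<^sup>2) * q p)"
            using qp by (simp add: g_def)
          also have "\<dots> \<le> 2 * L * q p / (l * (l + L) * q p * q p)"
            using l L qp q_hi[of p] \<kappa> \<kappa>_le p by (intro divide_left_mono mult_right_mono mult_left_mono mult_pos_pos) auto
          also have "\<dots> = 2 * L * q p / (l * q p * (l * q p + L * q p))" by (simp add: algebra_simps)
          also have "\<dots> \<le> 2 * L * q p / (l * q t * (l * q t + L * q p))"
            using l L qp qt tp by (intro divide_left_mono mult_mono add_mono mult_left_mono mult_pos_pos add_pos_pos) auto
          finally show ?thesis using True tE eq by simp
        next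
          case False
          then show ?thesis using nn by (auto simp: indicator_def)
        qed
      qed
    qed
    also have "\<dots> = (\<integral>t. indicator (E \<rho>) t * (2 / (l * q t)) \<partial>lborel) - (\<integral>t. indicator (E \<rho>) t * (2 / (l * q t + L * q p)) \<partial>lborel)"
      using i1 i20 by simp
    also have "\<dots> \<le> (\<integral>t. indicator (E \<rho>) t * (2 / (l * q t)) \<partial>lborel) - (\<integral>t. indicator (E \<rho>) t * (2 / (l * q (t + v) + L * q p)) \<partial>lborel)"
      using bathtub(2)[OF l b \<rho>, of v] by simp
    also have "\<dots> = (\<integral>t. indicator (E \<rho>) t * (2 / (l * q t) - 2 / (l * q (t + v) + L * q p)) \<partial>lborel)"
      using i1 i2[of v] by (simp add: right_diff_distrib)
    finally show "\<gamma> * norm p \<le> (\<integral>t. indicator (E (R * norm p)) t * (2 / (l * q t) - 2 / (l * q (t + v) + L * q p)) \<partial>lborel)"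
      by (simp add: \<rho>_def)
  qed
qed

end

section \<open>Linear gap at a threshold resonance\<close>

text \<open>\<open>w\<close> stands for \<open>u\<^sup>(\<^sup>\<alpha>\<^sup>) - m\<close> with the parameter of \<open>\<Lambda>\<^sub>\<alpha>\<close> as first argument;
  \<open>l q (t + s p) + L q p\<close> is its Hessian form at the origin after completing the square in \<open>t\<close>.\<close>
locale threshold = quad_form q \<kappa> \<kappa>' for q \<kappa> \<kappa>' +
  fixes w :: "(real^3) \<times> (real^3) \<Rightarrow> real" and \<phi> :: "real^3 \<Rightarrow> real" and l L s c C :: real
  assumes l: "l > 0" and L: "L > 0" and c: "c > 0" and C: "C \<ge> 0"
    and w_cont: "continuous_on UNIV w"
    and w_lower: "\<And>p t. p \<in> ccube \<Longrightarrow> t \<in> ccube \<Longrightarrow> c * ((norm p)\<^sup>2 + (norm t)\<^sup>2) \<le> w (p, t)"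
    and w_even: "\<And>p t. w (- p, - t) = w (p, t)"
    and w_diff: "\<And>p t. p \<in> ccube \<Longrightarrow> t \<in> ccube \<Longrightarrow> \<bar>w (p, t) - w (0, t)\<bar> \<le> C * norm p * (norm p + norm t)"
    and w_diff2: "\<And>p t. p \<in> ccube \<Longrightarrow> t \<in> ccube \<Longrightarrow> \<bar>w (p, t) + w (- p, t) - 2 * w (0, t)\<bar> \<le> C * (norm p)\<^sup>2"
    and quad_lower: "\<And>p t. c * ((norm p)\<^sup>2 + (norm t)\<^sup>2) \<le> (l * q (t + s *\<^sub>R p) + L * q p) / 2"
    and w_approx: "\<And>\<epsilon>. \<epsilon> > 0 \<Longrightarrow> \<exists>\<delta>>0. \<forall>p t. norm p < \<delta> \<longrightarrow> norm t < \<delta> \<longrightarrow>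
       \<bar>w (p, t) - (l * q (t + s *\<^sub>R p) + L * q p) / 2\<bar> \<le> \<epsilon> * ((norm p)\<^sup>2 + (norm t)\<^sup>2)"
    and \<phi>_cont: "continuous_on UNIV \<phi>"
    and \<phi>_even: "\<And>t. (\<phi> (- t))\<^sup>2 = (\<phi> t)\<^sup>2"
begin

text \<open>The function \<Lambda> at z = m, written over the closed cube and with Borel measure;
  \<open>Lam_eq_lebesgue\<close> identifies it with the integral over
  \<open>lebesgue_on torus_box\<close>.\<close>

definition Lam :: "real^3 \<Rightarrow> real" where
  "Lam p = (\<integral>t. indicator ccube t * ((\<phi> t)\<^sup>2 / w (p, t)) \<partial>lborel)"

lemma w_meas [measurable]: "(\<lambda>t. w (p, t)) \<in> borel_measurable borel"
  by (intro borel_measurable_continuous_onI continuous_on_compose2[OF w_cont] continuous_intros) auto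

lemma \<phi>_meas [measurable]: "\<phi> \<in> borel_measurable borel"
  by (intro borel_measurable_continuous_onI \<phi>_cont)

lemma \<phi>_bound: obtains \<Phi> where "\<Phi> \<ge> 0" "\<And>t. t \<in> ccube \<Longrightarrow> (\<phi> t)\<^sup>2 \<le> \<Phi>"
proof -
  have "compact ((\<lambda>t. (\<phi> t)\<^sup>2) ` ccube)"
    by (intro compact_continuous_image compact_ccube continuous_intros continuous_on_subset[OF \<phi>_cont]) auto
  then obtain B where "\<forall>x\<in>(\<lambda>t. (\<phi> t)\<^sup>2) ` ccube. norm x \<le> B"
    by (meson compact_imp_bounded bounded_iff)
  then show ?thesis by (intro that[of "max B 0"]) (auto simp: le_max_iff_disj)
qed

text \<open>In dimension three 1/|t|^2 is locally integrable; by \<open>inverse_w_le\<close> a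
  multiple of it majorises 1/w(p, t) for all p in the cube at once.\<close>

lemma inverse_square_integrable: "integrable lborel (\<lambda>t::real^3. indicator ccube t * (1 / (norm t)\<^sup>2))"
proof -
  obtain r where r: "r > 0" "(ccube :: (real^3) set) \<subseteq> cball 0 r" by (rule ccube_subset_cball)
  obtain D where D: "\<And>r. r > 0 \<Longrightarrow> integrable lborel (\<lambda>x::real^3. indicator (cball 0 r) x * norm x powr - 2)"
    by (rule integral_norm_powr_ball[where ?s=2 and 'a="real^3"]) auto
  show ?thesis
  proof (rule Bochner_Integration.integrable_bound[OF D[OF r(1)]])
    show "AE t::real^3 in lborel. norm (indicator ccube t * (1 / (norm t)\<^sup>2)) \<le> norm (indicator (cball 0 r) t * norm t powr - 2)"
      using r(2) by (auto intro!: AE_I2 simp: indicator_def powr_minus_divide)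
  qed measurable
qed

lemma w_pos: "p \<in> ccube \<Longrightarrow> t \<in> ccube \<Longrightarrow> t \<noteq> 0 \<Longrightarrow> 0 < w (p, t)"
  using w_lower[of p t] c by (smt (verit) mult_pos_pos zero_le_power2 zero_less_norm_iff zero_less_power)

lemma inverse_w_le:
  assumes "p \<in> ccube" "t \<in> ccube" "t \<noteq> 0"
  shows "1 / w (p, t) \<le> 1 / c * (1 / (norm t)\<^sup>2)"
proof -
  have "c * (norm t)\<^sup>2 \<le> c * ((norm p)\<^sup>2 + (norm t)\<^sup>2)" using c by simp
  then have "c * (norm t)\<^sup>2 \<le> w (p, t)" using w_lower[OF assms(1,2)] by linarith
  then have "1 / w (p, t) \<le> 1 / (c * (norm t)\<^sup>2)"
    using c assms by (intro divide_left_mono mult_pos_pos w_pos) auto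
  then show ?thesis by simp
qed

lemma Lam_integrable: "p \<in> ccube \<Longrightarrow> integrable lborel (\<lambda>t. indicator ccube t * ((\<phi> t)\<^sup>2 / w (p, t)))"
proof -
  assume p: "p \<in> ccube"
  obtain \<Phi> where \<Phi>: "\<Phi> \<ge> 0" "\<And>t. t \<in> ccube \<Longrightarrow> (\<phi> t)\<^sup>2 \<le> \<Phi>" by (rule \<phi>_bound) blast
  show ?thesis
  proof (rule Bochner_Integration.integrable_bound[OF integrable_mult_right[OF inverse_square_integrable, of "\<Phi> / c"]])
    show "AE t in lborel. norm (indicator ccube t * ((\<phi> t)\<^sup>2 / w (p, t))) \<le> norm (\<Phi> / c * (indicator ccube t * (1 / (norm t)\<^sup>2)))"
      using AE_lborel_singleton[of 0]
    proof eventually_elim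
      case (elim t)
      show ?case
      proof (cases "t \<in> ccube")
        case True
        have "(\<phi> t)\<^sup>2 * (1 / w (p, t)) \<le> \<Phi> * (1 / c * (1 / (norm t)\<^sup>2))"
          using inverse_w_le[OF p True] w_pos[OF p True] elim \<Phi> True by (intro mult_mono) (auto simp: less_imp_le)
        then show ?thesis using True w_pos[OF p True] elim \<Phi>(1) c by simp
      qed simp
    qed
  qed measurable
qed

text \<open>The integrand of \<open>Lam 0 - Lam p\<close>, kept as one function so that it can be
  split along an ellipsoid and averaged over p and -p.\<close>

definition h :: "real^3 \<Rightarrow> real^3 \<Rightarrow> real" where
  "h p t = indicator ccube t * ((\<phi> t)\<^sup>2 / w (0, t)) - indicator ccube t * ((\<phi> t)\<^sup>2 / w (p, t))"

lemma zero_ccube: "0 \<in> ccube" by (simp add: mem_ccube)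

lemma h_meas [measurable]: "h p \<in> borel_measurable borel"
  unfolding h_def[abs_def] by measurable

lemma h_int: "p \<in> ccube \<Longrightarrow> integrable lborel (h p)"
  unfolding h_def[abs_def] by (intro Bochner_Integration.integrable_diff Lam_integrable zero_ccube)

lemma h_int_ind:
  assumes "p \<in> ccube" "A \<in> sets borel"
  shows "integrable lborel (\<lambda>t. indicator A t * h p t)"
  using integrable_mult_indicator[of A lborel "h p"] h_int[OF assms(1)] assms(2) by simp

text \<open>Over a set symmetric about 0 the functions h p and h (-p) therefore have the same
  integral, which lets second differences replace first differences.\<close>

lemma h_uminus: "h (- p) (- t) = h p t"
  using w_even[of p t] w_even[of 0 t] by (simp add: h_def \<phi>_even indicator_def)

lemma Lam_diff: "p \<in> ccube \<Longrightarrow> Lam 0 - Lam p = (\<integral>t. h p t \<partial>lborel)"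
  unfolding Lam_def h_def by (intro Bochner_Integration.integral_diff[symmetric] Lam_integrable zero_ccube)

text \<open>The average of h p and h (-p) is a second difference of 1/w, bounded below by a multiple
  of -|p|^2/|t|^4. The complement of the ellipsoid lies outside a ball of radius proportional to
  \<rho>, over which |t|^(-4) integrates to O(1/\<rho>).\<close>

lemma outer_part:
  obtains B where "B > 0" "\<And>p \<rho>. p \<in> ccube \<Longrightarrow> \<rho> > 0 \<Longrightarrow>
     - B * (norm p)\<^sup>2 / \<rho> \<le> (\<integral>t. indicator (- E \<rho>) t * h p t \<partial>lborel)"
proof -
  obtain \<Phi> where \<Phi>: "\<Phi> \<ge> 0" "\<And>t. t \<in> ccube \<Longrightarrow> (\<phi> t)\<^sup>2 \<le> \<Phi>" by (rule \<phi>_bound) blast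
  obtain D where D: "D > 0" "\<And>r. r > 0 \<Longrightarrow> integrable lborel (\<lambda>x::real^3. indicator (- ball 0 r) x * norm x powr - 4)"
    "\<And>r. r > 0 \<Longrightarrow> integral\<^sup>L lborel (\<lambda>x::real^3. indicator (- ball 0 r) x * norm x powr - 4) \<le> D * r powr (real DIM(real^3) - 4)"
    by (rule integral_norm_powr_outside_ball[where ?s=4 and 'a="real^3"]) auto
  have pw: "norm x powr - 4 = 1 / (norm x)^4" for x :: "real^3"
    by (simp add: powr_minus_divide)
  define G where "G = \<Phi> * (C / c\<^sup>2 + 4 * C\<^sup>2 / c^3)"
  have G: "G \<ge> 0" using \<Phi> C c by (simp add: G_def)
  \<comment> \<open>The summand 1 keeps B positive even if the remaining product vanishes.\<close>
  define B where "B = G * D * sqrt \<kappa>' + 1"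
  have k': "sqrt \<kappa>' > 0" using \<kappa> \<kappa>_le by simp
  show ?thesis
  proof (rule that[of B])
    show "B > 0" using G D(1) k' by (simp add: B_def add_nonneg_pos)
    fix p :: "real^3" and \<rho> :: real assume p: "p \<in> ccube" and \<rho>: "\<rho> > 0"
    define r where "r = \<rho> / sqrt \<kappa>'"
    have r: "r > 0" using \<rho> k' by (simp add: r_def)
    have mp: "- p \<in> ccube" using p by simp
    have Em: "- E \<rho> \<in> sets borel" by measurable
    note i1 = h_int_ind[OF p Em] and i2 = h_int_ind[OF mp Em]
    have "(\<integral>t. indicator (- E \<rho>) t * h p t \<partial>lborel) = (\<integral>t. indicator (- E \<rho>) (- t) * h p (- t) \<partial>lborel)"
      by (rule lborel_integral_uminus[symmetric]) measurable
    also have "\<dots> = (\<integral>t. indicator (- E \<rho>) t * h (- p) t \<partial>lborel)"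
      using h_uminus[of "- p"] by (simp add: indicator_def)
    finally have "2 * (\<integral>t. indicator (- E \<rho>) t * h p t \<partial>lborel) =
        (\<integral>t. indicator (- E \<rho>) t * h p t + indicator (- E \<rho>) t * h (- p) t \<partial>lborel)"
      using i1 i2 by simp
    also have "\<dots> \<ge> integral\<^sup>L lborel (\<lambda>t::real^3. - (G * (norm p)\<^sup>2) * (indicator (- ball 0 r) t * norm t powr - 4))"
    proof (rule integral_mono_AE)
      show "AE t in lborel. - (G * (norm p)\<^sup>2) * (indicator (- ball 0 r) t * norm t powr - 4)
          \<le> indicator (- E \<rho>) t * h p t + indicator (- E \<rho>) t * h (- p) t"
        using AE_lborel_singleton[of 0]
      proof eventually_elim
        case (elim t)
        show ?case
        proof (cases "t \<in> ccube \<and> t \<notin> E \<rho>")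
          case True
          have "t \<in> - ball 0 r" using E_compl[of \<rho> t] True \<rho> by (simp add: r_def)
          have "1 / w (p, t) + 1 / w (- p, t) - 2 / w (0, t) \<le> (C / c\<^sup>2 + 4 * C\<^sup>2 / c^3) * ((norm p)\<^sup>2 / (norm t)^4)"
          proof (rule second_difference_inverse[OF c C])
            show "\<bar>w (p, t) + w (- p, t) - 2 * w (0, t)\<bar> \<le> C * (norm p)\<^sup>2"
              using w_diff2[OF p] True by blast
            show "\<bar>w (p, t) - w (0, t)\<bar> \<le> C * norm p * (norm p + norm t)"
              "\<bar>w (- p, t) - w (0, t)\<bar> \<le> C * norm p * (norm p + norm t)"
              using w_diff[OF p, of t] w_diff[OF mp, of t] True by simp_all
            show "c * ((norm p)\<^sup>2 + (norm t)\<^sup>2) \<le> w (p, t)" "c * ((norm p)\<^sup>2 + (norm t)\<^sup>2) \<le> w (- p, t)"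
              "c * (norm t)\<^sup>2 \<le> w (0, t)"
              using w_lower[OF p, of t] w_lower[OF mp, of t] w_lower[OF zero_ccube, of t] True by simp_all
          qed (use elim in auto)
          then have "(\<phi> t)\<^sup>2 * (1 / w (p, t) + 1 / w (- p, t) - 2 / w (0, t)) \<le> (\<phi> t)\<^sup>2 * ((C / c\<^sup>2 + 4 * C\<^sup>2 / c^3) * ((norm p)\<^sup>2 / (norm t)^4))"
            by (intro mult_left_mono) auto
          also have "\<dots> \<le> \<Phi> * ((C / c\<^sup>2 + 4 * C\<^sup>2 / c^3) * ((norm p)\<^sup>2 / (norm t)^4))"
            using \<Phi> True C c by (intro mult_right_mono) auto
          also have "\<dots> = G * (norm p)\<^sup>2 * norm t powr - 4" by (simp add: G_def pw)
          finally have "- (G * (norm p)\<^sup>2) * norm t powr - 4 \<le> h p t + h (- p) t"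
            using True by (simp add: h_def algebra_simps)
          then show ?thesis using True \<open>t \<in> - ball 0 r\<close> by (simp add: indicator_def)
        next
          case False
          then have "indicator (- E \<rho>) t * h p t + indicator (- E \<rho>) t * h (- p) t = 0"
            by (auto simp: h_def indicator_def)
          then show ?thesis using G by (simp add: mult_nonneg_nonneg)
        qed
      qed
      show "integrable lborel (\<lambda>t::real^3. - (G * (norm p)\<^sup>2) * (indicator (- ball 0 r) t * norm t powr - 4))"
        by (intro integrable_mult_right D(2)[OF r])
    qed (use i1 i2 in auto)
    finally have "2 * (\<integral>t. indicator (- E \<rho>) t * h p t \<partial>lborel) \<ge>
        - (G * (norm p)\<^sup>2) * integral\<^sup>L lborel (\<lambda>x::real^3. indicator (- ball 0 r) x * norm x powr - 4)"
      unfolding integral_mult_right_zero .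
    moreover have "(G * (norm p)\<^sup>2) * integral\<^sup>L lborel (\<lambda>x::real^3. indicator (- ball 0 r) x * norm x powr - 4) \<le> (G * (norm p)\<^sup>2) * (D * r powr - 1)"
      using D(3)[OF r] G by (intro mult_left_mono) auto
    moreover have "(G * (norm p)\<^sup>2) * (D * r powr - 1) = G * D * sqrt \<kappa>' * ((norm p)\<^sup>2 / \<rho>)"
      using r \<rho> k' by (simp add: powr_minus_divide r_def)
    moreover have "G * D * sqrt \<kappa>' * ((norm p)\<^sup>2 / \<rho>) \<le> 2 * (B * (norm p)\<^sup>2 / \<rho>)"
    proof -
      have "G * D * sqrt \<kappa>' * ((norm p)\<^sup>2 / \<rho>) \<le> (2 * B) * ((norm p)\<^sup>2 / \<rho>)"
        using G D(1) k' \<rho> by (intro mult_right_mono) (auto simp: B_def)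
      then show ?thesis by simp
    qed
    ultimately show "- B * (norm p)\<^sup>2 / \<rho> \<le> (\<integral>t. indicator (- E \<rho>) t * h p t \<partial>lborel)" by simp
  qed
qed

text \<open>Three errors are compared with the Hessian model: the square of \<phi> at t against its
  value at 0, and each of the two reciprocals against that of its quadratic form. Each is of order
  \<epsilon>/|t|^2; the first contributes 2/c to the constant, the other two together 2/c^2 times
  the square of \<phi> at 0.\<close>

lemma inner_pointwise:
  assumes p: "p \<in> ccube" and t: "t \<in> ccube" "t \<noteq> 0"
    and w0: "\<bar>w (0, t) - (l * q t) / 2\<bar> \<le> \<epsilon> * (norm t)\<^sup>2"
    and wp: "\<bar>w (p, t) - (l * q (t + s *\<^sub>R p) + L * q p) / 2\<bar> \<le> \<epsilon> * ((norm p)\<^sup>2 + (norm t)\<^sup>2)"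
    and ph: "\<bar>(\<phi> t)\<^sup>2 - (\<phi> 0)\<^sup>2\<bar> \<le> \<epsilon>"
  shows "(\<phi> 0)\<^sup>2 * (2 / (l * q t) - 2 / (l * q (t + s *\<^sub>R p) + L * q p)) -
      \<epsilon> * ((2 / c + 2 * (\<phi> 0)\<^sup>2 / c\<^sup>2) * (1 / (norm t)\<^sup>2)) \<le> h p t"
proof -
  have n: "norm t > 0" using t by simp
  define x0 xp y0 yp where "x0 = 1 / w (0, t)" and "xp = 1 / w (p, t)"
    and "y0 = 1 / ((l * q t) / 2)" and "yp = 1 / ((l * q (t + s *\<^sub>R p) + L * q p) / 2)"
  have 1: "\<bar>x0 - y0\<bar> \<le> \<epsilon> / c\<^sup>2 * (1 / (norm t)\<^sup>2)" unfolding x0_def y0_def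
    using w_lower[OF zero_ccube t(1)] quad_lower[of 0 t] q_hi[of 0] q_nonneg[of 0] w0
    by (intro inverse_perturbation[OF c n, of "(norm t)\<^sup>2"]) auto
  have 2: "\<bar>xp - yp\<bar> \<le> \<epsilon> / c\<^sup>2 * (1 / (norm t)\<^sup>2)" unfolding xp_def yp_def
    using w_lower[OF p t(1)] quad_lower[of p t] wp
    by (intro inverse_perturbation[OF c n, of "(norm p)\<^sup>2 + (norm t)\<^sup>2"]) auto
  have 3: "\<bar>x0 - xp\<bar> \<le> 2 / c * (1 / (norm t)\<^sup>2)"
    using inverse_w_le[OF zero_ccube t] inverse_w_le[OF p t] w_pos[OF zero_ccube t] w_pos[OF p t]
    unfolding x0_def[symmetric] xp_def[symmetric]
    by (auto simp: x0_def xp_def abs_le_iff) (smt (verit) divide_nonneg_pos add_divide_distrib)+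
  have eps: "\<epsilon> \<ge> 0" using ph by linarith
  have "\<bar>((\<phi> t)\<^sup>2 - (\<phi> 0)\<^sup>2) * (x0 - xp)\<bar> \<le> \<epsilon> * (2 / c * (1 / (norm t)\<^sup>2))"
    unfolding abs_mult using ph 3 eps by (intro mult_mono) auto
  moreover have "(\<phi> 0)\<^sup>2 * \<bar>(x0 - y0) - (xp - yp)\<bar> \<le> (\<phi> 0)\<^sup>2 * (2 * (\<epsilon> / c\<^sup>2 * (1 / (norm t)\<^sup>2)))"
    using 1 2 by (intro mult_left_mono) auto
  moreover have "\<bar>(\<phi> 0)\<^sup>2 * ((x0 - y0) - (xp - yp))\<bar> = (\<phi> 0)\<^sup>2 * \<bar>(x0 - y0) - (xp - yp)\<bar>"
    by (simp add: abs_mult)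
  moreover have "h p t = (\<phi> 0)\<^sup>2 * (y0 - yp) + ((\<phi> t)\<^sup>2 - (\<phi> 0)\<^sup>2) * (x0 - xp) + (\<phi> 0)\<^sup>2 * ((x0 - y0) - (xp - yp))"
    using t by (simp add: h_def x0_def xp_def algebra_simps diff_divide_distrib)
  moreover have "\<epsilon> * (2 / c * (1 / (norm t)\<^sup>2)) + (\<phi> 0)\<^sup>2 * (2 * (\<epsilon> / c\<^sup>2 * (1 / (norm t)\<^sup>2))) =
     \<epsilon> * ((2 / c + 2 * (\<phi> 0)\<^sup>2 / c\<^sup>2) * (1 / (norm t)\<^sup>2))" by (simp add: algebra_simps)
  moreover have "y0 - yp = 2 / (l * q t) - 2 / (l * q (t + s *\<^sub>R p) + L * q p)"
    by (simp add: y0_def yp_def)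
  ultimately show ?thesis by (smt (verit))
qed

text \<open>The ellipsoid \<open>E (R |p|)\<close> separates the scales: outside it the second difference of \<open>1 / w\<close>
  costs at most \<open>O(|p| / R)\<close>, inside it \<open>w\<close> may be replaced by its Hessian form, whose gain is
  at least \<open>\<gamma> |p|\<close> uniformly in \<open>R\<close>. So \<open>R\<close> is fixed first and \<open>\<epsilon>\<close> afterwards.\<close>
theorem linear_gap:
  assumes \<phi>0: "\<phi> 0 \<noteq> 0"
  obtains g \<delta> where "g > 0" "\<delta> > 0" "\<And>p. norm p < \<delta> \<Longrightarrow> g * norm p \<le> Lam 0 - Lam p"
proof -
  obtain B where B: "B > 0" "\<And>p \<rho>. p \<in> ccube \<Longrightarrow> \<rho> > 0 \<Longrightarrow>
     - B * (norm p)\<^sup>2 / \<rho> \<le> (\<integral>t. indicator (- E \<rho>) t * h p t \<partial>lborel)" by (rule outer_part) blast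
  obtain \<gamma> where \<gamma>: "\<gamma> > 0" "\<And>p R v. p \<noteq> 0 \<Longrightarrow> R > 0 \<Longrightarrow> \<kappa>' < R\<^sup>2 \<Longrightarrow>
    \<gamma> * norm p \<le> (\<integral>t. indicator (E (R * norm p)) t * (2 / (l * q t) - 2 / (l * q (t + v) + L * q p)) \<partial>lborel)"
    by (rule gain[OF l L]) blast
  obtain D where D: "D > 0" "\<And>\<rho>. \<rho> > 0 \<Longrightarrow> integrable lborel (\<lambda>t. indicator (E \<rho>) t * (1 / (norm t)\<^sup>2))"
    "\<And>\<rho>. \<rho> > 0 \<Longrightarrow> (\<integral>t. indicator (E \<rho>) t * (1 / (norm t)\<^sup>2) \<partial>lborel) \<le> D * \<rho>"
    by (rule integral_inverse_square_E) blast
  define f0 where "f0 = (\<phi> 0)\<^sup>2"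
  have f0: "f0 > 0" using \<phi>0 by (simp add: f0_def)
  define C2 where "C2 = 2 / c + 2 * f0 / c\<^sup>2"
  have C2: "C2 > 0" using c f0 by (simp add: C2_def add_pos_pos)
  \<comment> \<open>The summands 1 + \<kappa>' ensure \<kappa>' < R^2, as \<open>gain\<close>
    demands; the last one makes the outer loss B/R at most a quarter of f0 \<gamma>.\<close>
  define R where "R = 1 + \<kappa>' + 4 * B / (f0 * \<gamma>)"
  have k': "\<kappa>' > 0" using \<kappa> \<kappa>_le by simp
  have R1: "R \<ge> 1 + \<kappa>'" "R \<ge> 4 * B / (f0 * \<gamma>)" using B f0 \<gamma> k' by (auto simp: R_def)
  have R: "R > 0" using R1 k' by linarith
  have R2: "\<kappa>' < R\<^sup>2" using R1(1) k' mult_mono[of 1 R "1 + \<kappa>'" R] by (simp add: power2_eq_square)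
  \<comment> \<open>Makes the inner error \<epsilon> C2 D R |p| exactly a quarter of f0 \<gamma>
    |p|, so that at least half of the gain survives both losses.\<close>
  define \<epsilon> where "\<epsilon> = f0 * \<gamma> / (4 * C2 * D * R)"
  have \<epsilon>: "\<epsilon> > 0" using f0 \<gamma> C2 D R by (simp add: \<epsilon>_def)
  obtain \<delta>1 where \<delta>1: "\<delta>1 > 0" "\<And>p t. norm p < \<delta>1 \<Longrightarrow> norm t < \<delta>1 \<Longrightarrow>
       \<bar>w (p, t) - (l * q (t + s *\<^sub>R p) + L * q p) / 2\<bar> \<le> \<epsilon> * ((norm p)\<^sup>2 + (norm t)\<^sup>2)"
    using w_approx[OF \<epsilon>] by blast
  have "continuous_on UNIV (\<lambda>t. (\<phi> t)\<^sup>2)" by (intro continuous_intros \<phi>_cont)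
  then obtain \<delta>2 where \<delta>2: "\<delta>2 > 0" "\<And>t. norm t < \<delta>2 \<Longrightarrow> \<bar>(\<phi> t)\<^sup>2 - (\<phi> 0)\<^sup>2\<bar> < \<epsilon>"
    using continuous_on_UNIV_ball[of "\<lambda>t. (\<phi> t)\<^sup>2" \<epsilon> 0] \<epsilon> by auto
  define m where "m = min (min \<delta>1 \<delta>2) pi"
  have m: "m > 0" using \<delta>1 \<delta>2 by (simp add: m_def)
  \<comment> \<open>The ellipsoid reaches out to R |p| / sqrt \<kappa>; the second bound keeps it
    within radius m, where the Hessian approximation, the continuity of \<phi> and the inclusion in
    the cube all hold.\<close>
  define \<delta> where "\<delta> = min m (m * sqrt \<kappa> / R)"
  show ?thesis
  proof (rule that[of "f0 * \<gamma> / 2" \<delta>])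
    show "f0 * \<gamma> / 2 > 0" using f0 \<gamma> by simp
    show "\<delta> > 0" using m \<kappa> R by (simp add: \<delta>_def)
    fix p :: "real^3" assume pd: "norm p < \<delta>"
    show "f0 * \<gamma> / 2 * norm p \<le> Lam 0 - Lam p"
    proof (cases "p = 0")
      case False
      define \<rho> where "\<rho> = R * norm p"
      have \<rho>: "\<rho> > 0" using R False by (simp add: \<rho>_def)
      have pm: "norm p < m" using pd by (simp add: \<delta>_def)
      have pc: "p \<in> ccube" using pm by (intro cball_subset_ccube) (simp add: m_def)
      have \<rho>m: "\<rho> / sqrt \<kappa> < m"
        using pd R \<kappa> by (simp add: \<delta>_def \<rho>_def pos_less_divide_eq pos_divide_less_eq mult.commute)
      have tE: "norm t < m" if "t \<in> E \<rho>" for t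
        using E_subset[of \<rho> t] that \<rho> \<rho>m by simp
      have Em: "E \<rho> \<in> sets borel" "- E \<rho> \<in> sets borel" by measurable
      define Z where "Z t = 2 / (l * q t) - 2 / (l * q (t + s *\<^sub>R p) + L * q p)" for t
      \<comment> \<open>A function that is not integrable has integral 0 by convention, against the
        strictly positive lower bound of \<open>gain\<close>.\<close>
      have Zint: "integrable lborel (\<lambda>t. indicator (E \<rho>) t * Z t)"
      proof (rule ccontr)
        assume "\<not> ?thesis"
        then have "(\<integral>t. indicator (E \<rho>) t * Z t \<partial>lborel) = 0" by (rule not_integrable_integral_eq)
        then show False
          using \<gamma>(2)[OF False R R2, of "s *\<^sub>R p"] mult_pos_pos[OF \<gamma>(1), of "norm p"] False
          unfolding Z_def \<rho>_def by simp
      qed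
      have "f0 * (\<gamma> * norm p) - \<epsilon> * (C2 * (D * \<rho>))
        \<le> f0 * (\<integral>t. indicator (E \<rho>) t * Z t \<partial>lborel) - \<epsilon> * (C2 * (\<integral>t. indicator (E \<rho>) t * (1 / (norm t)\<^sup>2) \<partial>lborel))"
        using \<gamma>(2)[OF False R R2, of "s *\<^sub>R p"] D(3)[OF \<rho>] f0 \<epsilon> C2 unfolding Z_def \<rho>_def[symmetric]
        by (intro diff_mono mult_left_mono) auto
      also have "\<dots> = (\<integral>t. f0 * (indicator (E \<rho>) t * Z t) - \<epsilon> * (C2 * (indicator (E \<rho>) t * (1 / (norm t)\<^sup>2))) \<partial>lborel)"
      proof -
        have "(\<integral>t. f0 * (indicator (E \<rho>) t * Z t) - \<epsilon> * (C2 * (indicator (E \<rho>) t * (1 / (norm t)\<^sup>2))) \<partial>lborel)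
          = (\<integral>t. f0 * (indicator (E \<rho>) t * Z t) \<partial>lborel) - (\<integral>t. \<epsilon> * (C2 * (indicator (E \<rho>) t * (1 / (norm t)\<^sup>2))) \<partial>lborel)"
          by (intro Bochner_Integration.integral_diff integrable_mult_right Zint D(2)[OF \<rho>])
        then show ?thesis by (simp only: integral_mult_right_zero)
      qed
      also have "\<dots> \<le> (\<integral>t. indicator (E \<rho>) t * h p t \<partial>lborel)"
      proof (rule integral_mono_AE)
        show "integrable lborel (\<lambda>t. f0 * (indicator (E \<rho>) t * Z t) - \<epsilon> * (C2 * (indicator (E \<rho>) t * (1 / (norm t)\<^sup>2))))"
          by (intro Bochner_Integration.integrable_diff integrable_mult_right Zint D(2)[OF \<rho>])
        show "AE t in lborel. f0 * (indicator (E \<rho>) t * Z t) - \<epsilon> * (C2 * (indicator (E \<rho>) t * (1 / (norm t)\<^sup>2)))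
          \<le> indicator (E \<rho>) t * h p t"
          using AE_lborel_singleton[of 0]
        proof eventually_elim
          case (elim t)
          show ?case
          proof (cases "t \<in> E \<rho>")
            case True
            note tm = tE[OF True]
            have "f0 * Z t - \<epsilon> * (C2 * (1 / (norm t)\<^sup>2)) \<le> h p t"
              unfolding f0_def Z_def C2_def
            proof (rule inner_pointwise[OF pc _ elim])
              show "t \<in> ccube" using tm by (intro cball_subset_ccube) (simp add: m_def)
              show "\<bar>w (0, t) - (l * q t) / 2\<bar> \<le> \<epsilon> * (norm t)\<^sup>2"
                using \<delta>1(2)[of 0 t] \<delta>1(1) tm q_hi[of 0] q_nonneg[of 0] by (simp add: m_def)
              show "\<bar>w (p, t) - (l * q (t + s *\<^sub>R p) + L * q p) / 2\<bar> \<le> \<epsilon> * ((norm p)\<^sup>2 + (norm t)\<^sup>2)"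
                using \<delta>1(2)[of p t] tm pm by (simp add: m_def)
              show "\<bar>(\<phi> t)\<^sup>2 - (\<phi> 0)\<^sup>2\<bar> \<le> \<epsilon>"
                using \<delta>2(2)[of t] tm by (simp add: m_def less_imp_le)
            qed
            then show ?thesis using True by simp
          qed simp
        qed
      qed (rule h_int_ind[OF pc Em(1)])
      finally have inner: "f0 * (\<gamma> * norm p) - \<epsilon> * (C2 * (D * \<rho>)) \<le> (\<integral>t. indicator (E \<rho>) t * h p t \<partial>lborel)" .
      have "Lam 0 - Lam p = (\<integral>t. indicator (E \<rho>) t * h p t + indicator (- E \<rho>) t * h p t \<partial>lborel)"
        unfolding Lam_diff[OF pc] by (intro Bochner_Integration.integral_cong) (auto simp: indicator_def)
      also have "\<dots> = (\<integral>t. indicator (E \<rho>) t * h p t \<partial>lborel) + (\<integral>t. indicator (- E \<rho>) t * h p t \<partial>lborel)"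
        by (intro Bochner_Integration.integral_add h_int_ind[OF pc] Em)
      finally have tot: "Lam 0 - Lam p \<ge> f0 * (\<gamma> * norm p) - \<epsilon> * (C2 * (D * \<rho>)) - B * (norm p)\<^sup>2 / \<rho>"
        using inner B(2)[OF pc \<rho>] by simp
      have e1: "\<epsilon> * (C2 * (D * \<rho>)) = f0 * \<gamma> * norm p / 4"
        using C2 D(1) R by (simp add: \<epsilon>_def \<rho>_def)
      have "B * (norm p)\<^sup>2 / \<rho> = B / R * norm p" using False by (simp add: \<rho>_def power2_eq_square)
      also have "\<dots> \<le> f0 * \<gamma> / 4 * norm p"
      proof (rule mult_right_mono)
        show "B / R \<le> f0 * \<gamma> / 4" using R1(2) R f0 \<gamma>(1) by (simp add: field_simps)
      qed simp
      finally have e2: "B * (norm p)\<^sup>2 / \<rho> \<le> f0 * (\<gamma> * norm p) / 4" by simp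
      have e1': "\<epsilon> * (C2 * (D * \<rho>)) = f0 * (\<gamma> * norm p) / 4" unfolding e1 by simp
      have "f0 * \<gamma> / 2 * norm p = f0 * (\<gamma> * norm p) / 2" by simp
      then show ?thesis using tot e2 unfolding e1' by linarith
    qed simp
  qed
qed

end

section \<open>Nondegenerate minima of even periodic functions\<close>

text \<open>The constants are the extrema of f over the unit sphere; homogeneity spreads them to the
  whole space.\<close>

lemma homogeneous_bounds:
  fixes f :: "'a::euclidean_space \<Rightarrow> real"
  assumes cont: "continuous_on UNIV f" and hom: "\<And>a x. f (a *\<^sub>R x) = a\<^sup>2 * f x"
    and pos: "\<And>x. x \<noteq> 0 \<Longrightarrow> 0 < f x"
  obtains \<kappa> \<kappa>' where "\<kappa> > 0" "\<And>x. \<kappa> * (norm x)\<^sup>2 \<le> f x" "\<And>x. f x \<le> \<kappa>' * (norm x)\<^sup>2"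
proof -
  have ne: "sphere (0::'a) 1 \<noteq> {}" by simp
  have cs: "continuous_on (sphere 0 1) f" using cont continuous_on_subset by blast
  obtain x0 where x0: "x0 \<in> sphere 0 1" "\<And>y. y \<in> sphere 0 1 \<Longrightarrow> f x0 \<le> f y"
    using continuous_attains_inf[OF compact_sphere ne cs] by blast
  obtain x1 where x1: "\<And>y. y \<in> sphere 0 1 \<Longrightarrow> f y \<le> f x1"
    using continuous_attains_sup[OF compact_sphere ne cs] by blast
  have hn: "f x = (norm x)\<^sup>2 * f (x /\<^sub>R norm x)" if "x \<noteq> 0" for x
    using that hom[of "norm x" "x /\<^sub>R norm x"] by simp
  have f0: "f 0 = 0" using hom[of 0 0] by simp
  show ?thesis
  proof (rule that[of "f x0" "f x1"])
    show "f x0 > 0" using x0(1) by (intro pos) auto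
    show "f x0 * (norm x)\<^sup>2 \<le> f x" for x
    proof (cases "x = 0")
      case False
      then show ?thesis unfolding hn[OF False] using x0(2)[of "x /\<^sub>R norm x"] by (simp add: mult.commute mult_left_mono)
    qed (simp add: f0)
    show "f x \<le> f x1 * (norm x)\<^sup>2" for x
    proof (cases "x = 0")
      case False
      then show ?thesis unfolding hn[OF False] using x1[of "x /\<^sub>R norm x"] by (simp add: mult.commute mult_left_mono)
    qed (simp add: f0)
  qed
qed

lemma hessq_cont: "continuous_on UNIV (\<lambda>v. hessq f x v v)"
  unfolding hessq_def by (intro continuous_intros)

lemma hessq_add: "hessq f x (v + v') w = hessq f x v w + hessq f x v' w"
  by (simp add: hessq_def inner_add_left distrib_right sum.distrib)

lemma hessq_scale: "hessq f x (a *\<^sub>R v) w = a * hessq f x v w" "hessq f x v (a *\<^sub>R w) = a * hessq f x v w"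
  by (simp_all add: hessq_def sum_distrib_left mult_ac)

lemma hessq_diff_le:
  fixes f :: "'a::euclidean_space \<Rightarrow> real"
  assumes "\<And>b c. b \<in> Basis \<Longrightarrow> c \<in> Basis \<Longrightarrow> \<bar>ipartial f [b, c] y - ipartial g [b, c] x\<bar> \<le> \<eta>"
  shows "\<bar>hessq f y v v - hessq g x v v\<bar> \<le> \<eta> * (real DIM('a))\<^sup>2 * (norm v)\<^sup>2"
proof -
  have \<eta>: "\<eta> \<ge> 0" using assms[OF SOME_Basis SOME_Basis] by linarith
  have "\<bar>hessq f y v v - hessq g x v v\<bar> = \<bar>\<Sum>b\<in>Basis. \<Sum>c\<in>Basis. (v \<bullet> b) * (v \<bullet> c) * (ipartial f [b, c] y - ipartial g [b, c] x)\<bar>"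
    by (simp add: hessq_def sum_subtractf right_diff_distrib del: ipartial.simps)
  also have "\<dots> \<le> (\<Sum>b\<in>Basis. \<Sum>c\<in>Basis. \<bar>(v \<bullet> b) * (v \<bullet> c) * (ipartial f [b, c] y - ipartial g [b, c] x)\<bar>)"
    by (intro order_trans[OF sum_abs] sum_mono sum_abs)
  also have "\<dots> \<le> (\<Sum>b\<in>(Basis::'a set). \<Sum>c\<in>(Basis::'a set). (norm v * norm v) * \<eta>)"
    unfolding abs_mult using assms \<eta> Basis_le_norm[of _ v]
    by (intro sum_mono mult_mono) (auto simp del: ipartial.simps)
  also have "\<dots> = \<eta> * (real DIM('a))\<^sup>2 * (norm v)\<^sup>2" by (simp add: power2_eq_square)
  finally show ?thesis .
qed

lemma hessq_continuous:
  fixes f :: "'a::euclidean_space \<Rightarrow> real"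
  assumes f: "C_k k f" "2 \<le> k" and \<epsilon>: "\<epsilon> > 0"
  obtains \<delta> where "\<delta> > 0" "\<And>y v. norm (y - x) < \<delta> \<Longrightarrow> \<bar>hessq f y v v - hessq f x v v\<bar> \<le> \<epsilon> * (norm v)\<^sup>2"
proof -
  \<comment> \<open>The form has n^2 entries, n being the dimension, each multiplied by at most
    |v|^2.\<close>
  define \<eta> where "\<eta> = \<epsilon> / (real DIM('a))\<^sup>2"
  have \<eta>: "\<eta> > 0" using \<epsilon> by (simp add: \<eta>_def)
  define P where "P = (\<lambda>b c d. \<forall>y. norm (y - x) < d \<longrightarrow> \<bar>ipartial f [b, c] y - ipartial f [b, c] x\<bar> < \<eta>)"
  have "\<exists>d>0. P b c d" if "b \<in> Basis" "c \<in> Basis" for b c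
    using continuous_on_UNIV_ball[OF C_k_continuous[OF f(1), of "[b, c]"] \<eta>, of x] that f(2)
    unfolding P_def by (auto simp del: ipartial.simps)
  then obtain d where d: "\<And>b c. b \<in> Basis \<Longrightarrow> c \<in> Basis \<Longrightarrow> d b c > 0 \<and> P b c (d b c)" by metis
  define \<delta> where "\<delta> = Min ((\<lambda>(b, c). d b c) ` (Basis \<times> Basis))"
  have fin: "finite ((\<lambda>(b, c). d b c) ` (Basis \<times> Basis))" "(\<lambda>(b, c). d b c) ` (Basis \<times> Basis) \<noteq> {}" by auto
  have "\<delta> > 0" unfolding \<delta>_def using fin d by (subst Min_gr_iff) auto
  moreover have "\<bar>hessq f y v v - hessq f x v v\<bar> \<le> \<epsilon> * (norm v)\<^sup>2" if y: "norm (y - x) < \<delta>" for y v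
  proof -
    have "\<bar>ipartial f [b, c] y - ipartial f [b, c] x\<bar> \<le> \<eta>" if "b \<in> Basis" "c \<in> Basis" for b c
    proof -
      have "\<delta> \<le> d b c" unfolding \<delta>_def using fin that by (intro Min_le) auto
      then show ?thesis using d[OF that] y unfolding P_def by (meson less_imp_le less_le_trans)
    qed
    from hessq_diff_le[OF this, of v] show ?thesis by (simp add: \<eta>_def)
  qed
  ultimately show ?thesis using that by blast
qed

lemma second_partials_bounded:
  fixes f :: "'a::euclidean_space \<Rightarrow> real"
  assumes f: "C_k k f" "2 \<le> k" and S: "compact S"
  obtains B where "B \<ge> 0" "\<And>b c y. b \<in> Basis \<Longrightarrow> c \<in> Basis \<Longrightarrow> y \<in> S \<Longrightarrow> \<bar>ipartial f [b, c] y\<bar> \<le> B"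
proof -
  have "\<exists>B. \<forall>y\<in>S. \<bar>ipartial f [b, c] y\<bar> \<le> B" if "b \<in> Basis" "c \<in> Basis" for b c
  proof -
    have "continuous_on S (ipartial f [b, c])"
      using C_k_continuous[OF f(1), of "[b, c]"] that f(2) continuous_on_subset by (auto simp del: ipartial.simps)
    then have "bounded (ipartial f [b, c] ` S)"
      using S by (intro compact_imp_bounded compact_continuous_image)
    then show ?thesis by (auto simp: bounded_iff simp del: ipartial.simps)
  qed
  then obtain B where B: "\<And>b c y. b \<in> Basis \<Longrightarrow> c \<in> Basis \<Longrightarrow> y \<in> S \<Longrightarrow> \<bar>ipartial f [b, c] y\<bar> \<le> B b c"
    by metis
  \<comment> \<open>Including 0 keeps the maximum nonnegative, also when S is empty.\<close>
  define B' where "B' = Max (insert 0 ((\<lambda>(b, c). B b c) ` (Basis \<times> Basis)))"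
  have "B b c \<le> B'" if "b \<in> Basis" "c \<in> Basis" for b c
    unfolding B'_def using that by (intro Max_ge) auto
  moreover have "B' \<ge> 0" unfolding B'_def by (intro Max_ge) auto
  ultimately show ?thesis using B that[of B'] by (meson order_trans)
qed

lemma hessq_bound:
  fixes f :: "'a::euclidean_space \<Rightarrow> real"
  assumes "\<And>b c. b \<in> Basis \<Longrightarrow> c \<in> Basis \<Longrightarrow> \<bar>ipartial f [b, c] y\<bar> \<le> B"
  shows "\<bar>hessq f y v v\<bar> \<le> B * (real DIM('a))\<^sup>2 * (norm v)\<^sup>2"
proof -
  have B: "B \<ge> 0" using assms[OF SOME_Basis SOME_Basis] by linarith
  have "\<bar>hessq f y v v\<bar> \<le> (\<Sum>b\<in>Basis. \<Sum>c\<in>Basis. \<bar>(v \<bullet> b) * (v \<bullet> c) * ipartial f [b, c] y\<bar>)"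
    unfolding hessq_def by (intro order_trans[OF sum_abs] sum_mono sum_abs)
  also have "\<dots> \<le> (\<Sum>b\<in>(Basis::'a set). \<Sum>c\<in>(Basis::'a set). (norm v * norm v) * B)"
    unfolding abs_mult using assms B Basis_le_norm[of _ v]
    by (intro sum_mono mult_mono) (auto simp del: ipartial.simps)
  also have "\<dots> = B * (real DIM('a))\<^sup>2 * (norm v)\<^sup>2" by (simp add: power2_eq_square)
  finally show ?thesis .
qed

lemma even_gradient_zero:
  assumes f: "C_k k f" "1 \<le> k" and even: "\<And>x. f (- x) = f x" and b: "b \<in> Basis"
  shows "ipartial f [b] 0 = 0"
proof -
  have D: "((\<lambda>t. f (t *\<^sub>R b)) has_real_derivative ipartial f [b] 0) (at 0)"
    using ipartial_DERIV[OF f(1), of "[]" b 0 0] b f(2) by simp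
  have "((\<lambda>t. f ((- t) *\<^sub>R b)) has_real_derivative ipartial f [b] 0 * (- 1)) (at 0)"
    by (rule DERIV_chain2[of "\<lambda>t. f (t *\<^sub>R b)"]) (use D in \<open>auto intro!: derivative_eq_intros simp del: ipartial.simps\<close>)
  then have "((\<lambda>t. f (t *\<^sub>R b)) has_real_derivative - ipartial f [b] 0) (at 0)"
    using even by (simp del: ipartial.simps)
  from DERIV_unique[OF D this] show ?thesis by simp
qed

section \<open>Periodicity and the closed cube\<close>

lemma periodic_fun_sum:
  assumes f: "periodic_fun f" and S: "finite S" "S \<subseteq> Basis"
  shows "f (x + (\<Sum>b\<in>S. (2 * pi) *\<^sub>R b)) = f x"
  using S
proof (induction S rule: finite_induct)
  case (insert b S)
  have "f ((x + (\<Sum>b\<in>S. (2 * pi) *\<^sub>R b)) + (2 * pi) *\<^sub>R b) = f (x + (\<Sum>b\<in>S. (2 * pi) *\<^sub>R b))"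
    using f insert.prems unfolding periodic_fun_def by blast
  then show ?case using insert by (simp add: add_ac)
qed simp

text \<open>The faces with a coordinate -pi are missing from the half-open cube, and adding 2 pi
  there leads back into it. A shifted coordinate equals pi, so a nonzero point keeps a nonzero
  representative.\<close>

lemma ccube_representative:
  assumes f: "periodic_fun f" and x: "x \<in> ccube" "x \<noteq> 0"
  obtains y where "y \<in> torus_box" "y \<noteq> 0" "f y = f x"
proof -
  define S where "S = {b\<in>Basis. x \<bullet> b = - pi}"
  have S: "finite S" "S \<subseteq> Basis" by (auto simp: S_def)
  define y where "y = x + (\<Sum>b\<in>S. (2 * pi) *\<^sub>R b)"
  have yb: "y \<bullet> b = x \<bullet> b + (if b \<in> S then 2 * pi else 0)" if b: "b \<in> Basis" for b
  proof -
    have "(\<Sum>c\<in>S. (2 * pi) *\<^sub>R c) \<bullet> b = (\<Sum>c\<in>S. 2 * pi * (c \<bullet> b))"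
      by (simp add: inner_sum_left)
    also have "\<dots> = (\<Sum>c\<in>S. if c = b then 2 * pi else 0)"
      using S b by (intro sum.cong refl) (auto simp: inner_Basis subset_iff)
    finally have "(\<Sum>c\<in>S. (2 * pi) *\<^sub>R c) \<bullet> b = (\<Sum>c\<in>S. if c = b then 2 * pi else 0)" .
    then show ?thesis using S by (simp add: y_def inner_add_left)
  qed
  have "y \<in> torus_box"
    using x(1) yb by (auto simp: torus_box_def mem_ccube S_def abs_le_iff)
  moreover have "y \<noteq> 0"
  proof
    assume "y = 0"
    then have "x \<bullet> b + (if b \<in> S then 2 * pi else 0) = 0" if "b \<in> Basis" for b using yb[OF that] by simp
    then have "x \<bullet> b = 0" if "b \<in> Basis" for b
      using that pi_gt_zero by (smt (verit) S_def mem_Collect_eq)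
    then show False using x(2) by (metis euclidean_all_zero_iff)
  qed
  ultimately show ?thesis using that periodic_fun_sum[OF f S] by (simp add: y_def)
qed

lemma torus_box_subset_ccube: "torus_box \<subseteq> ccube"
  by (auto simp: torus_box_def mem_ccube abs_le_iff) (smt (verit))

section \<open>Quadratic growth at a nondegenerate minimum\<close>

locale even_minimum =
  fixes f :: "'a::euclidean_space \<Rightarrow> real" and k :: nat
  assumes f: "C_k k f" "2 \<le> k" and per: "periodic_fun f" and even: "\<And>x. f (- x) = f x"
    and min: "\<And>x. x \<in> torus_box \<Longrightarrow> x \<noteq> 0 \<Longrightarrow> f 0 < f x"
    and nondeg: "\<And>v. (\<And>c. c \<in> Basis \<Longrightarrow> (\<Sum>b\<in>Basis. (v \<bullet> b) * ipartial f [b, c] 0) = 0) \<Longrightarrow> v = 0"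
begin

lemma min_ccube: "x \<in> ccube \<Longrightarrow> x \<noteq> 0 \<Longrightarrow> f 0 < f x"
  using ccube_representative[OF per] min by metis

lemma cont: "continuous_on UNIV f"
  using C_k_continuous[OF f(1), of "[]"] by simp

lemma Taylor0:
  obtains \<theta> where "0 < \<theta>" "\<theta> < 1" "f v = f 0 + hessq f (\<theta> *\<^sub>R v) v v / 2"
proof -
  have "(\<Sum>b\<in>Basis. (v \<bullet> b) * ipartial f [b] 0) = 0"
    using even_gradient_zero[OF f(1) _ even] f(2) by (intro sum.neutral) (auto simp del: ipartial.simps)
  then show ?thesis
    using C_k_Taylor2[OF f, of 0 v] that by (auto simp del: ipartial.simps)
qed

lemma approx:
  assumes \<epsilon>: "\<epsilon> > 0"
  obtains \<delta> where "\<delta> > 0" "\<And>v. norm v < \<delta> \<Longrightarrow> \<bar>f v - f 0 - hessq f 0 v v / 2\<bar> \<le> \<epsilon> * (norm v)\<^sup>2"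
proof -
  obtain \<delta> where \<delta>: "\<delta> > 0" "\<And>y v. norm (y - 0) < \<delta> \<Longrightarrow> \<bar>hessq f y v v - hessq f 0 v v\<bar> \<le> \<epsilon> * (norm v)\<^sup>2"
    using hessq_continuous[OF f \<epsilon>] by blast
  show ?thesis
  proof (rule that[OF \<delta>(1)])
    fix v :: 'a assume v: "norm v < \<delta>"
    obtain \<theta> where \<theta>: "0 < \<theta>" "\<theta> < 1" "f v = f 0 + hessq f (\<theta> *\<^sub>R v) v v / 2" by (rule Taylor0)
    have "norm (\<theta> *\<^sub>R v) \<le> norm v" using \<theta> by (simp add: mult_left_le_one_le)
    then have "\<bar>hessq f (\<theta> *\<^sub>R v) v v - hessq f 0 v v\<bar> \<le> \<epsilon> * (norm v)\<^sup>2" using v by (intro \<delta>(2)) auto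
    moreover have "0 \<le> \<epsilon> * (norm v)\<^sup>2" using \<epsilon> by simp
    ultimately show "\<bar>f v - f 0 - hessq f 0 v v / 2\<bar> \<le> \<epsilon> * (norm v)\<^sup>2" using \<theta>(3) by (simp add: abs_le_iff)
  qed
qed

lemma hess_nonneg: "0 \<le> hessq f 0 v v"
proof (rule ccontr)
  assume neg: "\<not> 0 \<le> hessq f 0 v v"
  then have v: "v \<noteq> 0" by (auto simp: hessq_def)
  \<comment> \<open>The error takes back half of the negative leading term, so that a quarter of the
    Hessian value remains.\<close>
  define \<epsilon> where "\<epsilon> = - hessq f 0 v v / (4 * (norm v)\<^sup>2)"
  have \<epsilon>: "\<epsilon> > 0" using neg v by (simp add: \<epsilon>_def divide_neg_pos)
  obtain \<delta> where \<delta>: "\<delta> > 0" "\<And>v. norm v < \<delta> \<Longrightarrow> \<bar>f v - f 0 - hessq f 0 v v / 2\<bar> \<le> \<epsilon> * (norm v)\<^sup>2"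
    using approx[OF \<epsilon>] by blast
  \<comment> \<open>The norm of t v becomes half of min \<delta> pi, inside both the Taylor ball and
    the cube.\<close>
  define t where "t = min \<delta> pi / (2 * norm v)"
  have mp: "min \<delta> pi \<le> pi * 2" using min.cobounded2[of \<delta> pi] pi_gt_zero by linarith
  have t: "t > 0" "norm (t *\<^sub>R v) < \<delta>" "norm (t *\<^sub>R v) \<le> pi" using v \<delta>(1) mp by (auto simp: t_def)
  have "f 0 < f (t *\<^sub>R v)" using t v by (intro min_ccube cball_subset_ccube) auto
  moreover have "f (t *\<^sub>R v) - f 0 \<le> t\<^sup>2 * hessq f 0 v v / 2 + \<epsilon> * (t\<^sup>2 * (norm v)\<^sup>2)"
    using \<delta>(2)[OF t(2)] t(1) by (simp add: hessq_scale power_mult_distrib power2_eq_square abs_le_iff mult_ac)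
  moreover have "t\<^sup>2 * hessq f 0 v v / 2 + \<epsilon> * (t\<^sup>2 * (norm v)\<^sup>2) = t\<^sup>2 * (hessq f 0 v v / 4)"
    using v by (simp add: \<epsilon>_def field_simps)
  moreover have "t\<^sup>2 * (hessq f 0 v v / 4) < 0" using neg t by (simp add: mult_pos_neg)
  ultimately show False by linarith
qed

text \<open>A nonnegative form vanishing at v has v in its kernel, since it would otherwise become
  negative at some v + t w; the kernel is trivial by nondegeneracy.\<close>

lemma hess_pos: assumes v: "v \<noteq> 0" shows "0 < hessq f 0 v v"
proof (rule ccontr)
  assume "\<not> 0 < hessq f 0 v v"
  then have v0: "hessq f 0 v v = 0" using hess_nonneg[of v] by linarith
  have sym: "hessq f 0 v w = hessq f 0 w v" for v w by (rule hessq_sym[OF f])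
  have "hessq f 0 v w = 0" for w
  proof (rule ccontr)
    assume ne: "hessq f 0 v w \<noteq> 0"
    define a where "a = hessq f 0 v w"
    define d where "d = hessq f 0 w w + 1"
    have d: "d > 0" using hess_nonneg[of w] by (simp add: d_def)
    have exp: "hessq f 0 (v + t *\<^sub>R w) (v + t *\<^sub>R w) = 2 * t * a + t\<^sup>2 * hessq f 0 w w" for t
      by (simp add: hessq_add hessq_scale sym[of _ "v + _"] v0 sym[of w v] a_def power2_eq_square algebra_simps)
    \<comment> \<open>The choice t = -a/d. The minimiser would have the Hessian at w in the
      denominator; adding 1 excludes division by zero and still makes the value negative.\<close>
    have "0 \<le> 2 * (- a / d) * a + (- a / d)\<^sup>2 * hessq f 0 w w"
      unfolding exp[symmetric] by (rule hess_nonneg)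
    also have "hessq f 0 w w = d - 1" by (simp add: d_def)
    also have "2 * (- a / d) * a + (- a / d)\<^sup>2 * (d - 1) = (a / d)\<^sup>2 * (- d - 1)"
      using d by (simp add: power2_eq_square field_simps)
    also have "\<dots> < 0" using ne d by (intro mult_pos_neg) (auto simp: a_def)
    finally show False by simp
  qed
  then have z: "hessq f 0 v c = 0" for c .
  have "v = 0"
  proof (rule nondeg)
    fix c :: 'a assume c: "c \<in> Basis"
    have "hessq f 0 v c = (\<Sum>b\<in>Basis. \<Sum>c'\<in>Basis. if c' = c then (v \<bullet> b) * ipartial f [b, c] 0 else 0)"
      unfolding hessq_def using c by (intro sum.cong refl) (auto simp: inner_Basis simp del: ipartial.simps)
    also have "\<dots> = (\<Sum>b\<in>Basis. (v \<bullet> b) * ipartial f [b, c] 0)" using c by (simp del: ipartial.simps)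
    finally show "(\<Sum>b\<in>Basis. (v \<bullet> b) * ipartial f [b, c] 0) = 0" using z[of c] by simp
  qed
  with v show False by simp
qed

lemma hess_lower: obtains \<kappa> where "\<kappa> > 0" "\<And>v. \<kappa> * (norm v)\<^sup>2 \<le> hessq f 0 v v"
proof (rule homogeneous_bounds[of "\<lambda>v. hessq f 0 v v"])
  show "hessq f 0 (a *\<^sub>R x) (a *\<^sub>R x) = a\<^sup>2 * hessq f 0 x x" for a x
    by (simp add: hessq_scale power2_eq_square)
qed (use hessq_cont hess_pos that in blast)+

text \<open>Near 0 a Taylor error \<kappa>/4 leaves \<kappa>/4 of the Hessian bound \<kappa>/2; away
  from 0 the quotient of f - f 0 by |x|^2 has a positive minimum by compactness. One constant serves
  both f and its Hessian form, as \<open>threshold\<close> demands.\<close>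

lemma quadratic_lower_bound:
  obtains c where "c > 0" "\<And>x. x \<in> ccube \<Longrightarrow> c * (norm x)\<^sup>2 \<le> f x - f 0" "\<And>v. c * (norm v)\<^sup>2 \<le> hessq f 0 v v / 2"
proof -
  obtain \<kappa> where \<kappa>: "\<kappa> > 0" "\<And>v. \<kappa> * (norm v)\<^sup>2 \<le> hessq f 0 v v" by (rule hess_lower) blast
  obtain \<delta> where \<delta>: "\<delta> > 0" "\<And>v. norm v < \<delta> \<Longrightarrow> \<bar>f v - f 0 - hessq f 0 v v / 2\<bar> \<le> \<kappa> / 4 * (norm v)\<^sup>2"
    using approx[of "\<kappa> / 4"] \<kappa>(1) by auto
  define S where "S = (ccube :: 'a set) - ball 0 \<delta>"
  have S: "compact S" unfolding S_def by (intro compact_diff compact_ccube open_ball)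
  have far: "\<exists>c>0. \<forall>x\<in>S. c * (norm x)\<^sup>2 \<le> f x - f 0"
  proof (cases "S = {}")
    case False
    have "continuous_on S (\<lambda>x. (f x - f 0) / (norm x)\<^sup>2)"
      using \<delta>(1) by (intro continuous_intros continuous_on_subset[OF cont]) (auto simp: S_def)
    then obtain x0 where x0: "x0 \<in> S" "\<And>x. x \<in> S \<Longrightarrow> (f x0 - f 0) / (norm x0)\<^sup>2 \<le> (f x - f 0) / (norm x)\<^sup>2"
      using continuous_attains_inf[OF S False] by blast
    have "(f x0 - f 0) / (norm x0)\<^sup>2 > 0"
    proof -
      have "x0 \<noteq> 0" "x0 \<in> ccube" using x0(1) \<delta>(1) by (auto simp: S_def)
      then show ?thesis using min_ccube[of x0] by simp
    qed
    moreover have "(f x0 - f 0) / (norm x0)\<^sup>2 * (norm x)\<^sup>2 \<le> f x - f 0" if "x \<in> S" for x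
    proof -
      have "norm x > 0" using that \<delta>(1) by (auto simp: S_def)
      then show ?thesis using x0(2)[OF that] by (subst (asm) pos_le_divide_eq) auto
    qed
    ultimately show ?thesis by blast
  qed (auto intro: exI[of _ 1])
  then obtain c where c: "c > 0" "\<And>x. x \<in> S \<Longrightarrow> c * (norm x)\<^sup>2 \<le> f x - f 0" by blast
  show ?thesis
  proof (rule that[of "min c (\<kappa> / 4)"])
    show "min c (\<kappa> / 4) > 0" using c(1) \<kappa>(1) by simp
    have m1: "min c (\<kappa> / 4) * (norm x)\<^sup>2 \<le> c * (norm x)\<^sup>2" "min c (\<kappa> / 4) * (norm x)\<^sup>2 \<le> \<kappa> / 4 * (norm x)\<^sup>2" for x :: 'a
      by (intro mult_right_mono; simp)+
    show "min c (\<kappa> / 4) * (norm x)\<^sup>2 \<le> f x - f 0" if x: "x \<in> ccube" for x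
    proof (cases "norm x < \<delta>")
      case True
      then show ?thesis using \<delta>(2)[OF True] \<kappa>(2)[of x] m1(2)[of x] unfolding abs_le_iff by linarith
    next
      case False
      then show ?thesis using c(2)[of x] x m1(1)[of x] by (simp add: S_def)
    qed
    show "min c (\<kappa> / 4) * (norm v)\<^sup>2 \<le> hessq f 0 v v / 2" for v
    proof -
      have "0 \<le> \<kappa> * (norm v)\<^sup>2" using \<kappa>(1) by simp
      then show ?thesis using \<kappa>(2)[of v] m1(2)[of v] by linarith
    qed
  qed
qed

text \<open>By evenness the gradient vanishes at 0 and is therefore O(|x|), which gives the first
  difference its factor |h| + |x|. In the symmetric second difference the gradient terms
  cancel.\<close>

lemma difference_bounds:
  obtains C where "C \<ge> 0"
    "\<And>x h. norm x \<le> R \<Longrightarrow> norm h \<le> R \<Longrightarrow> \<bar>f (x + h) - f x\<bar> \<le> C * norm h * (norm h + norm x)"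
    "\<And>x h. norm x \<le> R \<Longrightarrow> norm h \<le> R \<Longrightarrow> \<bar>f (x + h) + f (x - h) - 2 * f x\<bar> \<le> C * (norm h)\<^sup>2"
proof -
  let ?n = "real DIM('a)"
  obtain B where B: "B \<ge> 0" "\<And>b c y. b \<in> Basis \<Longrightarrow> c \<in> Basis \<Longrightarrow> y \<in> cball 0 (2 * R) \<Longrightarrow> \<bar>ipartial f [b, c] y\<bar> \<le> B"
    using second_partials_bounded[OF f, of "cball 0 (2 * R)"] by auto
  have hb: "\<bar>hessq f (x + \<theta> *\<^sub>R h) h h\<bar> \<le> B * ?n\<^sup>2 * (norm h)\<^sup>2"
    if "norm x \<le> R" "norm h \<le> R" "0 < \<theta>" "\<theta> < 1" for x h \<theta>
  proof (rule hessq_bound)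
    have "norm (x + \<theta> *\<^sub>R h) \<le> norm x + \<theta> * norm h" using that by (metis abs_of_pos norm_scaleR norm_triangle_ineq)
    also have "\<dots> \<le> 2 * R" using that mult_left_le_one_le[of "norm h" \<theta>] by simp
    finally show "\<bar>ipartial f [b, c] (x + \<theta> *\<^sub>R h)\<bar> \<le> B" if "b \<in> Basis" "c \<in> Basis" for b c
      using that by (intro B) auto
  qed
  have gr: "\<bar>ipartial f [b] x\<bar> \<le> ?n * B * norm x" if b: "b \<in> Basis" and x: "norm x \<le> R" for b x
  proof -
    have "\<exists>t. 0 < t \<and> t < 1 \<and> ipartial f [b] (0 + 1 *\<^sub>R x) - ipartial f [b] (0 + 0 *\<^sub>R x) =
      (1 - 0) * (\<Sum>c\<in>Basis. (x \<bullet> c) * ipartial f [c, b] (0 + t *\<^sub>R x))"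
      using ipartial_line_DERIV[OF f(1), of "[b]" 0 x] b f(2)
      by (intro MVT2) (auto simp del: ipartial.simps)
    then obtain t where t: "0 < t" "t < 1" and eq: "ipartial f [b] x - ipartial f [b] 0 = (\<Sum>c\<in>Basis. (x \<bullet> c) * ipartial f [c, b] (t *\<^sub>R x))"
      by (auto simp del: ipartial.simps)
    have "norm (t *\<^sub>R x) \<le> norm x" using t by (simp add: mult_left_le_one_le)
    then have tx: "t *\<^sub>R x \<in> cball 0 (2 * R)" using x norm_ge_zero[of x] by (simp del: norm_ge_zero)
    have "\<bar>ipartial f [b] x\<bar> = \<bar>\<Sum>c\<in>Basis. (x \<bullet> c) * ipartial f [c, b] (t *\<^sub>R x)\<bar>"
      using eq even_gradient_zero[OF f(1) _ even b] f(2) by (simp del: ipartial.simps)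
    also have "\<dots> \<le> (\<Sum>c\<in>(Basis::'a set). norm x * B)"
      by (intro order_trans[OF sum_abs] sum_mono, unfold abs_mult, intro mult_mono B Basis_le_norm)
         (use b tx in \<open>auto simp del: ipartial.simps\<close>)
    finally show ?thesis by (simp add: mult_ac)
  qed
  define C where "C = ?n\<^sup>2 * B"
  have C: "C \<ge> 0" using B by (simp add: C_def)
  show ?thesis
  proof (rule that[OF C])
    fix x h :: 'a assume x: "norm x \<le> R" and h: "norm h \<le> R"
    obtain \<theta> where \<theta>: "0 < \<theta>" "\<theta> < 1" "f (x + h) = f x + (\<Sum>b\<in>Basis. (h \<bullet> b) * ipartial f [b] x) + hessq f (x + \<theta> *\<^sub>R h) h h / 2"
      by (rule C_k_Taylor2[OF f])
    obtain \<theta>' where \<theta>': "0 < \<theta>'" "\<theta>' < 1" "f (x + (- h)) = f x + (\<Sum>b\<in>Basis. ((- h) \<bullet> b) * ipartial f [b] x) + hessq f (x + \<theta>' *\<^sub>R (- h)) (- h) (- h) / 2"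
      by (rule C_k_Taylor2[OF f])
    have h1: "\<bar>hessq f (x + \<theta> *\<^sub>R h) h h\<bar> \<le> C * (norm h)\<^sup>2"
      using hb[OF x h \<theta>(1,2)] by (simp add: C_def mult_ac)
    have h2: "\<bar>hessq f (x + \<theta>' *\<^sub>R (- h)) (- h) (- h)\<bar> \<le> C * (norm h)\<^sup>2"
      using hb[OF x _ \<theta>'(1,2), of "- h"] h by (simp add: C_def mult_ac)
    have "\<bar>\<Sum>b\<in>Basis. (h \<bullet> b) * ipartial f [b] x\<bar> \<le> (\<Sum>b\<in>(Basis::'a set). norm h * (?n * B * norm x))"
      by (intro order_trans[OF sum_abs] sum_mono, unfold abs_mult, intro mult_mono gr Basis_le_norm)
         (use x in \<open>auto simp del: ipartial.simps\<close>)
    also have "\<dots> = C * norm h * norm x" by (simp add: C_def power2_eq_square)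
    finally have g1: "\<bar>\<Sum>b\<in>Basis. (h \<bullet> b) * ipartial f [b] x\<bar> \<le> C * norm h * norm x" .
    have "0 \<le> C * (norm h)\<^sup>2" using C by simp
    then have "\<bar>f (x + h) - f x\<bar> \<le> C * norm h * norm x + C * (norm h)\<^sup>2"
      using \<theta>(3) g1 h1 by (simp add: abs_le_iff del: ipartial.simps)
    then show "\<bar>f (x + h) - f x\<bar> \<le> C * norm h * (norm h + norm x)" by (simp add: algebra_simps power2_eq_square)
    have "(\<Sum>b\<in>Basis. ((- h) \<bullet> b) * ipartial f [b] x) = - (\<Sum>b\<in>Basis. (h \<bullet> b) * ipartial f [b] x)"
      by (simp add: sum_negf del: ipartial.simps)
    then show "\<bar>f (x + h) + f (x - h) - 2 * f x\<bar> \<le> C * (norm h)\<^sup>2"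
      using \<theta>(3) \<theta>'(3) h1 h2 by (simp add: abs_le_iff del: ipartial.simps)
  qed
qed

end

section \<open>The block Hessian of (H1) and the threshold hypotheses\<close>

lemma mem_ccube_Pair: "(p, t) \<in> ccube \<longleftrightarrow> p \<in> ccube \<and> t \<in> ccube"
  by (simp add: mem_ccube Basis_prod_def ball_Un)

lemma norm_Pair_sq: "(norm (p, t))\<^sup>2 = (norm p)\<^sup>2 + (norm t)\<^sup>2"
  by (simp add: norm_Pair)

lemma sum_Basis_vec:
  fixes g :: "real^3 \<Rightarrow> real"
  shows "(\<Sum>b\<in>Basis. g b) = (\<Sum>i\<in>UNIV. g (axis i 1))"
proof -
  have "(Basis :: (real^3) set) = (\<lambda>i. axis i 1) ` UNIV" by (auto simp: Basis_vec_def)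
  then have "(\<Sum>b\<in>Basis. g b) = sum g ((\<lambda>i. axis i 1) ` UNIV)" by (rule arg_cong)
  also have "\<dots> = sum (g \<circ> (\<lambda>i. axis i 1)) UNIV"
    by (rule sum.reindex) (auto simp: inj_def axis_eq_axis)
  finally show ?thesis by (simp add: o_def)
qed

lemma sum_Basis_vec_prod:
  fixes g :: "(real^3) \<times> (real^3) \<Rightarrow> real"
  shows "(\<Sum>b\<in>Basis. g b) = (\<Sum>i\<in>UNIV. g (axis i 1, 0)) + (\<Sum>i\<in>UNIV. g (0, axis i 1))"
proof -
  have "inj_on (\<lambda>u::real^3. (u, 0::real^3)) Basis" "inj_on (\<lambda>u::real^3. (0::real^3, u)) Basis"
    by (auto intro!: inj_onI)
  then have "(\<Sum>b\<in>Basis. g b) = (\<Sum>b\<in>Basis. g (b, 0)) + (\<Sum>b\<in>Basis. g (0, b))"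
    unfolding Basis_prod_def by (subst sum.union_disjoint) (auto simp: sum.reindex)
  then show ?thesis by (simp add: sum_Basis_vec)
qed

lemma inner_matrix_vector: "x \<bullet> (U *v y) = (\<Sum>i\<in>UNIV. \<Sum>j\<in>UNIV. x $ i * y $ j * U $ i $ j)" for U :: "real^3^3"
  by (simp add: inner_vec_def matrix_vector_mult_def sum_distrib_left mult_ac)

text \<open>All blocks of the Hessian being multiples of one matrix U, completing the square in t
  stays within the single form q: H(p, t) = l q(t + s p) + L q(p) with s = b/l and L = a - b^2/l.
  This is where part (ii) of (H1) acts.\<close>

lemma thresholdI:
  fixes w H :: "(real^3) \<times> (real^3) \<Rightarrow> real" and U :: "real^3^3"
  assumes pd: "posdef3 U" and sym: "\<And>x y. x \<bullet> (U *v y) = y \<bullet> (U *v x)" and l: "l > 0" and c: "c > 0" and C: "C \<ge> 0"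
    and w_cont: "continuous_on UNIV w"
    and w_lower: "\<And>p t. p \<in> ccube \<Longrightarrow> t \<in> ccube \<Longrightarrow> c * ((norm p)\<^sup>2 + (norm t)\<^sup>2) \<le> w (p, t)"
    and w_even: "\<And>p t. w (- p, - t) = w (p, t)"
    and w_diff: "\<And>p t. p \<in> ccube \<Longrightarrow> t \<in> ccube \<Longrightarrow> \<bar>w (p, t) - w (0, t)\<bar> \<le> C * norm p * (norm p + norm t)"
    and w_diff2: "\<And>p t. p \<in> ccube \<Longrightarrow> t \<in> ccube \<Longrightarrow> \<bar>w (p, t) + w (- p, t) - 2 * w (0, t)\<bar> \<le> C * (norm p)\<^sup>2"
    and H: "\<And>p t. H (p, t) = a * (p \<bullet> (U *v p)) + 2 * b * (p \<bullet> (U *v t)) + l * (t \<bullet> (U *v t))"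
    and H_lower: "\<And>p t. c * ((norm p)\<^sup>2 + (norm t)\<^sup>2) \<le> H (p, t) / 2"
    and w_approx: "\<And>\<epsilon>. \<epsilon> > 0 \<Longrightarrow> \<exists>\<delta>>0. \<forall>p t. norm p < \<delta> \<longrightarrow> norm t < \<delta> \<longrightarrow>
       \<bar>w (p, t) - H (p, t) / 2\<bar> \<le> \<epsilon> * ((norm p)\<^sup>2 + (norm t)\<^sup>2)"
    and \<phi>: "hyp_H2 \<phi>"
  shows "\<exists>q \<kappa> \<kappa>' L s. threshold q \<kappa> \<kappa>' w \<phi> l L s c C"
proof -
  define q where "q x = x \<bullet> (U *v x)" for x
  have q_cont: "continuous_on UNIV q"
    unfolding q_def by (intro continuous_intros matrix_vector_mult_linear_continuous_on)
  obtain \<kappa> \<kappa>' where \<kappa>: "\<kappa> > 0" "\<And>x. \<kappa> * (norm x)\<^sup>2 \<le> q x" "\<And>x. q x \<le> \<kappa>' * (norm x)\<^sup>2"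
  proof (rule homogeneous_bounds[OF q_cont])
    show "q (a *\<^sub>R x) = a\<^sup>2 * q x" for a x
      by (simp add: q_def matrix_vector_mult_scaleR power2_eq_square)
    show "x \<noteq> 0 \<Longrightarrow> 0 < q x" for x using pd by (simp add: q_def posdef3_def)
  qed blast
  define s where "s = b / l"
  define L where "L = a - b\<^sup>2 / l"
  have sq: "l * q (t + s *\<^sub>R p) + L * q p = H (p, t)" for p t
  proof -
    have "q (t + s *\<^sub>R p) = q t + 2 * s * (p \<bullet> (U *v t)) + s\<^sup>2 * q p"
      by (simp add: q_def matrix_vector_right_distrib matrix_vector_mult_scaleR inner_add_left inner_add_right sym[of t p] power2_eq_square algebra_simps)
    then show ?thesis using l by (simp add: H s_def L_def q_def power2_eq_square field_simps)
  qed
  \<comment> \<open>At t = -s p the first square vanishes, so the lower bound on H there is a bound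
    on L q p.\<close>
  have L: "L > 0"
  proof -
    obtain p :: "real^3" where p: "p \<in> Basis" using SOME_Basis by blast
    have "0 < c * ((norm p)\<^sup>2 + (norm (- s *\<^sub>R p))\<^sup>2)" using c p by (simp add: add_pos_nonneg)
    also have "\<dots> \<le> (l * q (- s *\<^sub>R p + s *\<^sub>R p) + L * q p) / 2" unfolding sq by (rule H_lower)
    also have "\<dots> = L * q p / 2" by (simp add: q_def)
    finally have "0 < L * q p" by simp
    moreover have "0 < q p" using \<kappa>(1) \<kappa>(2)[of p] p by simp
    ultimately show ?thesis by (simp add: zero_less_mult_iff)
  qed
  have "threshold q \<kappa> \<kappa>' w \<phi> l L s c C"
  proof
    show "continuous_on UNIV \<phi>"
      using \<phi> C_k_continuous[of 2 \<phi> "[]"] by (simp add: hyp_H2_def)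
    show "(\<phi> (- t))\<^sup>2 = (\<phi> t)\<^sup>2" for t
      using \<phi> by (auto simp: hyp_H2_def power2_eq_square)
    show "q (- x) = q x" for x
      using matrix_vector_mult_scaleR[of U "-1" x] by (simp add: q_def)
    show "\<exists>\<delta>>0. \<forall>p t. norm p < \<delta> \<longrightarrow> norm t < \<delta> \<longrightarrow>
       \<bar>w (p, t) - (l * q (t + s *\<^sub>R p) + L * q p) / 2\<bar> \<le> \<epsilon> * ((norm p)\<^sup>2 + (norm t)\<^sup>2)" if "\<epsilon> > 0" for \<epsilon>
      unfolding sq using w_approx[OF that] .
    show "c * ((norm p)\<^sup>2 + (norm t)\<^sup>2) \<le> (l * q (t + s *\<^sub>R p) + L * q p) / 2" for p t
      unfolding sq by (rule H_lower)
  qed (use assms \<kappa> L q_cont in auto)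
  then show ?thesis by blast
qed

lemma hyp_H1_umin:
  assumes "hyp_H1 u" shows "umin u = u 0"
proof -
  have "0 \<in> (torus_box :: ((real^3) \<times> (real^3)) set)" by (simp add: torus_box_def)
  moreover have "u 0 \<le> u x" if "x \<in> torus_box" for x
    using assms that unfolding hyp_H1_def by (metis less_imp_le order_refl)
  ultimately show ?thesis unfolding umin_def by (intro cInf_eq_minimum) auto
qed

lemma hyp_H1_even_minimum:
  fixes u :: "(real^3) \<times> (real^3) \<Rightarrow> real"
  shows "hyp_H1 u \<Longrightarrow> even_minimum u 3"
proof -
  assume u: "hyp_H1 u"
  then have nd: "\<forall>v. (\<forall>c\<in>Basis. (\<Sum>b\<in>Basis. (v \<bullet> b) * ipartial u [b, c] 0) = 0) \<longrightarrow> v = 0"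
    unfolding hyp_H1_def by (elim conjE)
  show ?thesis
  proof
    show "C_k 3 u" "periodic_fun u" "u (- x) = u x" "x \<in> torus_box \<Longrightarrow> x \<noteq> 0 \<Longrightarrow> u 0 < u x" for x
      using u unfolding hyp_H1_def by blast+
    show "v = 0" if "\<And>c. c \<in> Basis \<Longrightarrow> (\<Sum>b\<in>Basis. (v \<bullet> b) * ipartial u [b, c] 0) = 0" for v
      using nd that by blast
  qed simp
qed

text \<open>For \<alpha> = 1 the parameter of \<open>u_sec\<close> is the second argument of u, so
  the variables trade places: the integration variable carries the coefficient l1 and the parameter
  l2. In the other case it is the reverse.\<close>

lemma hyp_H1_threshold:
  assumes u: "hyp_H1 u" and \<phi>: "hyp_H2 \<phi>"
  obtains q \<kappa> \<kappa>' l L s c C where "threshold q \<kappa> \<kappa>' (\<lambda>x. u_sec u \<alpha> (fst x) (snd x) - umin u) \<phi> l L s c C"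
proof -
  interpret even_minimum u 3 using hyp_H1_even_minimum[OF u] .
  obtain U l1 l2 l where U: "posdef3 U" "l1 > 0" "l2 > 0"
    "\<And>i j. ipartial u [(axis i 1, 0), (axis j 1, 0)] 0 = l1 * U $ i $ j"
    "\<And>i j. ipartial u [(axis i 1, 0), (0, axis j 1)] 0 = l * U $ i $ j"
    "\<And>i j. ipartial u [(0, axis i 1), (0, axis j 1)] 0 = l2 * U $ i $ j"
    using u unfolding hyp_H1_def by metis
  have bas: "(axis i 1, 0) \<in> (Basis :: ((real^3) \<times> (real^3)) set)" "(0, axis i 1) \<in> (Basis :: ((real^3) \<times> (real^3)) set)" for i
    by (auto simp: Basis_prod_def)
  \<comment> \<open>(H1) prescribes one of the two mixed blocks; the other follows by interchanging
    the derivatives.\<close>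
  have U5: "ipartial u [(0, axis j 1), (axis i 1, 0)] 0 = l * U $ i $ j" for i j
    using C_k_Schwarz[OF f bas(1)[of i] bas(2)[of j], of 0] U(5)[of i j] by simp
  \<comment> \<open>\<open>posdef3\<close> does not include symmetry; it comes from the equality of
    mixed derivatives, after division by l1 > 0.\<close>
  have Usym: "U $ i $ j = U $ j $ i" for i j
    using C_k_Schwarz[OF f bas(1)[of i] bas(1)[of j], of 0] U(4)[of i j] U(4)[of j i] U(2) by simp
  have sym: "x \<bullet> (U *v y) = y \<bullet> (U *v x)" for x y
    unfolding inner_matrix_vector by (subst sum.swap) (simp add: Usym mult_ac)
  define H where "H x = hessq u 0 x x" for x
  have H: "H (p, t) = l1 * (p \<bullet> (U *v p)) + 2 * l * (p \<bullet> (U *v t)) + l2 * (t \<bullet> (U *v t))" for p t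
  proof -
    have "H (p, t) = (\<Sum>i\<in>UNIV. \<Sum>j\<in>UNIV. p $ i * p $ j * (l1 * U $ i $ j)) + (\<Sum>i\<in>UNIV. \<Sum>j\<in>UNIV. p $ i * t $ j * (l * U $ i $ j))
      + ((\<Sum>i\<in>UNIV. \<Sum>j\<in>UNIV. t $ i * p $ j * (l * U $ j $ i)) + (\<Sum>i\<in>UNIV. \<Sum>j\<in>UNIV. t $ i * t $ j * (l2 * U $ i $ j)))"
      unfolding H_def hessq_def sum_Basis_vec_prod U(4-6) U5
      by (simp add: sum.distrib inner_axis del: ipartial.simps)
    also have "(\<Sum>i\<in>UNIV. \<Sum>j\<in>UNIV. t $ i * p $ j * (l * U $ j $ i)) = (\<Sum>i\<in>UNIV. \<Sum>j\<in>UNIV. p $ i * t $ j * (l * U $ i $ j))"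
      by (subst sum.swap) (simp add: mult_ac)
    finally show ?thesis unfolding inner_matrix_vector by (simp add: sum_distrib_left mult_ac)
  qed
  obtain c where c: "c > 0" "\<And>x. x \<in> ccube \<Longrightarrow> c * (norm x)\<^sup>2 \<le> u x - u 0" "\<And>v. c * (norm v)\<^sup>2 \<le> H v / 2"
    unfolding H_def by (rule quadratic_lower_bound) blast
  obtain R where R: "R > 0" "(ccube :: (real^3) set) \<subseteq> cball 0 R" by (rule ccube_subset_cball)
  obtain C where C: "C \<ge> 0"
    "\<And>x h. norm x \<le> R \<Longrightarrow> norm h \<le> R \<Longrightarrow> \<bar>u (x + h) - u x\<bar> \<le> C * norm h * (norm h + norm x)"
    "\<And>x h. norm x \<le> R \<Longrightarrow> norm h \<le> R \<Longrightarrow> \<bar>u (x + h) + u (x - h) - 2 * u x\<bar> \<le> C * (norm h)\<^sup>2"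
    by (rule difference_bounds) blast
  have nR: "norm x \<le> R" if "x \<in> (ccube :: (real^3) set)" for x using R(2) that by auto
  have apx: "\<exists>\<delta>>0. \<forall>p t. norm p < \<delta> \<longrightarrow> norm t < \<delta> \<longrightarrow>
       \<bar>u (p, t) - u 0 - H (p, t) / 2\<bar> \<le> \<epsilon> * ((norm p)\<^sup>2 + (norm t)\<^sup>2)" if \<epsilon>: "\<epsilon> > 0" for \<epsilon>
  proof -
    obtain \<delta> where \<delta>: "\<delta> > 0" "\<And>v. norm v < \<delta> \<Longrightarrow> \<bar>u v - u 0 - H v / 2\<bar> \<le> \<epsilon> * (norm v)\<^sup>2"
      unfolding H_def using approx[OF \<epsilon>] by blast
    show ?thesis
    proof (intro exI[of _ "\<delta> / 2"] conjI allI impI)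
      fix p t :: "real^3" assume "norm p < \<delta> / 2" "norm t < \<delta> / 2"
      then have "norm (p, t) < \<delta>" using norm_Pair_le[of p t] by linarith
      then show "\<bar>u (p, t) - u 0 - H (p, t) / 2\<bar> \<le> \<epsilon> * ((norm p)\<^sup>2 + (norm t)\<^sup>2)"
        using \<delta>(2)[of "(p, t)"] by (simp add: norm_Pair_sq)
    qed (use \<delta>(1) in simp)
  qed
  have cont2: "continuous_on UNIV (\<lambda>x. u (snd x, fst x))"
    by (intro continuous_on_compose2[OF cont] continuous_intros) auto
  show ?thesis
  proof (cases "\<alpha> = 1")
    case True
    have "\<exists>q \<kappa> \<kappa>' L s. threshold q \<kappa> \<kappa>' (\<lambda>x. u (snd x, fst x) - u 0) \<phi> l1 L s c C"
    proof (rule thresholdI[OF U(1) sym U(2) c(1) C(1), where H="\<lambda>x. H (snd x, fst x)" and a=l2 and b=l])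
      show "continuous_on UNIV (\<lambda>x. u (snd x, fst x) - u 0)" using cont2 by (intro continuous_intros)
      fix p t :: "real^3"
      show "u (snd (- p, - t), fst (- p, - t)) - u 0 = u (snd (p, t), fst (p, t)) - u 0" using even[of "(t, p)"] by simp
      show "H (snd (p, t), fst (p, t)) = l2 * (p \<bullet> (U *v p)) + 2 * l * (p \<bullet> (U *v t)) + l1 * (t \<bullet> (U *v t))"
        by (simp add: H sym[of t p])
      show "c * ((norm p)\<^sup>2 + (norm t)\<^sup>2) \<le> H (snd (p, t), fst (p, t)) / 2"
        using c(3)[of "(t, p)"] by (simp add: norm_Pair_sq add.commute)
      assume p: "p \<in> ccube" and t: "t \<in> ccube"
      show "c * ((norm p)\<^sup>2 + (norm t)\<^sup>2) \<le> u (snd (p, t), fst (p, t)) - u 0"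
        using c(2)[of "(t, p)"] p t by (simp add: norm_Pair_sq mem_ccube_Pair add.commute)
      show "\<bar>(u (snd (p, t), fst (p, t)) - u 0) - (u (snd (0, t), fst (0, t)) - u 0)\<bar> \<le> C * norm p * (norm p + norm t)"
        using C(2)[of "(t, 0)" "(0, p)"] nR[OF p] nR[OF t] by (simp add: norm_Pair)
      show "\<bar>(u (snd (p, t), fst (p, t)) - u 0) + (u (snd (- p, t), fst (- p, t)) - u 0) - 2 * (u (snd (0, t), fst (0, t)) - u 0)\<bar> \<le> C * (norm p)\<^sup>2"
        using C(3)[of "(t, 0)" "(0, p)"] nR[OF p] nR[OF t] by (simp add: norm_Pair)
    next
      show "\<exists>\<delta>>0. \<forall>p t. norm p < \<delta> \<longrightarrow> norm t < \<delta> \<longrightarrow>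
       \<bar>u (snd (p, t), fst (p, t)) - u 0 - H (snd (p, t), fst (p, t)) / 2\<bar> \<le> \<epsilon> * ((norm p)\<^sup>2 + (norm t)\<^sup>2)" if \<epsilon>: "\<epsilon> > 0" for \<epsilon>
      proof -
        obtain \<delta> where \<delta>: "\<delta> > 0" "\<And>p t. norm p < \<delta> \<Longrightarrow> norm t < \<delta> \<Longrightarrow>
            \<bar>u (p, t) - u 0 - H (p, t) / 2\<bar> \<le> \<epsilon> * ((norm p)\<^sup>2 + (norm t)\<^sup>2)"
          using apx[OF \<epsilon>] by blast
        show ?thesis
        proof (intro exI[of _ \<delta>] conjI allI impI)
          fix p t :: "real^3" assume "norm p < \<delta>" "norm t < \<delta>"
          from \<delta>(2)[OF this(2,1)]
          show "\<bar>u (snd (p, t), fst (p, t)) - u 0 - H (snd (p, t), fst (p, t)) / 2\<bar> \<le> \<epsilon> * ((norm p)\<^sup>2 + (norm t)\<^sup>2)"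
            unfolding fst_conv snd_conv by (simp only: add.commute)
        qed (rule \<delta>(1))
      qed
    qed (fact \<phi>)
    then obtain q \<kappa> \<kappa>' L s where T: "threshold q \<kappa> \<kappa>' (\<lambda>x. u (snd x, fst x) - u 0) \<phi> l1 L s c C" by blast
    have eq: "(\<lambda>x. u_sec u \<alpha> (fst x) (snd x) - umin u) = (\<lambda>x. u (snd x, fst x) - u 0)"
      using True by (simp add: u_sec_def hyp_H1_umin[OF u])
    show ?thesis by (rule that) (unfold eq, rule T)
  next
    case False
    have "\<exists>q \<kappa> \<kappa>' L s. threshold q \<kappa> \<kappa>' (\<lambda>x. u x - u 0) \<phi> l2 L s c C"
    proof (rule thresholdI[OF U(1) sym U(3) c(1) C(1), where H="H" and a=l1 and b=l])
      show "continuous_on UNIV (\<lambda>x. u x - u 0)" using cont by (intro continuous_intros)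
      fix p t :: "real^3"
      show "u (- p, - t) - u 0 = u (p, t) - u 0" using even[of "(p, t)"] by simp
      show "H (p, t) = l1 * (p \<bullet> (U *v p)) + 2 * l * (p \<bullet> (U *v t)) + l2 * (t \<bullet> (U *v t))"
        by (simp add: H)
      show "c * ((norm p)\<^sup>2 + (norm t)\<^sup>2) \<le> H (p, t) / 2"
        using c(3)[of "(p, t)"] by (simp add: norm_Pair_sq)
      assume p: "p \<in> ccube" and t: "t \<in> ccube"
      show "c * ((norm p)\<^sup>2 + (norm t)\<^sup>2) \<le> u (p, t) - u 0"
        using c(2)[of "(p, t)"] p t by (simp add: norm_Pair_sq mem_ccube_Pair)
      show "\<bar>(u (p, t) - u 0) - (u (0, t) - u 0)\<bar> \<le> C * norm p * (norm p + norm t)"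
        using C(2)[of "(0, t)" "(p, 0)"] nR[OF p] nR[OF t] by (simp add: norm_Pair)
      show "\<bar>(u (p, t) - u 0) + (u (- p, t) - u 0) - 2 * (u (0, t) - u 0)\<bar> \<le> C * (norm p)\<^sup>2"
        using C(3)[of "(0, t)" "(p, 0)"] nR[OF p] nR[OF t] by (simp add: norm_Pair)
    qed (use apx \<phi> in auto)
    then obtain q \<kappa> \<kappa>' L s where T: "threshold q \<kappa> \<kappa>' (\<lambda>x. u x - u 0) \<phi> l2 L s c C" by blast
    have eq: "(\<lambda>x. u_sec u \<alpha> (fst x) (snd x) - umin u) = (\<lambda>x. u x - u 0)"
      using False by (simp add: u_sec_def hyp_H1_umin[OF u])
    show ?thesis by (rule that) (unfold eq, rule T)
  qed
qed

section \<open>Half-open and closed cube up to null sets\<close>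

lemma torus_box_sets [measurable]: "torus_box \<in> sets borel"
proof -
  have "torus_box = (\<Inter>b\<in>Basis. {x::'a. - pi < x \<bullet> b} \<inter> {x. x \<bullet> b \<le> pi})"
    by (auto simp: torus_box_def)
  also have "\<dots> \<in> sets borel"
    by (intro sets.finite_INT sets.Int borel_open borel_closed open_Collect_less closed_Collect_le continuous_intros) auto
  finally show ?thesis .
qed

lemma box_subset_torus_box: "box (- pi *\<^sub>R One) (pi *\<^sub>R One) \<subseteq> torus_box"
  by (auto simp: torus_box_def mem_box less_imp_le)

lemma AE_torus_box_eq_ccube: "AE x in lborel. x \<in> torus_box \<longleftrightarrow> x \<in> ccube"
proof -
  let ?N = "cbox (- pi *\<^sub>R One) (pi *\<^sub>R One) - box (- pi *\<^sub>R One) (pi *\<^sub>R One) :: 'a set"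
  have "negligible ?N" by (rule negligible_frontier_interval)
  then have "?N \<in> null_sets lborel"
    by (subst (asm) negligible_iff_null_sets) (simp add: null_sets_completion_iff)
  then have "AE x in lborel. x \<notin> ?N" by (rule AE_not_in)
  then show ?thesis
    by eventually_elim (use box_subset_torus_box torus_box_subset_ccube in \<open>auto simp: ccube_def\<close>)
qed

lemma integral_lebesgue_on_borel:
  fixes f :: "'a::euclidean_space \<Rightarrow> real"
  assumes [measurable]: "f \<in> borel_measurable borel" "S \<in> sets borel"
  shows "(\<integral>x. f x \<partial>(lebesgue_on S)) = (\<integral>x. indicator S x * f x \<partial>lborel)"
proof -
  have "(\<integral>x. f x \<partial>(lebesgue_on S)) = (\<integral>x. indicator S x *\<^sub>R f x \<partial>(completion lborel))"
    using assms by (intro integral_restrict_space) auto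
  also have "\<dots> = (\<integral>x. indicator S x * f x \<partial>lborel)"
    by (subst integral_completion) auto
  finally show ?thesis .
qed

lemma (in threshold) Lam_eq_lebesgue:
  "(\<integral>t. (\<phi> t)\<^sup>2 / w (p, t) \<partial>(lebesgue_on torus_box)) = Lam p"
proof -
  have "(\<integral>t. (\<phi> t)\<^sup>2 / w (p, t) \<partial>(lebesgue_on torus_box)) = (\<integral>t. indicator torus_box t * ((\<phi> t)\<^sup>2 / w (p, t)) \<partial>lborel)"
    by (rule integral_lebesgue_on_borel) measurable
  also have "\<dots> = Lam p" unfolding Lam_def
    by (rule integral_cong_AE) (use AE_torus_box_eq_ccube in \<open>auto elim!: eventually_mono simp: indicator_def\<close>)
  finally show ?thesis .
qed

section \<open>Lebesgue measure on the torus\<close>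

text \<open>A density instead of a restricted space: all sets stay Borel sets of the whole space, and
  the product of two copies is again such a density.\<close>
definition TM :: "'a::euclidean_space measure" where
  "TM = density lborel (\<lambda>x. ennreal (indicator torus_box x))"

lemma sets_TM [simp, measurable_cong]: "sets TM = sets borel"
  by (simp add: TM_def)

lemma space_TM [simp]: "space TM = UNIV"
  by (simp add: TM_def)

lemma borel_measurable_TM [simp]: "borel_measurable TM = borel_measurable borel"
  by (rule measurable_cong_sets) simp_all

lemma AE_TM: "(AE x in TM. P x) \<longleftrightarrow> (AE x in lborel. x \<in> torus_box \<longrightarrow> P x)"
  unfolding TM_def by (subst AE_density) (auto simp: indicator_def)

lemma AE_TM_torus: "AE x in TM. x \<in> torus_box"
  by (simp add: AE_TM)

lemma AE_TM_nonzero: "AE x in TM. x \<noteq> 0"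
  unfolding AE_TM using AE_lborel_singleton[of 0] by eventually_elim simp

lemma AE_lebesgue_on_torus: "(AE x in lebesgue_on torus_box. P x) \<longleftrightarrow> (AE x in TM. P x)"
  by (subst AE_restrict_space_iff) (auto simp: AE_TM AE_completion_iff)

lemma integral_TM: "f \<in> borel_measurable borel \<Longrightarrow> integral\<^sup>L TM f = (\<integral>x. indicator torus_box x *\<^sub>R f x \<partial>lborel)"
  for f :: "'a::euclidean_space \<Rightarrow> 'b::euclidean_space"
  unfolding TM_def by (rule integral_density) auto

lemma integrable_TM: "f \<in> borel_measurable borel \<Longrightarrow> integrable TM f \<longleftrightarrow> integrable lborel (\<lambda>x. indicator torus_box x *\<^sub>R f x)"
  for f :: "'a::euclidean_space \<Rightarrow> 'b::euclidean_space"
  unfolding TM_def by (rule integrable_density) auto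

lemma integrable_TM_ccube:
  fixes f :: "'a::euclidean_space \<Rightarrow> real"
  assumes "f \<in> borel_measurable borel" "integrable lborel (\<lambda>x. indicator ccube x * f x)"
  shows "integrable TM f"
proof -
  have "AE x in lborel. indicator ccube x * f x = indicator torus_box x * f x"
    using AE_torus_box_eq_ccube by eventually_elim (simp add: indicator_def)
  from integrable_cong_AE_imp[OF assms(2) _ this] show ?thesis
    using assms(1) by (simp add: integrable_TM)
qed

lemma finite_measure_TM: "finite_measure (TM :: 'a::euclidean_space measure)"
proof
  have "emeasure (TM :: 'a measure) (space TM) = emeasure lborel (torus_box :: 'a set)"
    unfolding TM_def by (subst emeasure_density) (auto simp: ennreal_indicator)
  also have "\<dots> \<le> emeasure lborel (ccube :: 'a set)"
    by (intro emeasure_mono torus_box_subset_ccube) auto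
  also have "\<dots> < \<infinity>" by (intro emeasure_bounded_finite compact_imp_bounded compact_ccube)
  finally show "emeasure (TM :: 'a measure) (space TM) \<noteq> \<infinity>" by simp
qed

lemma sigma_finite_TM: "sigma_finite_measure (TM :: 'a::euclidean_space measure)"
  by (rule finite_measure.axioms(1)[OF finite_measure_TM])

lemma mem_torus_box_Pair: "(p, t) \<in> torus_box \<longleftrightarrow> p \<in> torus_box \<and> t \<in> torus_box"
  by (simp add: torus_box_def Basis_prod_def ball_Un)

text \<open>Identifies the abstract product in \<open>birman_schwinger\<close> with the measure on
  the six-dimensional torus, where the eigenfunctions live.\<close>

lemma TM_pair: "(TM :: 'a::euclidean_space measure) \<Otimes>\<^sub>M (TM :: 'b::euclidean_space measure) = TM"
proof -
  have "(TM :: 'a measure) \<Otimes>\<^sub>M (TM :: 'b measure) =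
      density (lborel \<Otimes>\<^sub>M lborel) (\<lambda>(x, y). ennreal (indicator torus_box x) * ennreal (indicator torus_box y))"
    using sigma_finite_TM[where 'a='b] unfolding TM_def
    by (intro pair_measure_density) (auto intro: lborel.sigma_finite_measure_axioms)
  also have "\<dots> = TM"
  proof -
    have "(\<lambda>(x, y). ennreal (indicator torus_box x) * ennreal (indicator torus_box y))
        = (\<lambda>z :: 'a \<times> 'b. ennreal (indicator torus_box z))"
      by (auto simp: fun_eq_iff indicator_def mem_torus_box_Pair)
    then show ?thesis unfolding lborel_prod TM_def by simp
  qed
  finally show ?thesis .
qed

text \<open>The bridge from integrals over \<open>lebesgue_on torus_box\<close> to Borel functions
  under \<open>TM\<close>. As f is only almost everywhere equal to a Borel function, its own
  measurability rests on the completeness of Lebesgue measure.\<close>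

lemma lebesgue_on_torus_conv:
  fixes f f' :: "'a::euclidean_space \<Rightarrow> 'b::euclidean_space"
  assumes f'[measurable]: "f' \<in> borel_measurable borel" and eq: "AE x in TM. f x = f' x"
  shows "f \<in> borel_measurable (lebesgue_on torus_box)"
    and "integrable (lebesgue_on torus_box) f \<longleftrightarrow> integrable TM f'"
    and "integral\<^sup>L (lebesgue_on torus_box) f = integral\<^sup>L TM f'"
proof -
  have ae: "AE x in lebesgue. indicator torus_box x *\<^sub>R f' x = indicator torus_box x *\<^sub>R f x"
    by (rule AE_completion, use eq[unfolded AE_TM] in eventually_elim) (auto simp: indicator_def)
  have m': "(\<lambda>x. indicator torus_box x *\<^sub>R f' x) \<in> borel_measurable lborel" by measurable
  then have m'': "(\<lambda>x. indicator torus_box x *\<^sub>R f' x) \<in> borel_measurable lebesgue"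
    by (rule measurable_completion)
  then have m: "(\<lambda>x. indicator torus_box x *\<^sub>R f x) \<in> borel_measurable lebesgue"
    using ae by (rule borel_measurable_AE)
  then show "f \<in> borel_measurable (lebesgue_on torus_box)"
    by (subst borel_measurable_restrict_space_iff) auto
  have "integrable (lebesgue_on torus_box) f \<longleftrightarrow> integrable lebesgue (\<lambda>x. indicator torus_box x *\<^sub>R f x)"
    by (rule integrable_restrict_space) simp
  also have "\<dots> \<longleftrightarrow> integrable lebesgue (\<lambda>x. indicator torus_box x *\<^sub>R f' x)"
    using ae m m'' by (intro integrable_cong_AE) auto
  also have "\<dots> \<longleftrightarrow> integrable TM f'"
    using m' by (simp add: integrable_completion integrable_TM)
  finally show "integrable (lebesgue_on torus_box) f \<longleftrightarrow> integrable TM f'" .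
  have "integral\<^sup>L (lebesgue_on torus_box) f = integral\<^sup>L lebesgue (\<lambda>x. indicator torus_box x *\<^sub>R f x)"
    by (rule integral_restrict_space) simp
  also have "\<dots> = integral\<^sup>L lebesgue (\<lambda>x. indicator torus_box x *\<^sub>R f' x)"
    using ae m m'' by (intro integral_cong_AE) auto
  also have "\<dots> = integral\<^sup>L TM f'"
    using m' by (simp add: integral_completion integral_TM)
  finally show "integral\<^sup>L (lebesgue_on torus_box) f = integral\<^sup>L TM f'" .
qed

lemma lebesgue_on_torus_real_representative:
  fixes f :: "'a::euclidean_space \<Rightarrow> real"
  assumes "f \<in> borel_measurable (lebesgue_on torus_box)"
  obtains f' where "f' \<in> borel_measurable borel" "AE x in TM. f x = f' x"
proof -
  have "(\<lambda>x. if x \<in> torus_box then f x else 0) \<in> borel_measurable (completion lborel)"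
    using assms by (rule borel_measurable_if_I) simp
  then obtain g where g: "g \<in> borel_measurable lborel" "AE x in lborel. (if x \<in> torus_box then f x else 0) = g x"
    using completion_ex_borel_measurable_real by blast
  show ?thesis
    using g(1) by (intro that[of g]) (use g(2) in \<open>auto simp: AE_TM elim!: eventually_mono\<close>)
qed

lemma lebesgue_on_torus_complex_representative:
  fixes f :: "'a::euclidean_space \<Rightarrow> complex"
  assumes f: "f \<in> borel_measurable (lebesgue_on torus_box)"
  obtains a b where "a \<in> borel_measurable borel" "b \<in> borel_measurable borel"
    "AE x in TM. f x = Complex (a x) (b x)"
proof -
  have "(\<lambda>x. Re (f x)) \<in> borel_measurable (lebesgue_on torus_box)" "(\<lambda>x. Im (f x)) \<in> borel_measurable (lebesgue_on torus_box)"
    using f by measurable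
  note m = this
  obtain a where a: "a \<in> borel_measurable borel" "AE x in TM. Re (f x) = a x"
    using lebesgue_on_torus_real_representative[OF m(1)] by blast
  obtain b where b: "b \<in> borel_measurable borel" "AE x in TM. Im (f x) = b x"
    using lebesgue_on_torus_real_representative[OF m(2)] by blast
  have "AE x in TM. f x = Complex (a x) (b x)"
    using a(2) b(2) by eventually_elim (simp add: complex_eq_iff)
  with a b that show ?thesis by blast
qed

section \<open>Square integrability of the kernel\<close>

text \<open>Dominated convergence with a multiple of 1/|t|^2 as majorant. Continuity is what allows
  the gap to be extended from a neighbourhood of 0 to the cube by compactness.\<close>

lemma (in threshold) Lam_continuous: "continuous_on ccube Lam"
proof (rule continuous_on_sequentiallyI)
  fix x :: "nat \<Rightarrow> real^3" and a assume x: "\<forall>n. x n \<in> ccube" and a: "a \<in> ccube" and lim: "x \<longlonglongrightarrow> a"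
  obtain \<Phi> where \<Phi>: "\<Phi> \<ge> 0" "\<And>t. t \<in> ccube \<Longrightarrow> (\<phi> t)\<^sup>2 \<le> \<Phi>" by (rule \<phi>_bound) blast
  show "(\<lambda>n. Lam (x n)) \<longlonglongrightarrow> Lam a"
    unfolding Lam_def
  proof (rule integral_dominated_convergence[where w="\<lambda>t. \<Phi> / c * (indicator ccube t * (1 / (norm t)\<^sup>2))"])
    show "integrable lborel (\<lambda>t::real^3. \<Phi> / c * (indicator ccube t * (1 / (norm t)\<^sup>2)))"
      by (intro integrable_mult_right inverse_square_integrable)
    show "AE t in lborel. (\<lambda>n. indicator ccube t * ((\<phi> t)\<^sup>2 / w (x n, t))) \<longlonglongrightarrow> indicator ccube t * ((\<phi> t)\<^sup>2 / w (a, t))"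
      using AE_lborel_singleton[of 0]
    proof eventually_elim
      case (elim t)
      show ?case
      proof (cases "t \<in> ccube")
        case True
        have "isCont w (a, t)" using w_cont by (simp add: continuous_on_eq_continuous_at)
        then have "(\<lambda>n. w (x n, t)) \<longlonglongrightarrow> w (a, t)"
          by (rule isCont_tendsto_compose) (intro tendsto_Pair lim tendsto_const)
        then show ?thesis
          using w_pos[OF a True elim] by (intro tendsto_intros) auto
      qed simp
    qed
    show "AE t in lborel. norm (indicator ccube t * ((\<phi> t)\<^sup>2 / w (x n, t))) \<le> \<Phi> / c * (indicator ccube t * (1 / (norm t)\<^sup>2))" for n
      using AE_lborel_singleton[of 0]
    proof eventually_elim
      case (elim t)
      have xn: "x n \<in> ccube" using x by simp
      show ?case
      proof (cases "t \<in> ccube")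
        case True
        have "(\<phi> t)\<^sup>2 * (1 / w (x n, t)) \<le> \<Phi> * (1 / c * (1 / (norm t)\<^sup>2))"
          using inverse_w_le[OF xn True] w_pos[OF xn True] elim \<Phi> True by (intro mult_mono) (auto simp: less_imp_le)
        then show ?thesis using True w_pos[OF xn True elim] by simp
      qed simp
    qed
  qed measurable
qed

text \<open>Away from the origin the quotient of the gap by |p|^k attains a positive minimum. The
  exponent is 1 when \<phi> does not vanish at 0 and 2 when it does.\<close>

lemma (in threshold) gap_on_ccube:
  assumes less: "\<And>p. p \<in> ccube \<Longrightarrow> p \<noteq> 0 \<Longrightarrow> Lam p < Lam 0"
    and near: "c0 > 0" "\<delta> > 0" "\<And>p. norm p < \<delta> \<Longrightarrow> c0 * norm p ^ k \<le> Lam 0 - Lam p"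
  shows "\<exists>c1>0. \<forall>p\<in>ccube. c1 * norm p ^ k \<le> Lam 0 - Lam p"
proof -
  define S where "S = (ccube :: (real^3) set) - ball 0 \<delta>"
  have S: "compact S" unfolding S_def by (intro compact_diff compact_ccube open_ball)
  have "\<exists>c>0. \<forall>x\<in>S. c * norm x ^ k \<le> Lam 0 - Lam x"
  proof (cases "S = {}")
    case False
    have "continuous_on S (\<lambda>x. (Lam 0 - Lam x) / norm x ^ k)"
      using near(2) by (intro continuous_intros continuous_on_subset[OF Lam_continuous]) (auto simp: S_def)
    then obtain x0 where x0: "x0 \<in> S" "\<And>x. x \<in> S \<Longrightarrow> (Lam 0 - Lam x0) / norm x0 ^ k \<le> (Lam 0 - Lam x) / norm x ^ k"
      using continuous_attains_inf[OF S False] by blast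
    have "x0 \<noteq> 0" "x0 \<in> ccube" using x0(1) near(2) by (auto simp: S_def)
    then have "(Lam 0 - Lam x0) / norm x0 ^ k > 0" using less[of x0] by simp
    moreover have "(Lam 0 - Lam x0) / norm x0 ^ k * norm x ^ k \<le> Lam 0 - Lam x" if "x \<in> S" for x
    proof -
      have "norm x > 0" using that near(2) by (auto simp: S_def)
      then show ?thesis using x0(2)[OF that] by (subst (asm) pos_le_divide_eq) auto
    qed
    ultimately show ?thesis by blast
  qed (auto intro: exI[of _ 1])
  then obtain c where c: "c > 0" "\<And>x. x \<in> S \<Longrightarrow> c * norm x ^ k \<le> Lam 0 - Lam x" by blast
  show ?thesis
  proof (intro exI[of _ "min c c0"] conjI ballI)
    show "min c c0 > 0" using c near by simp
    fix p :: "real^3" assume p: "p \<in> ccube"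
    have m: "min c c0 * norm p ^ k \<le> c * norm p ^ k" "min c c0 * norm p ^ k \<le> c0 * norm p ^ k"
      by (intro mult_right_mono; simp)+
    show "min c c0 * norm p ^ k \<le> Lam 0 - Lam p"
    proof (cases "norm p < \<delta>")
      case True
      then show ?thesis using near(3)[OF True] m(2) by linarith
    next
      case False
      then have "p \<in> S" using p by (simp add: S_def)
      then show ?thesis using c(2)[of p] m(1) by linarith
    qed
  qed
qed

text \<open>Supplies \<phi> = O(|p|) when \<phi> vanishes at 0: the mean value theorem along the
  segment from 0, which stays in the cube.\<close>

lemma C_k_bound_at_zero:
  fixes f :: "'a::euclidean_space \<Rightarrow> real"
  assumes f: "C_k k f" "1 \<le> k"
  obtains B where "B \<ge> 0" "\<And>p. p \<in> ccube \<Longrightarrow> \<bar>f p - f 0\<bar> \<le> B * norm p"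
proof -
  have "\<exists>B. \<forall>y\<in>ccube. \<bar>ipartial f [b] y\<bar> \<le> B" if "b \<in> Basis" for b
  proof -
    have "continuous_on ccube (ipartial f [b])"
      using C_k_continuous[OF f(1), of "[b]"] that f(2) continuous_on_subset by (auto simp del: ipartial.simps)
    then have "bounded (ipartial f [b] ` ccube)"
      by (intro compact_imp_bounded compact_continuous_image compact_ccube)
    then show ?thesis by (auto simp: bounded_iff simp del: ipartial.simps)
  qed
  then obtain B where B: "\<And>b y. b \<in> Basis \<Longrightarrow> y \<in> ccube \<Longrightarrow> \<bar>ipartial f [b] y\<bar> \<le> B b"
    by metis
  have z: "(0::'a) \<in> ccube" by (simp add: mem_ccube)
  have B0: "B b \<ge> 0" if "b \<in> Basis" for b using B[OF that z] by linarith
  show ?thesis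
  proof (rule that[of "\<Sum>b\<in>Basis. B b"])
    show "0 \<le> (\<Sum>b\<in>Basis. B b)" using B0 by (intro sum_nonneg) auto
    fix p :: 'a assume p: "p \<in> ccube"
    have "\<exists>t. 0 < t \<and> t < 1 \<and> ipartial f [] (0 + 1 *\<^sub>R p) - ipartial f [] (0 + 0 *\<^sub>R p) =
      (1 - 0) * (\<Sum>c\<in>Basis. (p \<bullet> c) * ipartial f [c] (0 + t *\<^sub>R p))"
      using ipartial_line_DERIV[OF f(1), of "[]" 0 p] f(2) by (intro MVT2) (auto simp del: ipartial.simps)
    then obtain t where t: "0 < t" "t < 1" and eq: "ipartial f [] p - ipartial f [] 0 = (\<Sum>c\<in>Basis. (p \<bullet> c) * ipartial f [c] (t *\<^sub>R p))"
      by (auto simp del: ipartial.simps)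
    have tp: "t *\<^sub>R p \<in> ccube"
      unfolding mem_ccube
    proof
      fix b :: 'a assume b: "b \<in> Basis"
      have "\<bar>(t *\<^sub>R p) \<bullet> b\<bar> = t * \<bar>p \<bullet> b\<bar>" using t by (simp add: abs_mult)
      also have "\<dots> \<le> \<bar>p \<bullet> b\<bar>" using t by (intro mult_left_le_one_le) auto
      also have "\<dots> \<le> pi" using p b by (simp add: mem_ccube)
      finally show "\<bar>(t *\<^sub>R p) \<bullet> b\<bar> \<le> pi" .
    qed
    have "\<bar>f p - f 0\<bar> = \<bar>\<Sum>c\<in>Basis. (p \<bullet> c) * ipartial f [c] (t *\<^sub>R p)\<bar>" using eq by simp
    also have "\<dots> \<le> (\<Sum>c\<in>Basis. norm p * B c)"
      by (intro order_trans[OF sum_abs] sum_mono, unfold abs_mult, intro mult_mono B Basis_le_norm)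
         (use tp in \<open>auto simp del: ipartial.simps\<close>)
    finally show "\<bar>f p - f 0\<bar> \<le> (\<Sum>b\<in>Basis. B b) * norm p" by (simp add: sum_distrib_left mult.commute)
  qed
qed

text \<open>The quadratic gap of (H3) alone would leave the kernel logarithmically divergent in
  \<open>L\<^sub>2\<close>; when \<open>\<phi> 0 \<noteq> 0\<close> the threshold resonance makes the gap linear.\<close>
lemma hyp_gap:
  assumes u: "hyp_H1 u" and \<phi>: "hyp_H2 \<phi>" and H3: "hyp_H3 u \<phi> \<alpha>"
  defines "k \<equiv> if \<phi> 0 = 0 then 1 else (0::nat)"
  obtains c B where "c > 0" "B > 0" "\<And>p. p \<in> ccube \<Longrightarrow> \<bar>\<phi> p\<bar> \<le> B * norm p ^ k"
    "\<And>p. p \<in> ccube \<Longrightarrow> c * norm p ^ (1 + k) \<le> Lambda u \<phi> \<alpha> 0 (umin u) - Lambda u \<phi> \<alpha> p (umin u)"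
proof -
  obtain q \<kappa> \<kappa>' l L s c C where T: "threshold q \<kappa> \<kappa>' (\<lambda>x. u_sec u \<alpha> (fst x) (snd x) - umin u) \<phi> l L s c C"
    using hyp_H1_threshold[OF u \<phi>] by blast
  interpret threshold q \<kappa> \<kappa>' "\<lambda>x. u_sec u \<alpha> (fst x) (snd x) - umin u" \<phi> l L s c C by (fact T)
  have Lam: "Lambda u \<phi> \<alpha> p (umin u) = Lam p" for p
    using Lam_eq_lebesgue[of p] by (simp add: Lambda_def)
  have per_u: "periodic_fun u" using u unfolding hyp_H1_def by blast
  \<comment> \<open>(H3) speaks of the half-open cube; periodicity in the parameter carries the
    strict maximum over to the closed one, where compactness is available.\<close>
  have per: "periodic_fun (\<lambda>p. Lambda u \<phi> \<alpha> p (umin u))"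
    unfolding periodic_fun_def
  proof (intro allI ballI)
    fix p b :: "real^3" assume b: "b \<in> Basis"
    have "(b, 0) \<in> (Basis :: ((real^3) \<times> (real^3)) set)" "(0, b) \<in> (Basis :: ((real^3) \<times> (real^3)) set)"
      using b by (auto simp: Basis_prod_def)
    then have "u ((x, t) + (2 * pi) *\<^sub>R (b, 0)) = u (x, t)" "u ((x, t) + (2 * pi) *\<^sub>R (0, b)) = u (x, t)" for x t
      using per_u unfolding periodic_fun_def by blast+
    then have "u_sec u \<alpha> (p + (2 * pi) *\<^sub>R b) t = u_sec u \<alpha> p t" for t
      by (simp add: u_sec_def)
    then show "Lambda u \<phi> \<alpha> (p + (2 * pi) *\<^sub>R b) (umin u) = Lambda u \<phi> \<alpha> p (umin u)"
      by (simp add: Lambda_def)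
  qed
  have less: "Lam p < Lam 0" if p: "p \<in> ccube" "p \<noteq> 0" for p
  proof -
    obtain y where y: "y \<in> torus_box" "y \<noteq> 0" "Lam y = Lam p"
      by (rule ccube_representative[OF per p, unfolded Lam])
    have "\<And>p. p \<in> torus_box \<Longrightarrow> p \<noteq> 0 \<Longrightarrow> Lam p < Lam 0"
      using H3 unfolding hyp_H3_def Lam by blast
    from this[OF y(1,2)] show ?thesis using y(3) by simp
  qed
  have near: "\<exists>c0>0. \<exists>\<delta>>0. \<forall>p. norm p < \<delta> \<longrightarrow> c0 * norm p ^ (1 + k) \<le> Lam 0 - Lam p"
  proof (cases "\<phi> 0 = 0")
    case True
    obtain c \<delta> where c: "c > 0" "\<delta> > 0" "\<And>p. p \<in> torus_box \<Longrightarrow> p \<noteq> 0 \<Longrightarrow> norm p < \<delta> \<Longrightarrow> Lam 0 - Lam p > c * (norm p)\<^sup>2"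
      using H3 unfolding hyp_H3_def Lam by blast
    have "c * norm p ^ (1 + k) \<le> Lam 0 - Lam p" if p: "norm p < min \<delta> pi" for p
    proof (cases "p = 0")
      case False
      have "p \<in> torus_box" unfolding torus_box_def
      proof (intro CollectI ballI)
        fix b :: "real^3" assume "b \<in> Basis"
        then have "\<bar>p \<bullet> b\<bar> < pi" using Basis_le_norm[of b p] p by simp
        then show "- pi < p \<bullet> b \<and> p \<bullet> b \<le> pi" by linarith
      qed
      then show ?thesis using c(3)[of p] False p True by (simp add: k_def power2_eq_square)
    qed (simp add: k_def)
    then show ?thesis using c(1,2) by (intro exI[of _ c] conjI exI[of _ "min \<delta> pi"]) auto
  next
    case False
    obtain g \<delta> where "g > 0" "\<delta> > 0" "\<And>p. norm p < \<delta> \<Longrightarrow> g * norm p \<le> Lam 0 - Lam p"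
      by (rule linear_gap[OF False]) blast
    then show ?thesis using False by (intro exI[of _ g] conjI exI[of _ \<delta>]) (auto simp: k_def)
  qed
  then obtain c0 \<delta> where c0: "c0 > 0" "\<delta> > 0" "\<And>p. norm p < \<delta> \<Longrightarrow> c0 * norm p ^ (1 + k) \<le> Lam 0 - Lam p" by blast
  obtain c1 where c1: "c1 > 0" "\<And>p. p \<in> ccube \<Longrightarrow> c1 * norm p ^ (1 + k) \<le> Lam 0 - Lam p"
    using gap_on_ccube[OF less c0] by blast
  obtain B where B: "B > 0" "\<And>p. p \<in> ccube \<Longrightarrow> \<bar>\<phi> p\<bar> \<le> B * norm p ^ k"
  proof (cases "\<phi> 0 = 0")
    case True
    have "C_k 2 \<phi>" using \<phi> by (simp add: hyp_H2_def)
    then obtain B where "B \<ge> 0" "\<And>p. p \<in> ccube \<Longrightarrow> \<bar>\<phi> p - \<phi> 0\<bar> \<le> B * norm p"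
      using C_k_bound_at_zero[of 2 \<phi>] by (metis one_le_numeral)
    note B = this
    have "\<bar>\<phi> p\<bar> \<le> (B + 1) * norm p ^ k" if "p \<in> ccube" for p
    proof -
      have "B * norm p \<le> (B + 1) * norm p" by (simp add: mult_right_mono)
      then show ?thesis using B(2)[OF that] True by (simp add: k_def)
    qed
    then show ?thesis using that[of "B + 1"] B(1) by simp
  next
    case False
    obtain \<Phi> where \<Phi>: "\<Phi> \<ge> 0" "\<And>t. t \<in> ccube \<Longrightarrow> (\<phi> t)\<^sup>2 \<le> \<Phi>" by (rule \<phi>_bound) blast
    have "\<bar>\<phi> p\<bar> \<le> (\<Phi> + 1) * norm p ^ k" if "p \<in> ccube" for p
    proof -
      have "\<bar>\<phi> p\<bar>\<^sup>2 \<le> (\<Phi> + 1)\<^sup>2" 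
      proof -
        have "(\<Phi> + 1)\<^sup>2 = \<Phi>\<^sup>2 + 2 * \<Phi> + 1" by (simp add: power2_eq_square algebra_simps)
        then show ?thesis unfolding power2_abs using \<Phi>(2)[OF that] \<Phi>(1) zero_le_power2[of \<Phi>] by linarith
      qed
      then have "\<bar>\<phi> p\<bar> \<le> \<Phi> + 1" by (rule power2_le_imp_le) (use \<Phi> in simp)
      then show ?thesis using False by (simp add: k_def)
    qed
    then show ?thesis using that[of "\<Phi> + 1"] \<Phi>(1) by simp
  qed
  show ?thesis using that[OF c1(1) B(1)] B(2) c1(2) by (simp add: Lam)
qed

text \<open>If exactly one exponent k is 1, both sides have degree -5. If both are 1, the left side
  has degree -4, and the surplus factor sqrt(P Q) <= R is absorbed by 1 + R.\<close>

lemma kernel_pointwise: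
  fixes P Q R :: real
  assumes P: "0 < P" "P \<le> R" and Q: "0 < Q" "Q \<le> R" and k: "k1 \<le> 1" "k2 \<le> 1" "1 \<le> k1 + (k2::nat)"
  shows "P ^ (2 * k1) * Q ^ (2 * k2) / ((P\<^sup>2 + Q\<^sup>2)\<^sup>2 * Q ^ (1 + k1) * P ^ (1 + k2)) \<le> (1 + R) * (P powr - (5/2) * Q powr - (5/2))"
proof -
  define S where "S = P\<^sup>2 + Q\<^sup>2"
  have S: "S > 0" using P by (simp add: S_def add_pos_nonneg)
  have pw: "x powr - (5/2) = 1 / (x\<^sup>2 * sqrt x)" if "x > 0" for x :: real
  proof -
    have "x powr (5/2) = x powr (2 + 1/2)" by simp
    also have "\<dots> = x\<^sup>2 * sqrt x" using that by (subst powr_add) (simp add: powr_half_sqrt)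
    finally show ?thesis by (simp add: powr_minus_divide)
  qed
  have PQ: "P * Q \<le> S / 2" using sum_squares_bound[of P Q] by (simp add: S_def)
  have r: "sqrt P * sqrt Q \<le> (P + Q) / 2" using arith_geo_mean_sqrt[of P Q] P Q by (simp add: real_sqrt_mult)
  \<comment> \<open>Both sides have degree 4; the arithmetic-geometric mean inequality removes the
    root. Stated for arbitrary P and Q because the second case exchanges them.\<close>
  have key: "P ^ 3 * (sqrt P * sqrt Q) \<le> S\<^sup>2" if "0 < P" "0 < Q" "S = P\<^sup>2 + Q\<^sup>2" "P * Q \<le> S / 2" "sqrt P * sqrt Q \<le> (P + Q) / 2" for P Q
  proof -
    have "P ^ 3 * (sqrt P * sqrt Q) \<le> P ^ 3 * ((P + Q) / 2)" using that by (intro mult_left_mono) auto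
    also have "\<dots> = (P\<^sup>2 * P\<^sup>2 + P\<^sup>2 * (P * Q)) / 2" by (simp add: power2_eq_square power3_eq_cube algebra_simps)
    also have "\<dots> \<le> (S * S + S * S) / 2"
      using that S by (intro divide_right_mono add_mono mult_mono) auto
    also have "\<dots> = S\<^sup>2" by (simp add: power2_eq_square)
    finally show ?thesis .
  qed
  have sq: "sqrt P > 0" "sqrt Q > 0" using P Q by auto
  consider "k1 = 1" "k2 = 0" | "k1 = 0" "k2 = 1" | "k1 = 1" "k2 = 1" using k by linarith
  then have "P ^ (2 * k1) * Q ^ (2 * k2) / (S\<^sup>2 * Q ^ (1 + k1) * P ^ (1 + k2)) \<le> (1 + R) * (1 / (P\<^sup>2 * sqrt P) * (1 / (Q\<^sup>2 * sqrt Q)))"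
  proof cases
    case 1
    have "P ^ (2 * k1) * Q ^ (2 * k2) / (S\<^sup>2 * Q ^ (1 + k1) * P ^ (1 + k2)) = P ^ 3 * (sqrt P * sqrt Q) / (S\<^sup>2 * (P\<^sup>2 * sqrt P * (Q\<^sup>2 * sqrt Q)))"
      using 1 P Q S sq by (simp add: power2_eq_square power3_eq_cube field_simps)
    also have "\<dots> \<le> S\<^sup>2 / (S\<^sup>2 * (P\<^sup>2 * sqrt P * (Q\<^sup>2 * sqrt Q)))"
      using key[OF P(1) Q(1) S_def PQ r] S P Q by (intro divide_right_mono) auto
    also have "\<dots> = 1 * (1 / (P\<^sup>2 * sqrt P) * (1 / (Q\<^sup>2 * sqrt Q)))" using S by simp
    also have "\<dots> \<le> (1 + R) * (1 / (P\<^sup>2 * sqrt P) * (1 / (Q\<^sup>2 * sqrt Q)))"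
      using P Q by (intro mult_right_mono) auto
    finally show ?thesis .
  next
    case 2
    have "P ^ (2 * k1) * Q ^ (2 * k2) / (S\<^sup>2 * Q ^ (1 + k1) * P ^ (1 + k2)) = Q ^ 3 * (sqrt Q * sqrt P) / (S\<^sup>2 * (P\<^sup>2 * sqrt P * (Q\<^sup>2 * sqrt Q)))"
      using 2 P Q S sq by (simp add: power2_eq_square power3_eq_cube field_simps)
    also have "\<dots> \<le> S\<^sup>2 / (S\<^sup>2 * (P\<^sup>2 * sqrt P * (Q\<^sup>2 * sqrt Q)))"
      using key[of Q P] S_def PQ r S P Q by (intro divide_right_mono) (auto simp: mult.commute add.commute)
    also have "\<dots> = 1 * (1 / (P\<^sup>2 * sqrt P) * (1 / (Q\<^sup>2 * sqrt Q)))" using S by simp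
    also have "\<dots> \<le> (1 + R) * (1 / (P\<^sup>2 * sqrt P) * (1 / (Q\<^sup>2 * sqrt Q)))"
      using P Q by (intro mult_right_mono) auto
    finally show ?thesis .
  next
    case 3
    have "P ^ (2 * k1) * Q ^ (2 * k2) / (S\<^sup>2 * Q ^ (1 + k1) * P ^ (1 + k2)) = (P\<^sup>2 * Q\<^sup>2) * (sqrt P * sqrt Q) / (S\<^sup>2 * (P\<^sup>2 * sqrt P * (Q\<^sup>2 * sqrt Q)))"
      using 3 P Q S sq by (simp add: power2_eq_square field_simps)
    also have "\<dots> \<le> (S * S) * (1 + R) / (S\<^sup>2 * (P\<^sup>2 * sqrt P * (Q\<^sup>2 * sqrt Q)))"
    proof (intro divide_right_mono mult_mono)
      show "sqrt P * sqrt Q \<le> 1 + R" by (rule order_trans[OF r]) (use P Q in simp)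
    qed (use S P Q in \<open>auto simp: S_def\<close>)
    also have "\<dots> = (1 + R) * (1 / (P\<^sup>2 * sqrt P) * (1 / (Q\<^sup>2 * sqrt Q)))" using S by (simp add: power2_eq_square)
    finally show ?thesis .
  qed
  then show ?thesis using P Q by (simp add: pw S_def)
qed

locale lattice_model =
  fixes u :: "(real^3) \<times> (real^3) \<Rightarrow> real" and \<phi>1 \<phi>2 :: "real^3 \<Rightarrow> real" and \<mu>1 \<mu>2 :: real
  assumes u: "hyp_H1 u" and \<phi>1: "hyp_H2 \<phi>1" and \<phi>2: "hyp_H2 \<phi>2"
    and H31: "hyp_H3 u \<phi>1 1" and H32: "hyp_H3 u \<phi>2 2"
    and \<mu>1_pos: "\<mu>1 > 0" and \<mu>2_pos: "\<mu>2 > 0"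
    and \<mu>1: "\<mu>1 = mu0 u \<phi>1 1" and \<mu>2: "\<mu>2 = mu0 u \<phi>2 2"
    and \<phi>0: "\<phi>1 0 * \<phi>2 0 = 0"
begin

text \<open>Cut off outside the fundamental domain so that \<open>w\<close> is nonnegative and bounded everywhere.\<close>
definition w :: "(real^3) \<times> (real^3) \<Rightarrow> real" where
  "w z = indicator torus_box z * (u z - umin u)"

definition "Lam1 q = (\<integral>t. (\<phi>1 t)\<^sup>2 / w (t, q) \<partial>TM)"
definition "Lam2 p = (\<integral>t. (\<phi>2 t)\<^sup>2 / w (p, t) \<partial>TM)"

lemma u_cont: "continuous_on UNIV u"
  using u C_k_continuous[of 3 u "[]"] by (simp add: hyp_H1_def)

lemma \<phi>_cont: "continuous_on UNIV \<phi>1" "continuous_on UNIV \<phi>2"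
  using \<phi>1 \<phi>2 C_k_continuous[of 2 \<phi>1 "[]"] C_k_continuous[of 2 \<phi>2 "[]"] by (simp_all add: hyp_H2_def)

lemma u_meas [measurable]: "u \<in> borel_measurable borel"
  by (rule borel_measurable_continuous_onI[OF u_cont])

lemma \<phi>_borel [measurable]: "\<phi>1 \<in> borel_measurable borel" "\<phi>2 \<in> borel_measurable borel"
  by (rule borel_measurable_continuous_onI, rule \<phi>_cont)+

lemma w_borel [measurable]: "w \<in> borel_measurable borel"
  unfolding w_def[abs_def] by measurable

lemma u_gt: "z \<in> torus_box \<Longrightarrow> z \<noteq> 0 \<Longrightarrow> umin u < u z"
  using u hyp_H1_umin[OF u] unfolding hyp_H1_def by simp

lemma w_ge0: "0 \<le> w z"
  using u_gt[of z] hyp_H1_umin[OF u] by (cases "z = 0") (auto simp: w_def indicator_def less_imp_le)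

lemma w_bounded: "\<exists>W. \<forall>z. w z \<le> W"
proof -
  obtain B where B: "B > 0" "\<And>x. x \<in> ccube \<Longrightarrow> \<bar>u x\<bar> \<le> B" by (rule bounded_on_ccube[OF u_cont]) blast
  have "w z \<le> B + \<bar>umin u\<bar>" for z
    using B(2)[of z] B(1) torus_box_subset_ccube by (auto simp: w_def indicator_def subset_iff)
  then show ?thesis by blast
qed

text \<open>A closed term for the upper bound of \<open>w\<close>, as an argument of the
  interpretation \<open>bs\<close>.\<close>

definition "W = (SOME W. \<forall>z. w z \<le> W)"

lemma w_W: "w z \<le> W"
  using someI_ex[OF w_bounded] unfolding W_def by blast

lemma w_lower: "\<exists>c>0. \<forall>z\<in>torus_box. c * (norm z)\<^sup>2 \<le> w z"
proof -
  interpret even_minimum u 3 by (rule hyp_H1_even_minimum[OF u])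
  obtain c where "c > 0" "\<And>x. x \<in> ccube \<Longrightarrow> c * (norm x)\<^sup>2 \<le> u x - u 0" by (rule quadratic_lower_bound) blast
  then show ?thesis using torus_box_subset_ccube
    by (intro exI[of _ c]) (auto simp: w_def hyp_H1_umin[OF u] subset_iff)
qed

lemma Lambda_TM:
  fixes \<alpha> :: nat
  assumes \<phi>: "hyp_H2 \<phi>" and [measurable]: "\<phi> \<in> borel_measurable borel" and p: "p \<in> torus_box"
  shows "\<alpha> = 1 \<Longrightarrow> integrable TM (\<lambda>t. (\<phi> t)\<^sup>2 / w (t, p))"
    "\<alpha> = 1 \<Longrightarrow> (\<integral>t. (\<phi> t)\<^sup>2 / w (t, p) \<partial>TM) = Lambda u \<phi> 1 p (umin u)"
    "\<alpha> = 2 \<Longrightarrow> integrable TM (\<lambda>t. (\<phi> t)\<^sup>2 / w (p, t))"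
    "\<alpha> = 2 \<Longrightarrow> (\<integral>t. (\<phi> t)\<^sup>2 / w (p, t) \<partial>TM) = Lambda u \<phi> 2 p (umin u)"
proof -
  obtain q \<kappa> \<kappa>' l L s c C where T: "threshold q \<kappa> \<kappa>' (\<lambda>x. u_sec u \<alpha> (fst x) (snd x) - umin u) \<phi> l L s c C"
    using hyp_H1_threshold[OF u \<phi>] by blast
  interpret threshold q \<kappa> \<kappa>' "\<lambda>x. u_sec u \<alpha> (fst x) (snd x) - umin u" \<phi> l L s c C by (fact T)
  have pc: "p \<in> ccube" using p torus_box_subset_ccube by blast
  have m: "(\<lambda>t. (\<phi> t)\<^sup>2 / (u_sec u \<alpha> p t - umin u)) \<in> borel_measurable borel"
    using w_meas[of p] by simp
  have i: "integrable TM (\<lambda>t. (\<phi> t)\<^sup>2 / (u_sec u \<alpha> p t - umin u))"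
    using integrable_TM_ccube[OF m] Lam_integrable[OF pc] by simp
  have e: "(\<integral>t. (\<phi> t)\<^sup>2 / (u_sec u \<alpha> p t - umin u) \<partial>TM) = Lambda u \<phi> \<alpha> p (umin u)"
    unfolding Lambda_def by (rule lebesgue_on_torus_conv(3)[symmetric, OF m]) simp
  {
    assume a: "\<alpha> = 1"
    have m': "(\<lambda>t. (\<phi> t)\<^sup>2 / w (t, p)) \<in> borel_measurable TM" unfolding borel_measurable_TM by measurable
    have ae: "AE t in TM. (\<phi> t)\<^sup>2 / (u_sec u \<alpha> p t - umin u) = (\<phi> t)\<^sup>2 / w (t, p)"
      using AE_TM_torus by eventually_elim (simp add: a u_sec_def w_def mem_torus_box_Pair p)
    show "integrable TM (\<lambda>t. (\<phi> t)\<^sup>2 / w (t, p))"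
      by (rule integrable_cong_AE_imp[OF i m' ae])
    show "(\<integral>t. (\<phi> t)\<^sup>2 / w (t, p) \<partial>TM) = Lambda u \<phi> 1 p (umin u)"
      using e integral_cong_AE[OF _ m' ae] m by (simp add: a)
  }
  {
    assume a: "\<alpha> = 2"
    have m': "(\<lambda>t. (\<phi> t)\<^sup>2 / w (p, t)) \<in> borel_measurable TM" unfolding borel_measurable_TM by measurable
    have ae: "AE t in TM. (\<phi> t)\<^sup>2 / (u_sec u \<alpha> p t - umin u) = (\<phi> t)\<^sup>2 / w (p, t)"
      using AE_TM_torus by eventually_elim (simp add: a u_sec_def w_def mem_torus_box_Pair p)
    show "integrable TM (\<lambda>t. (\<phi> t)\<^sup>2 / w (p, t))"
      by (rule integrable_cong_AE_imp[OF i m' ae])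
    show "(\<integral>t. (\<phi> t)\<^sup>2 / w (p, t) \<partial>TM) = Lambda u \<phi> 2 p (umin u)"
      using e integral_cong_AE[OF _ m' ae] m by (simp add: a)
  }
qed

lemma Lam_eq:
  assumes "p \<in> torus_box"
  shows "Lam1 p = Lambda u \<phi>1 1 p (umin u)" "Lam2 p = Lambda u \<phi>2 2 p (umin u)"
    "integrable TM (\<lambda>t. (\<phi>1 t)\<^sup>2 / w (t, p))" "integrable TM (\<lambda>t. (\<phi>2 t)\<^sup>2 / w (p, t))"
  unfolding Lam1_def Lam2_def using Lambda_TM[OF \<phi>1 _ assms, of 1] Lambda_TM[OF \<phi>2 _ assms, of 2] by auto

lemma Lambda0: "Lambda u \<phi>1 1 0 (umin u) = 1 / \<mu>1" "Lambda u \<phi>2 2 0 (umin u) = 1 / \<mu>2"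
  by (simp_all add: \<mu>1 \<mu>2 mu0_def)

lemma \<phi>_sq_integrable: "integrable TM (\<lambda>x. (\<phi>1 x)\<^sup>2)" "integrable TM (\<lambda>x. (\<phi>2 x)\<^sup>2)"
proof -
  have *: "integrable TM (\<lambda>x. (f x)\<^sup>2)" if f: "continuous_on UNIV f" for f :: "real^3 \<Rightarrow> real"
  proof -
    obtain B where B: "B > 0" "\<And>x. x \<in> ccube \<Longrightarrow> \<bar>f x\<bar> \<le> B" by (rule bounded_on_ccube[OF f]) blast
    have [measurable]: "f \<in> borel_measurable borel" by (rule borel_measurable_continuous_onI[OF f])
    show ?thesis
    proof (rule finite_measure.integrable_const_bound[OF finite_measure_TM])
      show "AE x in TM. norm ((f x)\<^sup>2) \<le> B\<^sup>2"
        using AE_TM_torus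
      proof eventually_elim
        case (elim x)
        then have "\<bar>f x\<bar> \<le> B" using B(2) torus_box_subset_ccube by blast
        from power_mono[OF this, of 2] show ?case by simp
      qed
    qed (unfold borel_measurable_TM, measurable)
  qed
  show "integrable TM (\<lambda>x. (\<phi>1 x)\<^sup>2)" "integrable TM (\<lambda>x. (\<phi>2 x)\<^sup>2)" by (intro * \<phi>_cont)+
qed

sublocale bs: birman_schwinger TM w \<phi>1 \<phi>2 \<mu>1 \<mu>2 W Lam1 Lam2
proof (intro birman_schwinger.intro birman_schwinger_axioms.intro)
  show "sigma_finite_measure (TM :: (real^3) measure)" by (rule sigma_finite_TM)
  show "w \<in> borel_measurable (TM \<Otimes>\<^sub>M TM)" unfolding TM_pair borel_measurable_TM by (rule w_borel)
  show "AE z in TM \<Otimes>\<^sub>M TM. 0 < w z"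
    unfolding TM_pair using AE_TM_torus AE_TM_nonzero
    by eventually_elim (simp add: w_def u_gt)
  show "AE q in TM. integrable TM (\<lambda>t. (\<phi>1 t)\<^sup>2 / w (t, q))" "AE p in TM. integrable TM (\<lambda>t. (\<phi>2 t)\<^sup>2 / w (p, t))"
    using AE_TM_torus by (eventually_elim, simp add: Lam_eq)+
  \<comment> \<open>At the critical coupling 1/\<mu>1 is the value of \<Lambda> at 0, so the strict
    maximum in (H3) says exactly this away from the origin.\<close>
  show "AE q in TM. \<mu>1 * Lam1 q < 1"
    using AE_TM_torus AE_TM_nonzero
  proof eventually_elim
    case (elim q)
    then have "Lam1 q < 1 / \<mu>1"
      using H31 unfolding hyp_H3_def Lam_eq(1)[OF elim(1)] Lambda0[symmetric] by blast
    then show ?case using \<mu>1_pos by (simp add: field_simps)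
  qed
  show "AE q in TM. \<mu>2 * Lam2 q < 1"
    using AE_TM_torus AE_TM_nonzero
  proof eventually_elim
    case (elim q)
    then have "Lam2 q < 1 / \<mu>2"
      using H32 unfolding hyp_H3_def Lam_eq(2)[OF elim(1)] Lambda0[symmetric] by blast
    then show ?case using \<mu>2_pos by (simp add: field_simps)
  qed
qed (auto simp: w_ge0 w_W \<phi>_sq_integrable \<mu>1_pos \<mu>2_pos Lam1_def Lam2_def)

lemma K_square_integrable: "integrable (TM \<Otimes>\<^sub>M TM) (\<lambda>z. (bs.K z)\<^sup>2)"
proof -
  define k1 where "k1 = (if \<phi>1 0 = 0 then 1 else 0 :: nat)"
  define k2 where "k2 = (if \<phi>2 0 = 0 then 1 else 0 :: nat)"
  have k: "k1 \<le> 1" "k2 \<le> 1" "1 \<le> k1 + k2" using \<phi>0 by (auto simp: k1_def k2_def)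
  obtain c1 B1 where 1: "c1 > 0" "B1 > 0" "\<And>p. p \<in> ccube \<Longrightarrow> \<bar>\<phi>1 p\<bar> \<le> B1 * norm p ^ k1"
    "\<And>p. p \<in> ccube \<Longrightarrow> c1 * norm p ^ (1 + k1) \<le> 1 / \<mu>1 - Lambda u \<phi>1 1 p (umin u)"
    unfolding k1_def Lambda0[symmetric] using hyp_gap[OF u \<phi>1 H31] by blast
  obtain c2 B2 where 2: "c2 > 0" "B2 > 0" "\<And>p. p \<in> ccube \<Longrightarrow> \<bar>\<phi>2 p\<bar> \<le> B2 * norm p ^ k2"
    "\<And>p. p \<in> ccube \<Longrightarrow> c2 * norm p ^ (1 + k2) \<le> 1 / \<mu>2 - Lambda u \<phi>2 2 p (umin u)"
    unfolding k2_def Lambda0[symmetric] using hyp_gap[OF u \<phi>2 H32] by blast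
  obtain c where c: "c > 0" "\<And>z. z \<in> torus_box \<Longrightarrow> c * (norm z)\<^sup>2 \<le> w z" using w_lower by blast
  obtain R where R: "R > 0" "(ccube :: (real^3) set) \<subseteq> cball 0 R" by (rule ccube_subset_cball)
  define n where "n x = norm x powr - (5/2)" for x :: "real^3"
  have [measurable]: "n \<in> borel_measurable borel" unfolding n_def by measurable
  have n_int: "integrable TM n"
  proof (rule integrable_TM_ccube)
    obtain C where C: "\<And>r. r > 0 \<Longrightarrow> integrable lborel (\<lambda>x::real^3. indicator (cball 0 r) x * norm x powr - (5/2))"
      by (rule integral_norm_powr_ball[where ?s="5/2" and 'a="real^3"]) auto
    show "integrable lborel (\<lambda>x. indicator ccube x * n x)"
      by (rule Bochner_Integration.integrable_bound[OF C[OF R(1)]])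
         (use R(2) in \<open>auto intro!: AE_I2 simp: indicator_def n_def\<close>)
  qed measurable
  \<comment> \<open>The constants of the four pointwise bounds times the factor 1 + R of
    \<open>kernel_pointwise\<close>; the couplings cancel between the numerator and the lower bounds
    for \<open>bs.D1\<close> and \<open>bs.D2\<close>.\<close>
  define Q where "Q = B1\<^sup>2 * B2\<^sup>2 / (c\<^sup>2 * c1 * c2) * (1 + R)"
  have D: "bs.D1 q = \<mu>1 * (1 / \<mu>1 - Lambda u \<phi>1 1 q (umin u))" "bs.D2 q = \<mu>2 * (1 / \<mu>2 - Lambda u \<phi>2 2 q (umin u))"
    if "q \<in> torus_box" for q
    using \<mu>1_pos \<mu>2_pos by (simp_all add: bs.D1_def bs.D2_def Lam_eq[OF that] right_diff_distrib)
  \<comment> \<open>A majorant in product form, so that its integrability reduces to that of one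
    function on the three-dimensional torus.\<close>
  have bound: "(bs.K (p, q))\<^sup>2 \<le> Q * (n p * n q)" if p: "p \<in> torus_box" "p \<noteq> 0" and q: "q \<in> torus_box" "q \<noteq> 0" for p q
  proof -
    define P' Q' where "P' = norm p" and "Q' = norm q"
    have pc: "p \<in> ccube" "q \<in> ccube" using p q torus_box_subset_ccube by auto
    have P': "0 < P'" "P' \<le> R" "0 < Q'" "Q' \<le> R" using p q pc R(2) by (auto simp: P'_def Q'_def)
    have w: "c * (P'\<^sup>2 + Q'\<^sup>2) \<le> w (p, q)"
      using c(2)[of "(p, q)"] p q by (simp add: mem_torus_box_Pair norm_Pair_sq P'_def Q'_def)
    have S: "P'\<^sup>2 + Q'\<^sup>2 > 0" using P' by (simp add: add_pos_nonneg)
    have d1: "\<mu>1 * (c1 * Q' ^ (1 + k1)) \<le> bs.D1 q" "\<mu>2 * (c2 * P' ^ (1 + k2)) \<le> bs.D2 p"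
      unfolding D(1)[OF q(1)] D(2)[OF p(1)] P'_def Q'_def
      using 1(4)[OF pc(2)] 2(4)[OF pc(1)] \<mu>1_pos \<mu>2_pos by (auto intro!: mult_left_mono simp del: power_Suc)
    have pos: "0 < \<mu>1 * (c1 * Q' ^ (1 + k1))" "0 < \<mu>2 * (c2 * P' ^ (1 + k2))" "0 < c * (P'\<^sup>2 + Q'\<^sup>2)"
      using \<mu>1_pos \<mu>2_pos 1(1) 2(1) c(1) P' S by simp_all
    have dpos: "0 < bs.D1 q" "0 < bs.D2 p" "0 < w (p, q)" using d1 w pos by linarith+
    have "(bs.K (p, q))\<^sup>2 = \<mu>1 * \<mu>2 * ((\<phi>1 p)\<^sup>2 * (\<phi>2 q)\<^sup>2) / ((w (p, q))\<^sup>2 * bs.D1 q * bs.D2 p)"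
      using dpos \<mu>1_pos \<mu>2_pos by (simp add: bs.K_def power_mult_distrib power_divide)
    also have "\<dots> \<le> \<mu>1 * \<mu>2 * ((B1 * P' ^ k1)\<^sup>2 * (B2 * Q' ^ k2)\<^sup>2) /
        ((c * (P'\<^sup>2 + Q'\<^sup>2))\<^sup>2 * (\<mu>1 * (c1 * Q' ^ (1 + k1))) * (\<mu>2 * (c2 * P' ^ (1 + k2))))"
    proof (rule frac_le)
      have "(\<phi>1 p)\<^sup>2 \<le> (B1 * P' ^ k1)\<^sup>2" using power_mono[OF 1(3)[OF pc(1)], of 2] by (simp add: P'_def)
      moreover have "(\<phi>2 q)\<^sup>2 \<le> (B2 * Q' ^ k2)\<^sup>2" using power_mono[OF 2(3)[OF pc(2)], of 2] by (simp add: Q'_def)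
      ultimately show "\<mu>1 * \<mu>2 * ((\<phi>1 p)\<^sup>2 * (\<phi>2 q)\<^sup>2) \<le> \<mu>1 * \<mu>2 * ((B1 * P' ^ k1)\<^sup>2 * (B2 * Q' ^ k2)\<^sup>2)"
        using \<mu>1_pos \<mu>2_pos by (intro mult_left_mono mult_mono) auto
      show "0 < (c * (P'\<^sup>2 + Q'\<^sup>2))\<^sup>2 * (\<mu>1 * (c1 * Q' ^ (1 + k1))) * (\<mu>2 * (c2 * P' ^ (1 + k2)))"
        by (rule mult_pos_pos[OF mult_pos_pos[OF zero_less_power[OF pos(3)] pos(1)] pos(2)])
      show "(c * (P'\<^sup>2 + Q'\<^sup>2))\<^sup>2 * (\<mu>1 * (c1 * Q' ^ (1 + k1))) * (\<mu>2 * (c2 * P' ^ (1 + k2))) \<le> (w (p, q))\<^sup>2 * bs.D1 q * bs.D2 p"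
        using d1 w pos dpos by (intro mult_mono power_mono) (auto intro!: mult_nonneg_nonneg simp: less_imp_le simp del: power_Suc)
      show "0 \<le> \<mu>1 * \<mu>2 * ((B1 * P' ^ k1)\<^sup>2 * (B2 * Q' ^ k2)\<^sup>2)" using \<mu>1_pos \<mu>2_pos by simp
    qed
    also have "\<dots> = B1\<^sup>2 * B2\<^sup>2 / (c\<^sup>2 * c1 * c2) * (P' ^ (2 * k1) * Q' ^ (2 * k2) / ((P'\<^sup>2 + Q'\<^sup>2)\<^sup>2 * Q' ^ (1 + k1) * P' ^ (1 + k2)))"
      using \<mu>1_pos \<mu>2_pos by (simp add: power_mult_distrib power_mult[symmetric] mult.commute[of 2] mult_ac del: power_Suc)
    also have "\<dots> \<le> B1\<^sup>2 * B2\<^sup>2 / (c\<^sup>2 * c1 * c2) * ((1 + R) * (P' powr - (5/2) * Q' powr - (5/2)))"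
      using c(1) 1(1) 2(1) by (intro mult_left_mono kernel_pointwise P' k) auto
    also have "\<dots> = Q * (n p * n q)" by (simp add: Q_def n_def P'_def Q'_def)
    finally show ?thesis .
  qed
  show ?thesis
  proof (rule Bochner_Integration.integrable_bound)
    show "integrable (TM \<Otimes>\<^sub>M TM) (\<lambda>z. Q * (n (fst z) * n (snd z)))"
      by (intro integrable_mult_right bs.integrable_times n_int)
    show "AE z in TM \<Otimes>\<^sub>M TM. norm ((bs.K z)\<^sup>2) \<le> norm (Q * (n (fst z) * n (snd z)))"
      using bs.AE_pair_fst[OF AE_TM_torus] bs.AE_pair_fst[OF AE_TM_nonzero] bs.AE_pair_snd[OF AE_TM_torus] bs.AE_pair_snd[OF AE_TM_nonzero]
    proof eventually_elim
      case (elim z)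
      then show ?case using bound[of "fst z" "snd z"] by simp
    qed
  qed (use bs.K_meas in measurable)
qed

end

section \<open>Weyl sequences\<close>

lemma Hop_of_real:
  "Hop u \<phi>1 \<phi>2 \<mu>1 \<mu>2 (\<lambda>z. complex_of_real (G z)) (p, q) = complex_of_real (u (p, q) * G (p, q)
     - \<mu>1 * \<phi>1 p * (\<integral>t. \<phi>1 t * G (t, q) \<partial>(lebesgue_on torus_box))
     - \<mu>2 * \<phi>2 q * (\<integral>t. \<phi>2 t * G (p, t) \<partial>(lebesgue_on torus_box)))"
  by (simp add: Hop_def of_real_mult[symmetric] del: of_real_mult)

lemma square_add3_le: "(a - b - c)\<^sup>2 \<le> 3 * (a\<^sup>2 + b\<^sup>2 + c\<^sup>2)" for a b c :: real
proof -
  have "0 \<le> (a + b)\<^sup>2 + (a + c)\<^sup>2 + (b - c)\<^sup>2" by simp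
  then show ?thesis by (simp add: power2_eq_square algebra_simps)
qed

text \<open>The cubes approach p0 from the side of smaller coordinates, which stays inside the torus
  even when p0 lies on an upper face. Their coordinate intervals follow one another without overlap,
  so normalised indicators are orthogonal for free.\<close>

lemma dyadic_cubes:
  fixes p0 :: "real^3" and r :: real
  assumes r: "r > 0" "\<forall>b\<in>Basis. r \<le> p0 \<bullet> b + pi" and p0: "p0 \<in> torus_box"
  defines "A \<equiv> \<lambda>n. box (p0 - (r / 2 ^ n) *\<^sub>R One) (p0 - (r / 2 ^ Suc n) *\<^sub>R One)"
  shows "A n \<subseteq> torus_box" "n \<noteq> m \<Longrightarrow> A n \<inter> A m = {}" "measure lborel (A n) = (r / 2 ^ Suc n) ^ 3"
    "p \<in> A n \<Longrightarrow> norm (p - p0) \<le> 3 * (r / 2 ^ n)" "A n \<in> sets borel"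
proof -
  have mem: "p \<in> A n \<longleftrightarrow> (\<forall>b\<in>Basis. p0 \<bullet> b - r / 2 ^ n < p \<bullet> b \<and> p \<bullet> b < p0 \<bullet> b - r / 2 ^ Suc n)" for p n
    by (simp add: A_def mem_box inner_diff_left)
  have mono: "r / 2 ^ m \<le> r / 2 ^ n" if "n \<le> m" for n m :: nat
    using r(1) that by (intro divide_left_mono) (auto intro: power_increasing)
  show "A n \<in> sets borel" by (simp add: A_def)
  show "A n \<subseteq> torus_box"
  proof
    fix p assume p: "p \<in> A n"
    show "p \<in> torus_box" unfolding torus_box_def
    proof (intro CollectI ballI)
      fix b :: "real^3" assume b: "b \<in> Basis"
      have "r / 2 ^ n \<le> r / 2 ^ 0" by (rule mono) simp
      moreover have "r / 2 ^ Suc n > 0" using r(1) by simp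
      ultimately show "- pi < p \<bullet> b \<and> p \<bullet> b \<le> pi"
        using p b bspec[OF r(2) b] p0 unfolding mem torus_box_def by (smt (verit) div_by_1 mem_Collect_eq power_0)
    qed
  qed
  have disj: "A n \<inter> A m = {}" if nm: "n < m" for n m
  proof -
    obtain b :: "real^3" where b: "b \<in> Basis" using SOME_Basis by blast
    have "r / 2 ^ m \<le> r / 2 ^ Suc n" using nm by (intro mono) simp
    then have "p \<notin> A m" if "p \<in> A n" for p using that b unfolding mem by (smt (verit))
    then show ?thesis by blast
  qed
  show "n \<noteq> m \<Longrightarrow> A n \<inter> A m = {}" using disj[of n m] disj[of m n] by (cases "n < m") auto
  have le: "(p0 - (r / 2 ^ n) *\<^sub>R One) \<bullet> b \<le> (p0 - (r / 2 ^ Suc n) *\<^sub>R One) \<bullet> b" if "b \<in> Basis" for b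
    using mono[of n "Suc n"] that by (simp add: inner_diff_left)
  have "measure lborel (A n) = (\<Prod>b\<in>Basis. ((p0 - (r / 2 ^ Suc n) *\<^sub>R One) - (p0 - (r / 2 ^ n) *\<^sub>R One)) \<bullet> b)"
    unfolding A_def using le by (rule measure_lborel_box)
  also have "\<dots> = (\<Prod>b\<in>(Basis::(real^3) set). r / 2 ^ Suc n)"
    by (intro prod.cong refl) (simp add: inner_diff_left)
  finally show "measure lborel (A n) = (r / 2 ^ Suc n) ^ 3" by simp
  show "norm (p - p0) \<le> 3 * (r / 2 ^ n)" if "p \<in> A n"
  proof -
    have "norm (p - p0) \<le> (\<Sum>b\<in>Basis. \<bar>(p - p0) \<bullet> b\<bar>)" by (rule norm_le_l1)
    also have "\<dots> \<le> (\<Sum>b\<in>(Basis::(real^3) set). r / 2 ^ n)"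
    proof (intro sum_mono)
      fix b :: "real^3" assume b: "b \<in> Basis"
      have "r / 2 ^ Suc n > 0" using r(1) by simp
      then show "\<bar>(p - p0) \<bullet> b\<bar> \<le> r / 2 ^ n" using that b unfolding mem inner_diff_left by (smt (verit))
    qed
    finally show ?thesis by simp
  qed
qed

text \<open>On small cubes around x0 multiplication by u is nearly u x0. The cubes are products A n
  x B n because each partial integral operator then gives a bounded mean times the indicator of a
  slab over one factor, whose measure tends to 0.\<close>

lemma Weyl_range_in_ess_spectrum:
  fixes u :: "(real^3) \<times> (real^3) \<Rightarrow> real" and \<phi>1 \<phi>2 :: "real^3 \<Rightarrow> real"
  assumes u: "continuous_on UNIV u" and \<phi>1: "continuous_on UNIV \<phi>1" and \<phi>2: "continuous_on UNIV \<phi>2"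
    and x0: "x0 \<in> torus_box"
  shows "complex_of_real (u x0) \<in> ess_spectrum (Hop u \<phi>1 \<phi>2 \<mu>1 \<mu>2)"
proof -
  interpret TM: finite_measure "TM :: (real^3) measure" by (rule finite_measure_TM)
  interpret P: pair_sigma_finite "TM :: (real^3) measure" "TM :: (real^3) measure" ..
  have [measurable]: "u \<in> borel_measurable borel" "\<phi>1 \<in> borel_measurable borel" "\<phi>2 \<in> borel_measurable borel"
    using u \<phi>1 \<phi>2 by (auto intro: borel_measurable_continuous_onI)
  obtain p0 q0 where pq: "x0 = (p0, q0)" by (cases x0)
  have p0: "p0 \<in> torus_box" and q0: "q0 \<in> torus_box" using x0 by (auto simp: pq mem_torus_box_Pair)
  \<comment> \<open>The least distance of x0 to the lower faces, positive because these do not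
    belong to the torus.\<close>
  define r where "r = Min ((\<lambda>b. x0 \<bullet> b + pi) ` Basis)"
  have rb: "r \<le> x0 \<bullet> b + pi" if "b \<in> Basis" for b unfolding r_def using that by (intro Min_le) auto
  have "r > 0" unfolding r_def using x0 by (subst Min_gr_iff) (auto simp: torus_box_def)
  note r = this
  have rp: "\<forall>b\<in>Basis. r \<le> p0 \<bullet> b + pi" "\<forall>b\<in>Basis. r \<le> q0 \<bullet> b + pi"
    using rb[of "(_, 0)"] rb[of "(0, _)"] by (auto simp: pq Basis_prod_def)
  define A where "A n = box (p0 - (r / 2 ^ n) *\<^sub>R One) (p0 - (r / 2 ^ Suc n) *\<^sub>R One)" for n
  define B where "B n = box (q0 - (r / 2 ^ n) *\<^sub>R One) (q0 - (r / 2 ^ Suc n) *\<^sub>R One)" for n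
  note Ap = dyadic_cubes[OF r rp(1) p0, folded A_def]
  note Bp = dyadic_cubes[OF r rp(2) q0, folded B_def]
  have [measurable]: "A n \<in> sets borel" "B n \<in> sets borel" for n using Ap(5) Bp(5) by auto
  define v where "v n = (r / 2 ^ Suc n) ^ 3" for n
  have v: "v n > 0" for n using r by (simp add: v_def)
  have v0: "v \<longlonglongrightarrow> 0"
  proof -
    have "(\<lambda>n. (r / 2 * (1/2) ^ n) ^ 3) \<longlonglongrightarrow> (r / 2 * 0) ^ 3"
      by (intro tendsto_intros LIMSEQ_power_zero) simp
    then show ?thesis by (simp add: v_def[abs_def] power_divide)
  qed
  have indint: "integrable TM (indicator S :: real^3 \<Rightarrow> real)" "(\<integral>t. indicator S t \<partial>TM) = measure lborel S"
    if S[measurable]: "S \<in> sets borel" and ST: "S \<subseteq> torus_box" for S :: "(real^3) set"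
  proof -
    show "integrable TM (indicator S :: real^3 \<Rightarrow> real)"
      by (intro integrable_real_indicator) (auto simp: TM.emeasure_finite less_top[symmetric])
    have "(\<integral>t. indicator S t \<partial>TM) = (\<integral>t. indicator torus_box t *\<^sub>R (indicator S t :: real) \<partial>lborel)"
      by (rule integral_TM) measurable
    also have "\<dots> = (\<integral>t. indicator S t \<partial>lborel)"
      using ST by (intro Bochner_Integration.integral_cong) (auto simp: indicator_def)
    finally show "(\<integral>t. indicator S t \<partial>TM) = measure lborel S" by simp
  qed
  have iA: "integrable TM (indicator (A n) :: real^3 \<Rightarrow> real)" "(\<integral>t. indicator (A n) t \<partial>TM) = v n"
    and iB: "integrable TM (indicator (B n) :: real^3 \<Rightarrow> real)" "(\<integral>t. indicator (B n) t \<partial>TM) = v n" for n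
    using indint[of "A n"] indint[of "B n"] Ap(1,3,5) Bp(1,3,5) by (auto simp: v_def)
  \<comment> \<open>The product cube has measure (v n)^2, so division by v n normalises in
    L2.\<close>
  define G where "G n z = indicator (A n) (fst z) * indicator (B n) (snd z) / v n" for n and z :: "(real^3) \<times> (real^3)"
  have [measurable]: "G n \<in> borel_measurable borel" for n
    unfolding G_def[abs_def] borel_prod[symmetric] by measurable
  have Gsq: "integrable TM (\<lambda>z. (G n z)\<^sup>2)" "(\<integral>z. (G n z)\<^sup>2 \<partial>TM) = 1" for n
  proof -
    have eq: "(\<lambda>z. (G n z)\<^sup>2) = (\<lambda>z. 1 / (v n)\<^sup>2 * (indicator (A n) (fst z) * indicator (B n) (snd z)))"
      by (auto simp: G_def fun_eq_iff indicator_def power_divide)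
    show "integrable TM (\<lambda>z. (G n z)\<^sup>2)"
      unfolding eq TM_pair[symmetric] by (intro integrable_mult_right P.integrable_times iA iB)
    show "(\<integral>z. (G n z)\<^sup>2 \<partial>TM) = 1"
      unfolding eq TM_pair[symmetric] integral_mult_right_zero P.integrable_times(2)[OF iA(1) iB(1)] iA(2) iB(2)
      using v[of n] by (simp add: power2_eq_square)
  qed
  define F where "F n z = complex_of_real (G n z)" for n z
  have L2F: "L2fun (F n)" for n
    unfolding L2fun_def
  proof
    show "F n \<in> borel_measurable (lebesgue_on T6)"
      by (rule lebesgue_on_torus_conv(1)[of "F n"]) (auto simp: F_def[abs_def])
    show "integrable (lebesgue_on T6) (\<lambda>x. (cmod (F n x))\<^sup>2)"
      using lebesgue_on_torus_conv(2)[of "\<lambda>z. (G n z)\<^sup>2" "\<lambda>z. (G n z)\<^sup>2"] Gsq(1)[of n] by (simp add: F_def)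
  qed
  have orth: "L2inner (F n) (F m) = (if n = m then 1 else 0)" for n m
  proof -
    have "L2inner (F n) (F m) = complex_of_real (\<integral>x. G n x * G m x \<partial>(lebesgue_on T6))"
      by (simp add: L2inner_def F_def of_real_mult[symmetric] del: of_real_mult)
    also have "(\<integral>x. G n x * G m x \<partial>(lebesgue_on T6)) = (\<integral>x. G n x * G m x \<partial>TM)"
      by (rule lebesgue_on_torus_conv(3)) auto
    also have "\<dots> = (if n = m then 1 else 0)"
    proof (cases "n = m")
      case True
      then show ?thesis using Gsq(2)[of n] by (simp add: power2_eq_square)
    next
      case False
      have z: "(\<lambda>x. G n x * G m x) = (\<lambda>_. 0)" using Ap(2)[OF False] by (auto simp: G_def indicator_def fun_eq_iff)
      show ?thesis unfolding z using False by simp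
    qed
    finally show ?thesis by simp
  qed
  obtain C1 where C1: "C1 > 0" "\<And>x. x \<in> ccube \<Longrightarrow> \<bar>\<phi>1 x\<bar> \<le> C1"
    by (rule bounded_on_ccube[OF \<phi>1]) blast
  obtain C2 where C2: "C2 > 0" "\<And>x. x \<in> ccube \<Longrightarrow> \<bar>\<phi>2 x\<bar> \<le> C2"
    by (rule bounded_on_ccube[OF \<phi>2]) blast
  have mean: "\<bar>\<integral>t. \<phi> t * indicator S t \<partial>(lebesgue_on torus_box)\<bar> \<le> C * v n"
    if \<phi>[measurable]: "\<phi> \<in> borel_measurable borel" and S[measurable]: "S \<in> sets borel"
      and C: "\<And>x. x \<in> ccube \<Longrightarrow> \<bar>\<phi> x\<bar> \<le> C" and ST: "S \<subseteq> torus_box"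
      and iS: "integrable TM (indicator S :: real^3 \<Rightarrow> real)" "(\<integral>t. indicator S t \<partial>TM) = v n"
    for \<phi> :: "real^3 \<Rightarrow> real" and S C n
  proof -
    have le: "\<bar>\<phi> t * indicator S t\<bar> \<le> C * indicator S t" for t
      using C[of t] ST torus_box_subset_ccube by (auto simp: indicator_def)
    have i: "integrable TM (\<lambda>t. C * indicator S t :: real)" by (intro integrable_mult_right iS)
    have "(\<integral>t. \<phi> t * indicator S t \<partial>(lebesgue_on torus_box)) = (\<integral>t. \<phi> t * indicator S t \<partial>TM)"
      by (rule lebesgue_on_torus_conv(3)) auto
    also have "\<bar>\<dots>\<bar> \<le> (\<integral>t. \<bar>\<phi> t * indicator S t\<bar> \<partial>TM)" by (rule integral_abs_bound)
    also have "\<dots> \<le> (\<integral>t. C * indicator S t \<partial>TM)" 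
    proof (rule integral_mono'[OF i])
      show "\<bar>\<phi> t * indicator S t\<bar> \<le> C * indicator S t" "0 \<le> C * indicator S t" for t
        using le[of t] abs_ge_zero[of "\<phi> t * indicator S t"] by linarith+
    qed
    also have "\<dots> = C * v n" using iS by simp
    finally show ?thesis .
  qed
  define V where "V = measure (TM :: (real^3) measure) UNIV"
  define D where "D = (\<mu>1 * C1 * C1)\<^sup>2 + (\<mu>2 * C2 * C2)\<^sup>2"
  have one: "integrable (TM :: (real^3) measure) (\<lambda>_. 1 :: real)" "(\<integral>_. 1 \<partial>(TM :: (real^3) measure)) = V"
    by (auto simp: V_def)
  have est: "L2norm2 (\<lambda>x. Hop u \<phi>1 \<phi>2 \<mu>1 \<mu>2 (F n) x - complex_of_real (u x0) * F n x) \<le> 3 * (\<epsilon>\<^sup>2 + D * V * v n)"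
    if eps: "\<And>p q. p \<in> A n \<Longrightarrow> q \<in> B n \<Longrightarrow> \<bar>u (p, q) - u x0\<bar> \<le> \<epsilon>" for n \<epsilon>
  proof -
    \<comment> \<open>A majorant of the squared error: \<epsilon>^2 G^2 from the multiplication part
      and a constant on a slab from each integral operator; the factor 3 is the price of splitting
      the square of a sum of three terms.\<close>
    define h where "h z = 3 * (\<epsilon>\<^sup>2 * (G n z)\<^sup>2 + (\<mu>1 * C1 * C1)\<^sup>2 * (1 * indicator (B n) (snd z)) + (\<mu>2 * C2 * C2)\<^sup>2 * (indicator (A n) (fst z) * 1))" for z
    have [measurable]: "(\<lambda>z. indicator (B n) (snd z) :: real) \<in> borel_measurable (borel :: ((real^3) \<times> (real^3)) measure)"
      "(\<lambda>z. indicator (A n) (fst z) :: real) \<in> borel_measurable (borel :: ((real^3) \<times> (real^3)) measure)"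
      unfolding borel_prod[symmetric] by measurable
    have [measurable]: "h \<in> borel_measurable borel"
      unfolding h_def[abs_def] by (intro borel_measurable_times borel_measurable_add borel_measurable_power borel_measurable_const) measurable
    have i1: "integrable TM (\<lambda>z :: (real^3) \<times> (real^3). 1 * indicator (B n) (snd z) :: real)"
      "integral\<^sup>L TM (\<lambda>z :: (real^3) \<times> (real^3). 1 * indicator (B n) (snd z)) = V * v n"
      unfolding TM_pair[symmetric] using P.integrable_times[OF one(1) iB(1)[of n]] iB(2) one(2) by auto
    have i2: "integrable TM (\<lambda>z :: (real^3) \<times> (real^3). indicator (A n) (fst z) * 1 :: real)"
      "integral\<^sup>L TM (\<lambda>z :: (real^3) \<times> (real^3). indicator (A n) (fst z) * 1) = v n * V"
      unfolding TM_pair[symmetric] using P.integrable_times[OF iA(1)[of n] one(1)] iA(2) one(2) by auto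
    have hint: "integrable TM h" unfolding h_def[abs_def]
      by (intro integrable_mult_right Bochner_Integration.integrable_add Gsq(1) i1(1) i2(1))
    have hval: "(\<integral>z. h z \<partial>TM) = 3 * (\<epsilon>\<^sup>2 + D * V * v n)"
    proof -
      have "(\<integral>z. h z \<partial>TM) = 3 * (\<epsilon>\<^sup>2 * (\<integral>z. (G n z)\<^sup>2 \<partial>TM) + (\<mu>1 * C1 * C1)\<^sup>2 * integral\<^sup>L TM (\<lambda>z :: (real^3) \<times> (real^3). 1 * indicator (B n) (snd z))
          + (\<mu>2 * C2 * C2)\<^sup>2 * integral\<^sup>L TM (\<lambda>z :: (real^3) \<times> (real^3). indicator (A n) (fst z) * 1))"
        unfolding h_def using Gsq(1)[of n] i1(1) i2(1) by simp
      then show ?thesis unfolding Gsq i1 i2 by (simp add: D_def algebra_simps)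
    qed
    have "L2norm2 (\<lambda>x. Hop u \<phi>1 \<phi>2 \<mu>1 \<mu>2 (F n) x - complex_of_real (u x0) * F n x) \<le> (\<integral>z. h z \<partial>(lebesgue_on T6))"
      unfolding L2norm2_def
    proof (rule integral_mono')
      show "integrable (lebesgue_on T6) h" using lebesgue_on_torus_conv(2)[of h h] hint by simp
      show "0 \<le> h z" for z by (simp add: h_def)
      fix z :: "(real^3) \<times> (real^3)" assume "z \<in> space (lebesgue_on T6)"
      obtain p q where z: "z = (p, q)" by (cases z)
      have pq: "p \<in> ccube" "q \<in> ccube"
        using \<open>z \<in> space (lebesgue_on T6)\<close> torus_box_subset_ccube by (auto simp: z mem_torus_box_Pair)
      define a where "a = (u (p, q) - u x0) * G n (p, q)"
      define m1 where "m1 = (\<integral>t. \<phi>1 t * indicator (A n) t \<partial>(lebesgue_on torus_box)) / v n"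
      define m2 where "m2 = (\<integral>t. \<phi>2 t * indicator (B n) t \<partial>(lebesgue_on torus_box)) / v n"
      have m1: "\<bar>m1\<bar> \<le> C1" using mean[of \<phi>1 "A n" C1 n] C1(2) Ap(1) iA v[of n] by (simp add: m1_def pos_divide_le_eq)
      have m2: "\<bar>m2\<bar> \<le> C2" using mean[of \<phi>2 "B n" C2 n] C2(2) Bp(1) iB v[of n] by (simp add: m2_def pos_divide_le_eq)
      have e1: "(\<integral>t. \<phi>1 t * G n (t, q) \<partial>(lebesgue_on torus_box)) = m1 * indicator (B n) q"
      proof -
        have "(\<lambda>t. \<phi>1 t * G n (t, q)) = (\<lambda>t. \<phi>1 t * indicator (A n) t * (indicator (B n) q / v n))"
          by (simp add: G_def fun_eq_iff)
        then show ?thesis by (simp add: m1_def)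
      qed
      have e2: "(\<integral>t. \<phi>2 t * G n (p, t) \<partial>(lebesgue_on torus_box)) = m2 * indicator (A n) p"
      proof -
        have "(\<lambda>t. \<phi>2 t * G n (p, t)) = (\<lambda>t. \<phi>2 t * indicator (B n) t * (indicator (A n) p / v n))"
          by (simp add: G_def fun_eq_iff)
        then show ?thesis by (simp add: m2_def)
      qed
      define b where "b = \<mu>1 * \<phi>1 p * (m1 * indicator (B n) q)"
      define c where "c = \<mu>2 * \<phi>2 q * (m2 * indicator (A n) p)"
      have "Hop u \<phi>1 \<phi>2 \<mu>1 \<mu>2 (F n) z - complex_of_real (u x0) * F n z = complex_of_real (a - b - c)"
        unfolding z F_def[abs_def] Hop_of_real e1 e2 a_def b_def c_def
        by (simp add: algebra_simps)
      then have "(cmod (Hop u \<phi>1 \<phi>2 \<mu>1 \<mu>2 (F n) z - complex_of_real (u x0) * F n z))\<^sup>2 = (a - b - c)\<^sup>2"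
        by (simp only: norm_of_real power2_abs)
      also have "\<dots> \<le> 3 * (a\<^sup>2 + b\<^sup>2 + c\<^sup>2)" by (rule square_add3_le)
      also have "\<dots> \<le> h z"
      proof -
        have "a\<^sup>2 \<le> \<epsilon>\<^sup>2 * (G n z)\<^sup>2"
        proof (cases "p \<in> A n \<and> q \<in> B n")
          case True
          have "\<bar>u (p, q) - u x0\<bar>\<^sup>2 \<le> \<epsilon>\<^sup>2" using eps[of p q] True by (intro power_mono) auto
          then show ?thesis by (simp add: a_def z power_mult_distrib mult_right_mono)
        qed (auto simp: a_def z G_def)
        moreover have "b\<^sup>2 \<le> (\<mu>1 * C1 * C1)\<^sup>2 * (1 * indicator (B n) (snd z))"
        proof (cases "q \<in> B n")
          case True
          have "\<bar>\<mu>1 * \<phi>1 p * m1\<bar> \<le> \<bar>\<mu>1\<bar> * C1 * C1"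
            unfolding abs_mult using m1 C1 pq by (intro mult_mono) auto
          then have "\<bar>\<mu>1 * \<phi>1 p * m1\<bar>\<^sup>2 \<le> (\<bar>\<mu>1\<bar> * C1 * C1)\<^sup>2" by (intro power_mono) auto
          then show ?thesis using True by (simp add: b_def z power_mult_distrib)
        qed (simp add: b_def z)
        moreover have "c\<^sup>2 \<le> (\<mu>2 * C2 * C2)\<^sup>2 * (indicator (A n) (fst z) * 1)"
        proof (cases "p \<in> A n")
          case True
          have "\<bar>\<mu>2 * \<phi>2 q * m2\<bar> \<le> \<bar>\<mu>2\<bar> * C2 * C2"
            unfolding abs_mult using m2 C2 pq by (intro mult_mono) auto
          then have "\<bar>\<mu>2 * \<phi>2 q * m2\<bar>\<^sup>2 \<le> (\<bar>\<mu>2\<bar> * C2 * C2)\<^sup>2" by (intro power_mono) auto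
          then show ?thesis using True by (simp add: c_def z power_mult_distrib)
        qed (simp add: c_def z)
        ultimately show ?thesis unfolding h_def by (intro mult_left_mono add_mono) (assumption | simp)+
      qed
      finally show "(cmod (Hop u \<phi>1 \<phi>2 \<mu>1 \<mu>2 (F n) z - complex_of_real (u x0) * F n z))\<^sup>2 \<le> h z" .
    qed
    also have "(\<integral>z. h z \<partial>(lebesgue_on T6)) = (\<integral>z. h z \<partial>TM)" by (rule lebesgue_on_torus_conv(3)) auto
    finally show ?thesis unfolding hval .
  qed
  have lim: "(\<lambda>n. L2norm2 (\<lambda>x. Hop u \<phi>1 \<phi>2 \<mu>1 \<mu>2 (F n) x - complex_of_real (u x0) * F n x)) \<longlonglongrightarrow> 0"
  proof (rule order_tendstoI)
    fix e :: real assume "e < 0"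
    then show "\<forall>\<^sub>F n in sequentially. e < L2norm2 (\<lambda>x. Hop u \<phi>1 \<phi>2 \<mu>1 \<mu>2 (F n) x - complex_of_real (u x0) * F n x)"
      by (intro always_eventually allI) (auto simp: L2norm2_def intro: less_le_trans)
  next
    fix e :: real assume e: "0 < e"
    define \<epsilon> where "\<epsilon> = sqrt (e / 6)"
    have \<epsilon>: "\<epsilon> > 0" "3 * \<epsilon>\<^sup>2 = e / 2" using e by (auto simp: \<epsilon>_def)
    obtain d where d: "d > 0" "\<And>y. norm (y - x0) < d \<Longrightarrow> \<bar>u y - u x0\<bar> < \<epsilon>"
      using continuous_on_UNIV_ball[OF u \<epsilon>(1), of x0] by blast
    have "(\<lambda>n. 6 * (r * (1/2) ^ n)) \<longlonglongrightarrow> 6 * (r * 0)" by (intro tendsto_intros LIMSEQ_power_zero) simp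
    then have "\<forall>\<^sub>F n in sequentially. 6 * (r * (1/2) ^ n) < d" using d(1) by (intro order_tendstoD) auto
    moreover have "(\<lambda>n. 3 * (D * V * v n)) \<longlonglongrightarrow> 3 * (D * V * 0)" by (intro tendsto_intros v0)
    then have "\<forall>\<^sub>F n in sequentially. 3 * (D * V * v n) < e / 2" by (rule order_tendstoD(2)) (use e in simp)
    ultimately show "\<forall>\<^sub>F n in sequentially. L2norm2 (\<lambda>x. Hop u \<phi>1 \<phi>2 \<mu>1 \<mu>2 (F n) x - complex_of_real (u x0) * F n x) < e"
    proof eventually_elim
      case (elim n)
      have "\<bar>u (p, q) - u x0\<bar> \<le> \<epsilon>" if "p \<in> A n" "q \<in> B n" for p q
      proof -
        have "norm ((p, q) - x0) \<le> norm (p - p0) + norm (q - q0)" unfolding pq by (simp add: norm_Pair_le)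
        also have "\<dots> \<le> 6 * (r * (1/2) ^ n)" using Ap(4)[OF that(1)] Bp(4)[OF that(2)] by (simp add: power_divide)
        finally show ?thesis using d(2)[of "(p, q)"] elim(1) by simp
      qed
      then have "L2norm2 (\<lambda>x. Hop u \<phi>1 \<phi>2 \<mu>1 \<mu>2 (F n) x - complex_of_real (u x0) * F n x) \<le> 3 * (\<epsilon>\<^sup>2 + D * V * v n)"
        by (rule est)
      also have "\<dots> = 3 * \<epsilon>\<^sup>2 + 3 * (D * V * v n)" by (rule distrib_left)
      also have "\<dots> < e" using elim(2) \<epsilon>(2) by linarith
      finally show ?case .
    qed
  qed
  show ?thesis unfolding ess_spectrum_def using L2F orth lim by blast
qed

section \<open>Counting the eigenvalues\<close>

context lattice_model
begin

abbreviation "MM \<equiv> (TM :: (real^3) measure) \<Otimes>\<^sub>M (TM :: (real^3) measure)"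

text \<open>H on real functions, with the Borel marginals over \<open>TM\<close>;
  \<open>Hop_Complex\<close> shows that \<open>Hop\<close> acts in this way on real and imaginary
  parts.\<close>

definition "Hr a z = u z * a z - \<mu>1 * \<phi>1 (fst z) * bs.g1 a (snd z) - \<mu>2 * \<phi>2 (snd z) * bs.g2 a (fst z)"

text \<open>The bilinear form of H; moving \<phi>1 and \<phi>2 into the marginals makes its symmetry
  in a and b evident.\<close>

definition "form a b = (\<integral>z. u z * (a z * b z) \<partial>MM) - \<mu>1 * (\<integral>q. bs.g1 a q * bs.g1 b q \<partial>TM)
   - \<mu>2 * (\<integral>p. bs.g2 a p * bs.g2 b p \<partial>TM)"

abbreviation ip :: "((real^3) \<times> (real^3) \<Rightarrow> real) \<Rightarrow> ((real^3) \<times> (real^3) \<Rightarrow> real) \<Rightarrow> real" where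
  "ip a b \<equiv> (\<integral>z. a z * b z \<partial>MM)"

lemma form_sym: "form a b = form b a"
  by (simp add: form_def mult.commute)

lemma MM_TM: "MM = TM" by (rule TM_pair)

lemma L2_iff: "bs.L2 a \<longleftrightarrow> a \<in> borel_measurable borel \<and> integrable TM (\<lambda>z. (a z)\<^sup>2)"
  by (simp add: bs.L2_def MM_TM)

lemma L2_mult_integrable: "bs.L2 a \<Longrightarrow> bs.L2 b \<Longrightarrow> integrable MM (\<lambda>z. a z * b z)"
  unfolding bs.L2_def by (intro integrable_mult_of_squares) auto

lemma u_mult_integrable:
  assumes "bs.L2 a" "bs.L2 b"
  shows "integrable MM (\<lambda>z. u z * (a z * b z))"
proof -
  obtain B where B: "B > 0" "\<And>x. x \<in> ccube \<Longrightarrow> \<bar>u x\<bar> \<le> B" by (rule bounded_on_ccube[OF u_cont]) blast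
  have [measurable]: "a \<in> borel_measurable borel" "b \<in> borel_measurable borel" using assms by (auto simp: L2_iff)
  have i: "integrable TM (\<lambda>z. B * (a z * b z))"
    using L2_mult_integrable[OF assms] unfolding MM_TM by simp
  show ?thesis unfolding MM_TM
  proof (rule Bochner_Integration.integrable_bound[OF i])
    show "AE z in TM. norm (u z * (a z * b z)) \<le> norm (B * (a z * b z))"
      using AE_TM_torus
    proof eventually_elim
      case (elim z)
      then have "\<bar>u z\<bar> \<le> \<bar>B\<bar>" using B(1) B(2)[of z] torus_box_subset_ccube by force
      then show ?case by (simp add: abs_mult mult_right_mono)
    qed
  qed (unfold borel_measurable_TM, measurable)
qed

lemma Hr_form:
  assumes a: "bs.L2 a" and b: "bs.L2 b"
  shows "(\<integral>z. Hr a z * b z \<partial>MM) = form a b"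
proof -
  have [measurable]: "a \<in> borel_measurable MM" using a by (simp add: bs.L2_def)
  note P = bs.pairing(1,2)[OF b bs.g_meas(1) bs.g_L2(1)[OF a]] bs.pairing(3,4)[OF b bs.g_meas(2) bs.g_L2(2)[OF a]]
  have P1: "integrable MM (\<lambda>z. bs.g1 a (snd z) * \<phi>1 (fst z) * b z)"
    "(\<integral>z. bs.g1 a (snd z) * \<phi>1 (fst z) * b z \<partial>MM) = (\<integral>q. bs.g1 a q * bs.g1 b q \<partial>TM)"
    "integrable MM (\<lambda>z. bs.g2 a (fst z) * \<phi>2 (snd z) * b z)"
    "(\<integral>z. bs.g2 a (fst z) * \<phi>2 (snd z) * b z \<partial>MM) = (\<integral>p. bs.g2 a p * bs.g2 b p \<partial>TM)"
    using P by simp_all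
  have "(\<integral>z. Hr a z * b z \<partial>MM) = (\<integral>z. u z * (a z * b z) - \<mu>1 * (bs.g1 a (snd z) * \<phi>1 (fst z) * b z)
      - \<mu>2 * (bs.g2 a (fst z) * \<phi>2 (snd z) * b z) \<partial>MM)"
    by (simp add: Hr_def algebra_simps)
  also have "\<dots> = form a b"
    unfolding form_def P1(2,4)[symmetric] using u_mult_integrable[OF a b] P1(1,3) by simp
  finally show ?thesis .
qed

text \<open>On the torus w = u - m, so the energy is the form of H shifted by m; the cut-off of
  \<open>w\<close> outside is invisible to \<open>TM\<close>.\<close>

lemma energy_form:
  assumes a: "bs.L2 a"
  shows "bs.energy a = form a a - umin u * ip a a"
proof -
  have [measurable]: "a \<in> borel_measurable borel" using a by (simp add: L2_iff)
  have "(\<integral>z. w z * (a z)\<^sup>2 \<partial>MM) = (\<integral>z. u z * (a z * a z) - umin u * (a z * a z) \<partial>MM)"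
    unfolding MM_TM
  proof (rule integral_cong_AE)
    show "AE z in TM. w z * (a z)\<^sup>2 = u z * (a z * a z) - umin u * (a z * a z)"
      using AE_TM_torus by eventually_elim (simp add: w_def power2_eq_square algebra_simps)
  qed (unfold borel_measurable_TM, measurable)
  also have "\<dots> = (\<integral>z. u z * (a z * a z) \<partial>MM) - umin u * ip a a"
    using u_mult_integrable[OF a a] L2_mult_integrable[OF a a] by simp
  finally show ?thesis by (simp add: bs.energy_def form_def power2_eq_square)
qed

definition "real_eigen x a \<longleftrightarrow> bs.L2 a \<and> \<not> (AE z in TM. a z = 0) \<and> (AE z in TM. Hr a z = x * a z)"

lemma Hr_meas:
  assumes "bs.L2 a" shows "Hr a \<in> borel_measurable MM"
proof -
  have [measurable]: "a \<in> borel_measurable MM" using assms by (simp add: bs.L2_def)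
  have [measurable]: "u \<in> borel_measurable MM" unfolding MM_TM by simp
  show ?thesis unfolding Hr_def[abs_def] by measurable
qed

text \<open>The extra term y c covers the coupled real equations that a complex eigenvalue imposes
  on the real and imaginary parts; y = 0 is the ordinary eigenvalue equation.\<close>

lemma eigen_form:
  assumes a: "bs.L2 a" and b: "bs.L2 b" and c: "bs.L2 c" and eq: "AE z in TM. Hr a z = x * a z + y * c z"
  shows "form a b = x * ip a b + y * ip c b"
proof -
  have [measurable]: "a \<in> borel_measurable MM" "b \<in> borel_measurable MM" "c \<in> borel_measurable MM" "Hr a \<in> borel_measurable MM"
    using a b c Hr_meas[OF a] by (simp_all add: bs.L2_def)
  have "form a b = (\<integral>z. Hr a z * b z \<partial>MM)" by (rule Hr_form[OF a b, symmetric])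
  also have "\<dots> = (\<integral>z. x * (a z * b z) + y * (c z * b z) \<partial>MM)"
  proof (rule integral_cong_AE)
    show "AE z in MM. Hr a z * b z = x * (a z * b z) + y * (c z * b z)"
      unfolding MM_TM using eq by eventually_elim (simp add: algebra_simps)
  qed measurable
  also have "\<dots> = x * ip a b + y * ip c b"
    using L2_mult_integrable[OF a b] L2_mult_integrable[OF c b] by simp
  finally show ?thesis .
qed

lemma ip_nonneg: "0 \<le> ip a a" by (rule integral_nonneg_AE) simp

lemma ip_zero:
  assumes a: "bs.L2 a" and "ip a a = 0"
  shows "AE z in TM. a z = 0"
proof -
  have "AE z in MM. a z * a z = 0"
    using assms integral_nonneg_eq_0_iff_AE[OF L2_mult_integrable[OF a a]] by simp
  then show ?thesis unfolding MM_TM by eventually_elim simp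
qed

section \<open>From complex eigenfunctions to real ones\<close>

lemma AE_swap: "AE z in TM. P (snd z, fst z)" if "AE z in TM. P z" for P :: "(real^3) \<times> (real^3) \<Rightarrow> bool"
proof -
  have "AE z in distr MM MM (\<lambda>(x, y). (y, x)). P z"
    using that by (subst bs.distr_pair_swap[symmetric]) (unfold MM_TM)
  then have "AE z in MM. P ((\<lambda>(x, y). (y, x)) z)"
    by (rule AE_distrD[rotated]) (rule measurable_pair_swap')
  then show ?thesis unfolding MM_TM by (simp add: case_prod_beta')
qed

lemma marginal_integral:
  fixes f :: "real^3 \<Rightarrow> complex" and a b \<phi> :: "real^3 \<Rightarrow> real"
  assumes [measurable]: "a \<in> borel_measurable borel" "b \<in> borel_measurable borel" "\<phi> \<in> borel_measurable borel"
    and f: "AE t in TM. f t = Complex (a t) (b t)"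
    and i: "integrable TM (\<lambda>t. \<phi> t * a t)" "integrable TM (\<lambda>t. \<phi> t * b t)"
  shows "(\<integral>t. complex_of_real (\<phi> t) * f t \<partial>(lebesgue_on torus_box)) =
    Complex (\<integral>t. \<phi> t * a t \<partial>TM) (\<integral>t. \<phi> t * b t \<partial>TM)"
proof -
  have "(\<integral>t. complex_of_real (\<phi> t) * f t \<partial>(lebesgue_on torus_box)) =
     (\<integral>t. complex_of_real (\<phi> t * a t) + \<i> * complex_of_real (\<phi> t * b t) \<partial>TM)"
  proof (rule lebesgue_on_torus_conv(3))
    show "AE t in TM. complex_of_real (\<phi> t) * f t = complex_of_real (\<phi> t * a t) + \<i> * complex_of_real (\<phi> t * b t)"
      using f by eventually_elim (simp add: complex_eq_iff)
  qed measurable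
  also have "\<dots> = (\<integral>t. complex_of_real (\<phi> t * a t) \<partial>TM) + \<i> * (\<integral>t. complex_of_real (\<phi> t * b t) \<partial>TM)"
    using integrable_of_real[OF i(1), where 'a=complex] integrable_of_real[OF i(2), where 'a=complex]
    by (simp del: of_real_mult)
  also have "\<dots> = Complex (\<integral>t. \<phi> t * a t \<partial>TM) (\<integral>t. \<phi> t * b t \<partial>TM)"
    by (simp add: complex_eq_iff del: of_real_mult)
  finally show ?thesis .
qed

text \<open>\<open>Hop\<close> integrates the given representative over sections in both variables;
  Fubini for null sets, in both orders of the coordinates, makes almost every section agree with the
  Borel one.\<close>

lemma Hop_Complex:
  assumes a: "bs.L2 a" and b: "bs.L2 b" and f: "AE z in TM. f z = Complex (a z) (b z)"
  shows "AE z in TM. Hop u \<phi>1 \<phi>2 \<mu>1 \<mu>2 f z = Complex (Hr a z) (Hr b z)"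
proof -
  have ab: "a \<in> borel_measurable borel" "b \<in> borel_measurable borel" using a b by (auto simp: L2_iff)
  have sec: "(\<lambda>t. c (t, q)) \<in> borel_measurable borel" "(\<lambda>t. c (q, t)) \<in> borel_measurable borel"
    if c: "c \<in> borel_measurable borel" for c :: "(real^3) \<times> (real^3) \<Rightarrow> real" and q
  proof -
    have "c \<in> borel_measurable (borel \<Otimes>\<^sub>M borel)" using c by (simp add: borel_prod)
    note [measurable] = this
    show "(\<lambda>t. c (t, q)) \<in> borel_measurable borel" "(\<lambda>t. c (q, t)) \<in> borel_measurable borel" by measurable
  qed
  have f2: "AE p in TM. AE t in TM. f (p, t) = Complex (a (p, t)) (b (p, t))"
    by (rule bs.AE_pair, unfold MM_TM, rule f)
  have f1: "AE q in TM. AE t in TM. f (t, q) = Complex (a (t, q)) (b (t, q))"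
  proof -
    have "AE z in MM. f (snd z, fst z) = Complex (a (snd z, fst z)) (b (snd z, fst z))"
      unfolding MM_TM by (rule AE_swap[OF f])
    from bs.AE_pair[OF this] show ?thesis by simp
  qed
  have 1: "AE q in TM. (\<integral>t. complex_of_real (\<phi>1 t) * f (t, q) \<partial>(lebesgue_on torus_box)) = Complex (bs.g1 a q) (bs.g1 b q)"
    using f1 bs.g_L2(3)[OF a] bs.g_L2(3)[OF b]
    by eventually_elim (unfold bs.g1_def, intro marginal_integral sec ab \<phi>_borel)
  have 2: "AE p in TM. (\<integral>t. complex_of_real (\<phi>2 t) * f (p, t) \<partial>(lebesgue_on torus_box)) = Complex (bs.g2 a p) (bs.g2 b p)"
    using f2 bs.g_L2(4)[OF a] bs.g_L2(4)[OF b]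
    by eventually_elim (unfold bs.g2_def, intro marginal_integral sec ab \<phi>_borel)
  show ?thesis
    using f bs.AE_pair_snd[OF 1, unfolded MM_TM] bs.AE_pair_fst[OF 2, unfolded MM_TM]
  proof eventually_elim
    case (elim z)
    then show ?case
      by (cases z) (simp add: Hop_def Hr_def complex_eq_iff)
  qed
qed

text \<open>With z = x + i y the parts satisfy H a = x a - y b and H b = x b + y a; the symmetry of
  the form gives y (|a|^2 + |b|^2) = 0, hence y = 0. Either part that is not null is then a real
  eigenfunction.\<close>

lemma real_eigenfunction:
  assumes "is_eigenvalue (Hop u \<phi>1 \<phi>2 \<mu>1 \<mu>2) z"
  obtains a where "z = complex_of_real (Re z)" "real_eigen (Re z) a"
proof -
  obtain f where f: "L2fun f" "\<not> (AE x in lebesgue_on T6. f x = 0)"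
    "AE x in lebesgue_on T6. Hop u \<phi>1 \<phi>2 \<mu>1 \<mu>2 f x = z * f x"
    using assms unfolding is_eigenvalue_def by blast
  have "f \<in> borel_measurable (lebesgue_on T6)" using f(1) by (simp add: L2fun_def)
  then obtain a b where ab[measurable]: "a \<in> borel_measurable borel" "b \<in> borel_measurable borel"
    and fab: "AE x in TM. f x = Complex (a x) (b x)"
    by (rule lebesgue_on_torus_complex_representative)
  have "AE x in TM. (cmod (f x))\<^sup>2 = (a x)\<^sup>2 + (b x)\<^sup>2"
    using fab by eventually_elim (simp add: cmod_power2)
  then have i: "integrable TM (\<lambda>x. (a x)\<^sup>2 + (b x)\<^sup>2)"
    using f(1) lebesgue_on_torus_conv(2)[of "\<lambda>x. (a x)\<^sup>2 + (b x)\<^sup>2" "\<lambda>x. (cmod (f x))\<^sup>2"] by (simp add: L2fun_def)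
  have La: "bs.L2 a" unfolding L2_iff
    by (intro conjI ab Bochner_Integration.integrable_bound[OF i]) (auto intro!: AE_I2)
  have Lb: "bs.L2 b" unfolding L2_iff
    by (intro conjI ab Bochner_Integration.integrable_bound[OF i]) (auto intro!: AE_I2)
  define x y where "x = Re z" and "y = Im z"
  have eq: "AE t in TM. Complex (Hr a t) (Hr b t) = z * Complex (a t) (b t)"
    using Hop_Complex[OF La Lb fab] f(3)[unfolded AE_lebesgue_on_torus] fab by eventually_elim simp
  have Ha: "AE t in TM. Hr a t = x * a t + (- y) * b t"
    using eq by eventually_elim (simp add: complex_eq_iff x_def y_def)
  have Hb: "AE t in TM. Hr b t = x * b t + y * a t"
    using eq by eventually_elim (simp add: complex_eq_iff x_def y_def)
  have "form a b = x * ip a b + (- y) * ip b b" by (rule eigen_form[OF La Lb Lb Ha])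
  moreover have "form b a = x * ip b a + y * ip a a" by (rule eigen_form[OF Lb La La Hb])
  moreover have "ip b a = ip a b" by (simp add: mult.commute)
  ultimately have y0: "y * (ip a a + ip b b) = 0" using form_sym[of a b] by (simp add: algebra_simps)
  have ne: "\<not> (AE t in TM. a t = 0) \<or> \<not> (AE t in TM. b t = 0)"
  proof (rule ccontr)
    assume "\<not> ?thesis"
    then have "AE t in TM. a t = 0" "AE t in TM. b t = 0" by auto
    then have "AE t in TM. f t = 0" using fab by eventually_elim (simp add: complex_eq_iff)
    with f(2) show False by (simp add: AE_lebesgue_on_torus)
  qed
  have "ip a a + ip b b \<noteq> 0"
    using ne ip_zero[OF La] ip_zero[OF Lb] ip_nonneg[of a] ip_nonneg[of b] by (smt (verit))
  with y0 have y: "y = 0" by simp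
  have z: "z = complex_of_real (Re z)" using y by (simp add: y_def complex_eq_iff)
  from ne show ?thesis
  proof
    assume "\<not> (AE t in TM. a t = 0)"
    then have "real_eigen (Re z) a" using La Ha y by (simp add: real_eigen_def x_def)
    with z show ?thesis by (rule that)
  next
    assume "\<not> (AE t in TM. b t = 0)"
    then have "real_eigen (Re z) b" using Lb Hb y by (simp add: real_eigen_def x_def)
    with z show ?thesis by (rule that)
  qed
qed

section \<open>Position of the eigenvalues and the count\<close>

lemma convex_torus_box: "convex (torus_box :: 'a::euclidean_space set)"
proof -
  have "torus_box = (\<Inter>b\<in>Basis. {x::'a. b \<bullet> x > - pi} \<inter> {x. b \<bullet> x \<le> pi})"
    by (auto simp: torus_box_def inner_commute)
  also have "convex \<dots>"
    by (intro convex_INT convex_Int convex_halfspace_gt convex_halfspace_le)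
  finally show ?thesis .
qed

text \<open>The torus is connected, so a value x >= m that u misses exceeds u everywhere. The
  subtracted potentials are nonnegative, so x |a|^2 is at most the integral of u a^2, which forces a
  = 0 almost everywhere.\<close>

lemma real_eigen_below:
  assumes e: "real_eigen x a" and x: "x \<notin> u ` torus_box"
  shows "x < umin u"
proof (rule ccontr)
  assume "\<not> x < umin u"
  then have "u 0 \<le> x" by (simp add: hyp_H1_umin[OF u])
  have z0: "0 \<in> (torus_box :: ((real^3) \<times> (real^3)) set)" by (simp add: torus_box_def)
  have con: "connected (u ` torus_box)"
    by (intro connected_continuous_image continuous_on_subset[OF u_cont] convex_connected convex_torus_box) auto
  have lt: "u z < x" if z: "z \<in> torus_box" for z
  proof (rule ccontr)
    assume "\<not> u z < x"
    then have "x \<in> {u 0..u z}" using \<open>u 0 \<le> x\<close> by simp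
    then have "x \<in> u ` torus_box"
      using connected_contains_Icc[OF con, of "u 0" "u z"] z0 z by blast
    with x show False by blast
  qed
  have a: "bs.L2 a" and ne: "\<not> (AE z in TM. a z = 0)" and eq: "AE z in TM. Hr a z = x * a z"
    using e by (auto simp: real_eigen_def)
  have [measurable]: "a \<in> borel_measurable borel" using a by (simp add: L2_iff)
  have "form a a = x * ip a a + 0 * ip a a" by (rule eigen_form[OF a a a]) (use eq in simp)
  then have f: "form a a = x * ip a a" by simp
  have "x * ip a a \<le> (\<integral>z. u z * (a z * a z) \<partial>MM)"
  proof -
    have "0 \<le> (\<integral>q. bs.g1 a q * bs.g1 a q \<partial>TM)" "0 \<le> (\<integral>p. bs.g2 a p * bs.g2 a p \<partial>TM)"
      by (rule integral_nonneg_AE, simp)+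
    then have "0 \<le> \<mu>1 * (\<integral>q. bs.g1 a q * bs.g1 a q \<partial>TM)" "0 \<le> \<mu>2 * (\<integral>p. bs.g2 a p * bs.g2 a p \<partial>TM)"
      using \<mu>1_pos \<mu>2_pos by simp_all
    then show ?thesis unfolding f[symmetric] form_def by linarith
  qed
  then have le: "(\<integral>z. x * (a z * a z) - u z * (a z * a z) \<partial>MM) \<le> 0"
    using u_mult_integrable[OF a a] L2_mult_integrable[OF a a] by simp
  have nn: "AE z in MM. 0 \<le> x * (a z * a z) - u z * (a z * a z)"
    unfolding MM_TM using AE_TM_torus
  proof eventually_elim
    case (elim z)
    have "u z * (a z * a z) \<le> x * (a z * a z)" using lt[OF elim] by (intro mult_right_mono) auto
    then show ?case by simp
  qed
  have int: "integrable MM (\<lambda>z. x * (a z * a z) - u z * (a z * a z))"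
    using u_mult_integrable[OF a a] L2_mult_integrable[OF a a] by simp
  have "AE z in MM. x * (a z * a z) - u z * (a z * a z) = 0"
    using integral_nonneg_eq_0_iff_AE[OF int nn] le integral_nonneg_AE[OF nn] by linarith
  then have "AE z in TM. a z = 0"
    unfolding MM_TM using AE_TM_torus
  proof eventually_elim
    case (elim z)
    then have "(x - u z) * (a z * a z) = 0" by (simp add: algebra_simps)
    then show ?case using lt[of z] elim(2) by simp
  qed
  with ne show False by contradiction
qed

lemma form_sum:
  fixes f :: "nat \<Rightarrow> (real^3) \<times> (real^3) \<Rightarrow> real" and N :: nat
  assumes f: "\<And>i. bs.L2 (f i)"
  shows "bs.energy (\<lambda>z. \<Sum>i<N. c i * f i z) = (\<Sum>i<N. \<Sum>j<N. c i * c j * (form (f i) (f j) - umin u * ip (f i) (f j)))"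
proof -
  let ?F = "\<lambda>z. \<Sum>i<N. c i * f i z"
  have F: "bs.L2 ?F" using f by (intro bs.L2_sum) auto
  have [measurable]: "f i \<in> borel_measurable MM" for i using f by (simp add: bs.L2_def)
  have [measurable]: "?F \<in> borel_measurable MM" using F by (simp add: bs.L2_def)
  have "ip ?F ?F = (\<Sum>i<N. \<Sum>j<N. c i * c j * ip (f i) (f j))"
    by (intro integral_bilinear_sum L2_mult_integrable f) auto
  moreover have "(\<integral>z. u z * (?F z * ?F z) \<partial>MM) = (\<Sum>i<N. \<Sum>j<N. c i * c j * (\<integral>z. u z * (f i z * f j z) \<partial>MM))"
  proof -
    have eq: "(\<lambda>z. u z * (?F z * ?F z)) = (\<lambda>z. (\<Sum>i<N. c i * (u z * f i z)) * (\<Sum>j<N. c j * f j z))"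
      by (simp add: sum_distrib_left mult_ac)
    have "(\<integral>z. (\<Sum>i<N. c i * (u z * f i z)) * (\<Sum>j<N. c j * f j z) \<partial>MM)
        = (\<Sum>i<N. \<Sum>j<N. c i * c j * (\<integral>z. (u z * f i z) * f j z \<partial>MM))"
      using u_mult_integrable[OF f f] by (intro integral_bilinear_sum) (auto simp: mult.assoc)
    then show ?thesis unfolding eq by (simp only: mult.assoc)
  qed
  moreover have "(\<integral>q. bs.g1 ?F q * bs.g1 ?F q \<partial>TM) = (\<Sum>i<N. \<Sum>j<N. c i * c j * (\<integral>q. bs.g1 (f i) q * bs.g1 (f j) q \<partial>TM))"
  proof -
    have "(\<integral>q. bs.g1 ?F q * bs.g1 ?F q \<partial>TM) = (\<integral>q. (\<Sum>i<N. c i * bs.g1 (f i) q) * (\<Sum>j<N. c j * bs.g1 (f j) q) \<partial>TM)"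
    proof (rule integral_cong_AE)
      show "AE q in TM. bs.g1 ?F q * bs.g1 ?F q = (\<Sum>i<N. c i * bs.g1 (f i) q) * (\<Sum>j<N. c j * bs.g1 (f j) q)"
        using bs.g_sum(1)[of "{..<N}" f c] f by (auto elim!: eventually_mono)
    qed measurable
    also have "\<dots> = (\<Sum>i<N. \<Sum>j<N. c i * c j * (\<integral>q. bs.g1 (f i) q * bs.g1 (f j) q \<partial>TM))"
      using bs.g_L2(1)[OF f] by (intro integral_bilinear_sum integrable_mult_of_squares) auto
    finally show ?thesis .
  qed
  moreover have "(\<integral>q. bs.g2 ?F q * bs.g2 ?F q \<partial>TM) = (\<Sum>i<N. \<Sum>j<N. c i * c j * (\<integral>q. bs.g2 (f i) q * bs.g2 (f j) q \<partial>TM))"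
  proof -
    have "(\<integral>q. bs.g2 ?F q * bs.g2 ?F q \<partial>TM) = (\<integral>q. (\<Sum>i<N. c i * bs.g2 (f i) q) * (\<Sum>j<N. c j * bs.g2 (f j) q) \<partial>TM)"
    proof (rule integral_cong_AE)
      show "AE q in TM. bs.g2 ?F q * bs.g2 ?F q = (\<Sum>i<N. c i * bs.g2 (f i) q) * (\<Sum>j<N. c j * bs.g2 (f j) q)"
        using bs.g_sum(2)[of "{..<N}" f c] f by (auto elim!: eventually_mono)
    qed measurable
    also have "\<dots> = (\<Sum>i<N. \<Sum>j<N. c i * c j * (\<integral>q. bs.g2 (f i) q * bs.g2 (f j) q \<partial>TM))"
      using bs.g_L2(2)[OF f] by (intro integral_bilinear_sum integrable_mult_of_squares) auto
    finally show ?thesis .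
  qed
  ultimately show ?thesis
    unfolding energy_form[OF F] form_def
    by (simp add: sum_distrib_left sum_subtractf[symmetric] algebra_simps)
qed

text \<open>Eigenfunctions of distinct eigenvalues are orthogonal, so the energy of a combination is
  diagonal, with entries (x i - m) |g i|^2 < 0.\<close>

lemma eigenvalue_count:
  assumes e: "\<And>i. i < N \<Longrightarrow> real_eigen (x i) (f i)" and below: "\<And>i. i < N \<Longrightarrow> x i < umin u"
    and inj: "inj_on x {..<N}"
  shows "real N \<le> (\<integral>z. (bs.K z)\<^sup>2 \<partial>MM)"
proof -
  \<comment> \<open>Continued by 0 because the dimension bound asks for a square integrable function
    at every index.\<close>
  define g where "g i = (if i < N then f i else (\<lambda>_. 0))" for i
  have L: "bs.L2 (g i)" for i using e[of i] by (auto simp: g_def real_eigen_def L2_iff)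
  have eig: "form (g i) b = x i * ip (g i) b" if "i < N" "bs.L2 b" for i b
    using eigen_form[OF L[of i] that(2) L[of i], of "x i" 0] e[OF that(1)] that(1) by (simp add: g_def real_eigen_def)
  have orth: "ip (g i) (g j) = 0" if "i < N" "j < N" "i \<noteq> j" for i j
  proof -
    have "x i * ip (g i) (g j) = x j * ip (g j) (g i)"
      using eig[OF that(1) L[of j]] eig[OF that(2) L[of i]] form_sym[of "g i" "g j"] by simp
    moreover have "ip (g j) (g i) = ip (g i) (g j)" by (simp add: mult.commute)
    moreover have "x i \<noteq> x j" using inj that by (auto simp: inj_on_def)
    ultimately show ?thesis by simp
  qed
  have pos: "0 < ip (g i) (g i)" if "i < N" for i
  proof -
    have "ip (g i) (g i) \<noteq> 0" using ip_zero[OF L[of i]] e[OF that] that by (auto simp: g_def real_eigen_def)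
    then show ?thesis using ip_nonneg[of "g i"] by linarith
  qed
  show ?thesis
  proof (rule bs.negative_energy_dimension_bound[OF K_square_integrable L])
    fix c :: "nat \<Rightarrow> real" assume c: "\<exists>i<N. c i \<noteq> 0"
    have "bs.energy (\<lambda>z. \<Sum>i<N. c i * g i z) = (\<Sum>i<N. \<Sum>j<N. c i * c j * (form (g i) (g j) - umin u * ip (g i) (g j)))"
      by (rule form_sum[OF L])
    also have "\<dots> = (\<Sum>i<N. \<Sum>j<N. if i = j then (c i)\<^sup>2 * ((x i - umin u) * ip (g i) (g i)) else 0)"
    proof (intro sum.cong refl)
      fix i j assume "i \<in> {..<N}" "j \<in> {..<N}"
      then have ij: "i < N" "j < N" by auto
      have "form (g i) (g j) - umin u * ip (g i) (g j) = (x i - umin u) * ip (g i) (g j)"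
        unfolding eig[OF ij(1) L] by (simp add: algebra_simps)
      then show "c i * c j * (form (g i) (g j) - umin u * ip (g i) (g j)) = (if i = j then (c i)\<^sup>2 * ((x i - umin u) * ip (g i) (g i)) else 0)"
        using orth[OF ij] by (cases "i = j") (simp_all add: power2_eq_square)
    qed
    also have "\<dots> = (\<Sum>i<N. (c i)\<^sup>2 * ((x i - umin u) * ip (g i) (g i)))" by simp
    also have "\<dots> < 0"
    proof -
      have le: "(c i)\<^sup>2 * ((x i - umin u) * ip (g i) (g i)) \<le> 0" if "i < N" for i
        using below[OF that] ip_nonneg[of "g i"] by (intro mult_nonneg_nonpos mult_nonpos_nonneg) auto
      obtain i where i: "i < N" "c i \<noteq> 0" using c by blast
      have "(c i)\<^sup>2 * ((x i - umin u) * ip (g i) (g i)) < 0"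
        using i below[OF i(1)] pos[OF i(1)] by (intro mult_pos_neg mult_neg_pos) auto
      moreover have "(\<Sum>i<N. (c i)\<^sup>2 * ((x i - umin u) * ip (g i) (g i)))
          \<le> (c i)\<^sup>2 * ((x i - umin u) * ip (g i) (g i))"
        using i le by (subst sum.remove[of _ i]) (auto intro!: sum_nonpos)
      ultimately show ?thesis by linarith
    qed
    finally show "bs.energy (\<lambda>z. \<Sum>i<N. c i * g i z) < 0" .
  qed
qed

theorem finite_discrete_eigenvalues:
  "finite {z. is_eigenvalue (Hop u \<phi>1 \<phi>2 \<mu>1 \<mu>2) z \<and> z \<notin> ess_spectrum (Hop u \<phi>1 \<phi>2 \<mu>1 \<mu>2)}" (is "finite ?S")
proof -
  define B where "B = nat \<lceil>\<integral>z. (bs.K z)\<^sup>2 \<partial>MM\<rceil>"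
  \<comment> \<open>Finiteness follows from one bound on the cardinality of all finite subsets; each
    eigenvalue is represented by one real eigenfunction.\<close>
  have "card F \<le> B" if F: "F \<subseteq> ?S" "finite F" for F
  proof -
    obtain h where h: "bij_betw h {..<card F} F"
      using ex_bij_betw_nat_finite[OF F(2)] by (auto simp: atLeast0LessThan)
    have ex: "\<exists>a. h i = complex_of_real (Re (h i)) \<and> real_eigen (Re (h i)) a \<and> Re (h i) < umin u" if i: "i < card F" for i
    proof -
      have hi: "h i \<in> ?S" using h F(1) i by (auto simp: bij_betw_def)
      obtain a where a: "h i = complex_of_real (Re (h i))" "real_eigen (Re (h i)) a"
        by (rule real_eigenfunction[of "h i"]) (use hi in auto)
      \<comment> \<open>The only point at which lying outside the essential spectrum is
        used.\<close>
      have "Re (h i) \<notin> u ` torus_box"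
      proof
        assume "Re (h i) \<in> u ` torus_box"
        then obtain x0 where x0: "x0 \<in> torus_box" "Re (h i) = u x0" by blast
        have "h i \<in> ess_spectrum (Hop u \<phi>1 \<phi>2 \<mu>1 \<mu>2)"
          using Weyl_range_in_ess_spectrum[OF u_cont \<phi>_cont x0(1)] x0(2) a(1) by metis
        with hi show False by simp
      qed
      with a show ?thesis using real_eigen_below by blast
    qed
    then obtain f where f: "\<And>i. i < card F \<Longrightarrow> h i = complex_of_real (Re (h i)) \<and> real_eigen (Re (h i)) (f i) \<and> Re (h i) < umin u"
      by metis
    have "inj_on (\<lambda>i. Re (h i)) {..<card F}"
    proof (rule inj_onI)
      fix i j assume ij: "i \<in> {..<card F}" "j \<in> {..<card F}" "Re (h i) = Re (h j)"
      then have "h i = h j" using f[of i] f[of j] by (metis lessThan_iff)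
      then show "i = j" using h ij by (auto simp: bij_betw_def inj_on_def)
    qed
    then have "real (card F) \<le> (\<integral>z. (bs.K z)\<^sup>2 \<partial>MM)"
      using f by (intro eigenvalue_count) auto
    then show ?thesis unfolding B_def by linarith
  qed
  then show ?thesis by (rule finite_if_finite_subsets_card_bdd[THEN conjunct1, rotated]) auto
qed

end

theorem mainTheorem1:
  fixes u :: "(real^3) \<times> (real^3) \<Rightarrow> real"
    and \<phi>1 \<phi>2 :: "real^3 \<Rightarrow> real"
    and \<mu>1 \<mu>2 :: real
  assumes "hyp_H1 u"
    and "hyp_H2 \<phi>1" and "hyp_H2 \<phi>2"
    and "hyp_H3 u \<phi>1 1" and "hyp_H3 u \<phi>2 2"
    and "\<mu>1 > 0" and "\<mu>2 > 0"
    and "\<mu>1 = mu0 u \<phi>1 1" and "\<mu>2 = mu0 u \<phi>2 2"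
    and "\<phi>1 0 * \<phi>2 0 = 0"
  shows "finite {z. is_eigenvalue (Hop u \<phi>1 \<phi>2 \<mu>1 \<mu>2) z \<and> z \<notin> ess_spectrum (Hop u \<phi>1 \<phi>2 \<mu>1 \<mu>2)}"
proof -
  interpret lattice_model u \<phi>1 \<phi>2 \<mu>1 \<mu>2
    by (rule lattice_model.intro) fact+
  show ?thesis by (rule finite_discrete_eigenvalues)
qed

end
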